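(* Let $S(q)=S^0+\varphi^i q_i+S^{ij}q_iq_j+S^{ijk}q_iq_jq_k+\cdots$ be a formal power series in $q=(q_1,\dots,q_d)$ with symmetric coefficients, and let $G:\mathbb{R}^d\to\mathbb{R}$ be smooth. Let $$I(S,G)=\int dy\,\frac{dq}{(2\pi\hbar)^d}\;e^{\frac{i}{\hbar}\left(S(q)+G(y)-y^\alpha q_\alpha\right)},$$ the integration being over $y\in\mathbb{R}^d$ and $q$ in its dual. Then $I(S,G)$ has the following expansion over bipartite graphs: $$I(S,G)=\exp\left(\frac{i}{\hbar}\sum_{\gamma\in[\Gamma^\circ]}\frac{1}{|\mathrm{sym}(\gamma)|}\left(\frac{\hbar}{i}\right)^{b_\gamma}\langle S,G;\gamma\rangle\right).$$
   Context: Repeated indices are summed from $1$ to $d$. $S^{a_1\dots a_m}$ denotes the coefficient of $q_{a_1}\cdots q_{a_m}$ in $S$, symmetric in its indices; $S^i=\varphi^i$, the coefficient without indices is $S^0$, and $\varphi=(\varphi^1,\dots,\varphi^d)\in\mathbb{R}^d$. Coefficients of $S$ and $G$ may depend on suppressed parameters. Formal meaning of the integral: writing $S=S^0+\varphi^iq_i+S^+(q)$ with $S^+$ of order $\ge 2$ in $q$, the factor $e^{\frac{i}{\hbar}S^+(q)}$ is expanded as a formal power series in $q$, and each resulting term $\int \frac{dq}{(2\pi\hbar)^d}\,e^{\frac{i}{\hbar}\varphi^iq_i}\,q_{a_1}\cdots q_{a_m}\int dy\,e^{-\frac{i}{\hbar}y^\alpha q_\alpha}e^{\frac{i}{\hbar}G(y)}$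 is understood as the inverse Fourier transform, evaluated at $\varphi$, of the polynomial times the Fourier transform of $e^{\frac i\hbar G}$ (in the sense of tempered distributions). Equalities are equalities of formal series, compared degree by degree, where $S^{a_1\dots a_m}$ with $m\ge2$ has degree $m$. A bipartite graph is $\gamma=(B_\gamma,W_\gamma,E_\gamma)$ with black vertices $B_\gamma=\{1,\dots,n\}$, white vertices $W_\gamma=\{-1,\dots,-m\}$ and a finite multiset $E_\gamma$ of elements of $B_\gamma\times W_\gamma$ (edges; multiple edges are allowed, but parallel edges are not distinguished). $|\gamma|$ is the number of vertices and $b_\gamma:=|E_\gamma|-|\gamma|+1$. An isomorphism is a pair of permutations of the black and the white vertices preserving edge multiplicities; $\mathrm{sym}(\gamma)$ is the group of automorphisms (permutations of parallel edges are not counted). $\Gamma^\circ$ is the set of (nonempty) connected bipartite graphs all of whose leaves (vertices attached to exactly one edge) are white; it contains the one-vertex graphs $\bullet$ and $\circ$. $[\Gamma^\circ]$ is its set of isomorphism classes. For a vertex $v$ let $e^v_1,\dots,e^v_{m_v}$ be the edges attached to it, and for a black vertex $v$ let $k^v_i$ be the number of white vertices with which $v$ shares exactly $i$ edges. Using edges (each copy separately) as dummy summation indices, define $$\langle S,G;\gamma\rangle:=\Big(\prod_{v\in B_\gamma}\frac{m_v!}{(1!)^{k^v_1}(2!)^{k^v_2}\cdots(m_v!)^{k^v_{m_v}}}S^{e^v_1\dots e^v_{m_v}}\Big)\Big(\prod_{w\in W_\gamma}\frac{\partial}{\partial y^{e^w_1}}\cdots\frac{\partial}{\partial y^{e^w_{m_w}}}G(\varphi)\Big),$$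 so $\langle S,G;\bullet\rangle=S^0$, $\langle S,G;\circ\rangle=G(\varphi)$. *)

theory Defs
  imports
    "HOL-Analysis.Analysis"
    "HOL-Computational_Algebra.Computational_Algebra"
    "HOL-Combinatorics.Combinatorics"
begin

subsection \<open>Smooth functions, Schwartz functions, tempered distributions\<close>

definition partial :: "'d::finite \<Rightarrow> (real^'d \<Rightarrow> 'b::real_normed_vector) \<Rightarrow> real^'d \<Rightarrow> 'b" where
  "partial i f x = frechet_derivative f (at x) (axis i 1)"

fun partials :: "'d::finite list \<Rightarrow> (real^'d \<Rightarrow> 'b::real_normed_vector) \<Rightarrow> real^'d \<Rightarrow> 'b" where
  "partials [] f = f"
| "partials (i # is) f = partial i (partials is f)"

definition smooth :: "(real^'d::finite \<Rightarrow> 'b::real_normed_vector) \<Rightarrow> bool" where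
  "smooth f \<longleftrightarrow> (\<forall>is x. partials is f differentiable (at x))"

definition schwartz :: "(real^'d::finite \<Rightarrow> complex) \<Rightarrow> bool" where
  "schwartz \<psi> \<longleftrightarrow> smooth \<psi> \<and>
     (\<forall>k is. bounded (range (\<lambda>x. (1 + norm x) ^ k *\<^sub>R partials is \<psi> x)))"

definition schwartz_norm :: "nat \<Rightarrow> (real^'d::finite \<Rightarrow> complex) \<Rightarrow> real" where
  "schwartz_norm k \<psi> =
     (\<Sum>is | length is \<le> k. SUP x. (1 + norm x) ^ k * norm (partials is \<psi> x))"

definition test_function :: "(real^'d::finite \<Rightarrow> complex) \<Rightarrow> bool" where
  "test_function \<psi> \<longleftrightarrow> smooth \<psi> \<and> compact (closure {x. \<psi> x \<noteq> 0})"

text \<open>Distributions are functionals on functions, written as total HOL functions; only their values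
  on Schwartz functions matter.\<close>

type_synonym 'd distr = "(real^'d \<Rightarrow> complex) \<Rightarrow> complex"

definition tempered :: "'d::finite distr \<Rightarrow> bool" where
  "tempered T \<longleftrightarrow>
     (\<forall>\<psi> \<eta>. schwartz \<psi> \<longrightarrow> schwartz \<eta> \<longrightarrow> T (\<lambda>x. \<psi> x + \<eta> x) = T \<psi> + T \<eta>) \<and>
     (\<forall>c \<psi>. schwartz \<psi> \<longrightarrow> T (\<lambda>x. c * \<psi> x) = c * T \<psi>) \<and>
     (\<exists>C k. \<forall>\<psi>. schwartz \<psi> \<longrightarrow> norm (T \<psi>) \<le> C * schwartz_norm k \<psi>)"

definition distr_of :: "(real^'d::finite \<Rightarrow> complex) \<Rightarrow> 'd distr" where
  "distr_of u \<psi> = (LINT y|lborel. u y * \<psi> y)"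

definition mult_distr :: "(real^'d::finite \<Rightarrow> complex) \<Rightarrow> 'd distr \<Rightarrow> 'd distr" where
  "mult_distr p T \<psi> = T (\<lambda>q. p q * \<psi> q)"

text \<open>Throughout, \<open>h\<close> stands for the reduced Planck constant.\<close>

definition fourier :: "real \<Rightarrow> (real^'d::finite \<Rightarrow> complex) \<Rightarrow> real^'d \<Rightarrow> complex" where
  "fourier h \<psi> q = (LINT y|lborel. exp (- (\<i> / of_real h) * of_real (y \<bullet> q)) * \<psi> y)"

definition inv_fourier :: "real \<Rightarrow> (real^'d::finite \<Rightarrow> complex) \<Rightarrow> real^'d \<Rightarrow> complex" where
  "inv_fourier h \<psi> y =
     (LINT q|lborel. exp ((\<i> / of_real h) * of_real (y \<bullet> q)) * \<psi> q)
       / of_real ((2 * pi * h) ^ CARD('d))"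

definition fourier_distr :: "real \<Rightarrow> 'd::finite distr \<Rightarrow> 'd distr" where
  "fourier_distr h T \<psi> = T (fourier h \<psi>)"

definition inv_fourier_distr :: "real \<Rightarrow> 'd::finite distr \<Rightarrow> 'd distr" where
  "inv_fourier_distr h T \<psi> = T (inv_fourier h \<psi>)"

text \<open>A tempered distribution that is a continuous function. Since the function need not be of
  polynomial growth, it is compared with the distribution on compactly supported test functions
  only; as these are dense among the Schwartz functions, this determines the distribution.\<close>

definition is_function :: "'d::finite distr \<Rightarrow> (real^'d \<Rightarrow> complex) \<Rightarrow> bool" where
  "is_function T f \<longleftrightarrow> tempered T \<and> continuous_on UNIV f \<and>
     (\<forall>\<psi>. test_function \<psi> \<longrightarrow> T \<psi> = distr_of f \<psi>)"

definition distr_eval :: "'d::finite distr \<Rightarrow> real^'d \<Rightarrow> complex" where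
  "distr_eval T x = (THE f. is_function T f) x"


subsection \<open>The formal oscillatory integral\<close>

text \<open>\<open>S [a\<^sub>1, \<dots>, a\<^sub>m]\<close> is the coefficient of the word \<open>q\<^sub>a\<^sub>1 \<dots> q\<^sub>a\<^sub>m\<close>, all words being summed over.\<close>

definition symmetric_coeffs :: "('d list \<Rightarrow> complex) \<Rightarrow> bool" where
  "symmetric_coeffs S \<longleftrightarrow> (\<forall>as bs. mset as = mset bs \<longrightarrow> S as = S bs)"

definition lin_part :: "('d::finite list \<Rightarrow> complex) \<Rightarrow> real^'d" where
  "lin_part S = (\<chi> i. Re (S [i]))"

text \<open>Formal series graded by degree are power series in a bookkeeping variable \<open>t\<close> that replaces
  \<open>S [a\<^sub>1, \<dots>, a\<^sub>m]\<close> by \<open>t ^ m * S [a\<^sub>1, \<dots>, a\<^sub>m]\<close> for \<open>m \<ge> 2\<close>. With the terms of order at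
  least 2 of \<open>S\<close> this amounts to substituting \<open>t * q\<close> for \<open>q\<close>, so that the degree is also the
  degree in \<open>q\<close>.\<close>

definition S_plus :: "('d::finite list \<Rightarrow> complex) \<Rightarrow> real^'d \<Rightarrow> complex fps" where
  "S_plus S q = Abs_fps (\<lambda>m. if m \<ge> 2
     then (\<Sum>as | length as = m. S as * (\<Prod>a\<leftarrow>as. of_real (vec_nth q a))) else 0)"

text \<open>The homogeneous polynomial in \<open>q\<close> of degree \<open>n\<close> in the expansion of \<open>exp (\<i> / h * S\<^sup>+ q)\<close>.\<close>

definition exp_S_plus :: "real \<Rightarrow> ('d::finite list \<Rightarrow> complex) \<Rightarrow> nat \<Rightarrow> real^'d \<Rightarrow> complex" where
  "exp_S_plus h S n q = fps_nth (fps_exp (\<i> / of_real h) oo S_plus S q) n"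

definition formal_integral ::
    "real \<Rightarrow> ('d::finite list \<Rightarrow> complex) \<Rightarrow> (real^'d \<Rightarrow> real) \<Rightarrow> complex fps" where
  "formal_integral h S G = Abs_fps (\<lambda>n. exp ((\<i> / of_real h) * S []) *
     distr_eval
       (inv_fourier_distr h (mult_distr (exp_S_plus h S n)
          (fourier_distr h (distr_of (\<lambda>y. exp ((\<i> / of_real h) * of_real (G y)))))))
       (lin_part S))"

text \<open>Exponential of a formal series whose constant term need not vanish.\<close>

definition formal_exp :: "complex fps \<Rightarrow> complex fps" where
  "formal_exp F =
     fps_const (exp (fps_nth F 0)) * (fps_exp 1 oo (F - fps_const (fps_nth F 0)))"


subsection \<open>Bipartite graphs\<close>

record bigraph =
  nblack :: nat
  nwhite :: nat
  edges :: "(int \<times> int) multiset"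

definition black :: "bigraph \<Rightarrow> int set" where
  "black \<gamma> = {1..int (nblack \<gamma>)}"

definition white :: "bigraph \<Rightarrow> int set" where
  "white \<gamma> = {- int (nwhite \<gamma>)..-1}"

definition vertices :: "bigraph \<Rightarrow> int set" where
  "vertices \<gamma> = black \<gamma> \<union> white \<gamma>"

definition bipartite_graph :: "bigraph \<Rightarrow> bool" where
  "bipartite_graph \<gamma> \<longleftrightarrow> set_mset (edges \<gamma>) \<subseteq> black \<gamma> \<times> white \<gamma>"

text \<open>The copies of an edge of multiplicity \<open>k\<close> are numbered \<open>0, \<dots>, k - 1\<close>.\<close>

type_synonym edge_copy = "(int \<times> int) \<times> nat"

definition edge_copies :: "bigraph \<Rightarrow> edge_copy set" where
  "edge_copies \<gamma> = {(e, j). j < count (edges \<gamma>) e}"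

definition attached :: "bigraph \<Rightarrow> int \<Rightarrow> edge_copy set" where
  "attached \<gamma> v = {((b, w), j) \<in> edge_copies \<gamma>. b = v \<or> w = v}"

definition vdeg :: "bigraph \<Rightarrow> int \<Rightarrow> nat" where
  "vdeg \<gamma> v = card (attached \<gamma> v)"

text \<open>An enumeration \<open>e\<^sub>1, \<dots>, e\<^sub>m\<close> of the edges attached to \<open>v\<close>; the order is immaterial by symmetry
  of coefficients and of partial derivatives.\<close>

definition edge_list :: "bigraph \<Rightarrow> int \<Rightarrow> edge_copy list" where
  "edge_list \<gamma> v = (SOME es. distinct es \<and> set es = attached \<gamma> v)"

definition connected_graph :: "bigraph \<Rightarrow> bool" where
  "connected_graph \<gamma> \<longleftrightarrow> vertices \<gamma> \<noteq> {} \<and>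
     (\<forall>u\<in>vertices \<gamma>. \<forall>v\<in>vertices \<gamma>.
        (u, v) \<in> (set_mset (edges \<gamma>) \<union> (set_mset (edges \<gamma>))\<inverse>)\<^sup>*)"

definition Gamma_circ :: "bigraph set" where
  "Gamma_circ = {\<gamma>. bipartite_graph \<gamma> \<and> connected_graph \<gamma> \<and>
     (\<forall>v\<in>vertices \<gamma>. vdeg \<gamma> v = 1 \<longrightarrow> v \<in> white \<gamma>)}"

definition isomorphisms :: "bigraph \<Rightarrow> bigraph \<Rightarrow> ((int \<Rightarrow> int) \<times> (int \<Rightarrow> int)) set" where
  "isomorphisms \<gamma> \<gamma>' = {(\<sigma>, \<tau>).
     nblack \<gamma> = nblack \<gamma>' \<and> nwhite \<gamma> = nwhite \<gamma>' \<and>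
     \<sigma> permutes black \<gamma> \<and> \<tau> permutes white \<gamma> \<and>
     (\<forall>b\<in>black \<gamma>. \<forall>w\<in>white \<gamma>. count (edges \<gamma>') (\<sigma> b, \<tau> w) = count (edges \<gamma>) (b, w))}"

definition automorphisms :: "bigraph \<Rightarrow> ((int \<Rightarrow> int) \<times> (int \<Rightarrow> int)) set" where
  "automorphisms \<gamma> = isomorphisms \<gamma> \<gamma>"

definition Gamma_circ_classes :: "bigraph set set" where
  "Gamma_circ_classes =
     Gamma_circ // {(\<gamma>, \<gamma>'). \<gamma> \<in> Gamma_circ \<and> \<gamma>' \<in> Gamma_circ \<and> isomorphisms \<gamma> \<gamma>' \<noteq> {}}"

definition betti :: "bigraph \<Rightarrow> int" where
  "betti \<gamma> = int (size (edges \<gamma>)) - int (card (vertices \<gamma>)) + 1"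

text \<open>Degree, in the coefficients of order at least 2 of \<open>S\<close>, of the contribution of a graph.\<close>

definition graph_degree :: "bigraph \<Rightarrow> nat" where
  "graph_degree \<gamma> = (\<Sum>v\<in>black \<gamma>. if vdeg \<gamma> v \<ge> 2 then vdeg \<gamma> v else 0)"

definition shared :: "bigraph \<Rightarrow> int \<Rightarrow> nat \<Rightarrow> nat" where
  "shared \<gamma> v i = card {w \<in> white \<gamma>. count (edges \<gamma>) (v, w) = i}"

definition pairing ::
    "('d::finite list \<Rightarrow> complex) \<Rightarrow> (real^'d \<Rightarrow> real) \<Rightarrow> bigraph \<Rightarrow> complex" where
  "pairing S G \<gamma> = (\<Sum>a\<in>edge_copies \<gamma> \<rightarrow>\<^sub>E UNIV.
     (\<Prod>v\<in>black \<gamma>.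
        fact (vdeg \<gamma> v) / (\<Prod>i=1..vdeg \<gamma> v. fact i ^ shared \<gamma> v i)
          * S (map a (edge_list \<gamma> v))) *
     (\<Prod>w\<in>white \<gamma>. of_real (partials (map a (edge_list \<gamma> w)) G (lin_part S))))"

text \<open>Formal series \<open>\<Sum>\<^bsub>\<gamma> \<in> [\<Gamma>\<^sup>\<circ>]\<^esub> F \<gamma>\<close>, each term being placed in its degree. Only
  finitely many classes have a given degree; \<open>F\<close> has to be invariant under isomorphism.\<close>

definition sum_graphs :: "(bigraph \<Rightarrow> complex) \<Rightarrow> complex fps" where
  "sum_graphs F = Abs_fps (\<lambda>n.
     \<Sum>c \<in> {c \<in> Gamma_circ_classes. graph_degree (SOME \<gamma>. \<gamma> \<in> c) = n}. F (SOME \<gamma>. \<gamma> \<in> c))"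

end

theory Submission
  imports Defs "HOL-Probability.Probability"
begin

text \<open>Write \<open>c = \<i> / h\<close>, \<open>z = h / \<i> = 1 / c\<close>, \<open>x = lin_part S\<close> and \<open>u = exp (c G)\<close>. Both sides of the
  identity expand over graphs: on the left the edges turn out to be labelled, on the right graphs
  are counted up to isomorphism.

  The integral is a differential operator. Multiplying the Fourier transform of \<open>u\<close> by a polynomial
  \<open>p\<close> and transforming back yields \<open>p (z \<partial>) u\<close>. To see this, the distribution is tested against a
  compactly supported function: Fourier inversion for Schwartz functions (\<open>fourier_inv_fourier\<close>)
  cancels the two transforms, partial integration moves the operator to \<open>u\<close>, and a continuous
  function is determined by its integrals against test functions. This gives the value at \<open>x\<close>
  (\<open>distr_eval_multiplier_distr\<close>).

  The operator expands over set partitions. The degree \<open>n\<close> part of the exponential of \<open>c S\<^sup>+\<close> is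
  \<open>1 / n!\<close> times a sum over index assignments \<open>a\<close> on \<open>{..<n}\<close> and over partitions \<open>P\<close> of \<open>{..<n}\<close>,
  in which a block \<open>B\<close> with at least two elements contributes \<open>c\<close> times \<open>|B|!\<close> times the coefficient
  of \<open>S\<close> with the indices \<open>a j\<close>, \<open>j \<in> B\<close> (\<open>exp_S_plus_eq_sum_parts\<close>). By the formula of Faa di Bruno,
  a derivative of order \<open>n\<close> of \<open>u\<close> is \<open>u\<close> times a sum over partitions \<open>Q\<close> of \<open>{..<n}\<close>, in which a block
  contributes \<open>c\<close> times a derivative of \<open>G\<close> (\<open>faa_di_bruno_exp\<close>). Hence the degree \<open>n\<close> part of the
  integral is \<open>exp (c (S\<^sup>0 + G x)) / n!\<close> times a weighted sum over pairs \<open>(P, Q)\<close> of partitions of one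
  set with \<open>n\<close> elements (\<open>formal_integral_eq_sum_pairs\<close>).

  Such a pair is a bipartite graph with labelled edges: its black vertices are the blocks of \<open>P\<close>, its
  white vertices are the blocks of \<open>Q\<close>, and the label \<open>j\<close> is an edge between the two blocks containing
  \<open>j\<close>. No vertex is isolated, and black leaves have weight 0. The weight is multiplicative over
  connected components, so the exponential formula expresses the sum over all pairs by the sum over
  connected pairs (\<open>all_sum_eq_exp_connected_sum\<close>).

  It remains to forget the labels. Number the vertices as well: a connected pair arises from
  \<open>nblack! nwhite!\<close> numbered graphs with enumerated edges (\<open>sum_enumerations\<close>), and a numbered graph
  has \<open>n!\<close> divided by the product of the factorials of its edge multiplicities as its number of edge
  enumerations (\<open>sum_enumerations_eq_sum_graphs\<close>). Orbit counting turns the sum over numbered graphs,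
  divided by \<open>nblack! nwhite!\<close>, into the sum over isomorphism classes with weight \<open>1 / |sym|\<close>
  (\<open>sum_graphs_eq_labelled\<close>). The factorials \<open>|B|!\<close> and those of the multiplicities make up the
  prefactors in \<open>pairing\<close>, and \<open>c\<close> to the number of vertices times \<open>z\<close> to the number of edges is \<open>c\<close>
  times \<open>z\<close> to the Betti number (\<open>pair_weight_eq\<close>). The two graphs without edges are not seen by
  partitions; they account for the factor \<open>exp (c (S\<^sup>0 + G x))\<close>.\<close>

section \<open>Calculus of smooth functions\<close>

lemma partial_eq:
  "(f has_derivative f') (at x) \<Longrightarrow> partial i f x = f' (axis i 1)"
  unfolding partial_def using frechet_derivative_at by metis

lemma partials_append: "partials (is @ js) f = partials is (partials js f)"
  by (induction "is") auto

lemma smooth_partials: "smooth f \<Longrightarrow> smooth (partials is f)"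
  unfolding smooth_def by (metis partials_append)

lemma smooth_partial: "smooth f \<Longrightarrow> smooth (partial i f)"
  using smooth_partials[of f "[i]"] by simp

lemma smooth_differentiable: "smooth f \<Longrightarrow> f differentiable (at x)"
  unfolding smooth_def by (metis partials.simps(1))

lemma smooth_has_derivative:
  "smooth f \<Longrightarrow> (f has_derivative frechet_derivative f (at x)) (at x)"
  using smooth_differentiable frechet_derivative_works by blast

lemma smooth_continuous_on: "smooth f \<Longrightarrow> continuous_on A f"
  by (meson continuous_at_imp_continuous_on differentiable_imp_continuous_within smooth_differentiable)

text \<open>Smoothness concerns all iterated derivatives. A class of functions that is closed under a
  single derivative is often easy to exhibit, and spares an induction over words of indices.\<close>

lemma smooth_coinduct:
  assumes "K f" and "\<And>f x. K f \<Longrightarrow> f differentiable (at x)" and "\<And>f i. K f \<Longrightarrow> K (partial i f)"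
  shows "smooth f"
proof -
  have "K (partials is f)" for "is"
    by (induction "is") (auto simp: assms)
  then show ?thesis unfolding smooth_def using assms(2) by blast
qed

lemma partial_const: "partial i (\<lambda>x. c) = (\<lambda>x. 0)"
  by (rule ext, subst partial_eq[where f'="\<lambda>x. 0"]) auto

lemma partial_add:
  assumes "smooth f" "smooth g"
  shows "partial i (\<lambda>x. f x + g x) = (\<lambda>x. partial i f x + partial i g x)"
  by (rule ext, subst partial_eq[OF has_derivative_add[OF assms[THEN smooth_has_derivative]]])
    (simp add: partial_def)

lemma partial_mult:
  fixes f g :: "real^'d::finite \<Rightarrow> 'b::real_normed_algebra"
  assumes "smooth f" "smooth g"
  shows "partial i (\<lambda>x. f x * g x) = (\<lambda>x. partial i f x * g x + f x * partial i g x)"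
  by (rule ext, subst partial_eq[OF has_derivative_mult[OF assms[THEN smooth_has_derivative]]])
    (simp add: partial_def add.commute)

lemma partial_linear:
  assumes "bounded_linear L" "smooth f"
  shows "partial i (\<lambda>x. L (f x)) = (\<lambda>x. L (partial i f x))"
  by (rule ext, subst partial_eq[OF bounded_linear.has_derivative[OF assms(1) smooth_has_derivative[OF assms(2)]]])
    (simp add: partial_def)

lemma smooth_const [intro]: "smooth (\<lambda>x. c)"
  by (rule smooth_coinduct[where K="\<lambda>f. \<exists>c. f = (\<lambda>x. c)"]) (auto simp: partial_const)

lemma smooth_add [intro]:
  assumes "smooth f" "smooth g" shows "smooth (\<lambda>x. f x + g x)"
proof (rule smooth_coinduct[where K="\<lambda>u. \<exists>f g. smooth f \<and> smooth g \<and> u = (\<lambda>x. f x + g x)"])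
  show "\<exists>fa ga. smooth fa \<and> smooth ga \<and> (\<lambda>x. f x + g x) = (\<lambda>x. fa x + ga x)" using assms by blast
next
  fix u :: "real^'a \<Rightarrow> 'b" and x assume "\<exists>f g. smooth f \<and> smooth g \<and> u = (\<lambda>x. f x + g x)"
  then show "u differentiable (at x)" using differentiable_add smooth_differentiable by blast
next
  fix u :: "real^'a \<Rightarrow> 'b" and i assume "\<exists>f g. smooth f \<and> smooth g \<and> u = (\<lambda>x. f x + g x)"
  then show "\<exists>f g. smooth f \<and> smooth g \<and> partial i u = (\<lambda>x. f x + g x)"
    using partial_add smooth_partial by metis
qed

lemma smooth_linear [intro]:
  assumes "bounded_linear L" "smooth f" shows "smooth (\<lambda>x. L (f x))"
proof (rule smooth_coinduct[where K="\<lambda>u. \<exists>f. smooth f \<and> u = (\<lambda>x. L (f x))"])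
  show "\<exists>fa. smooth fa \<and> (\<lambda>x. L (f x)) = (\<lambda>x. L (fa x))" using assms by blast
next
  fix u x assume "\<exists>f. smooth f \<and> u = (\<lambda>x. L (f x))"
  then show "u differentiable (at x)"
    using bounded_linear.has_derivative[OF assms(1)] smooth_has_derivative differentiableI by metis
qed (auto simp: partial_linear assms dest: smooth_partial)

lemma smooth_of_real: "smooth f \<Longrightarrow> smooth (\<lambda>x. of_real (f x) :: complex)"
  using bounded_linear_of_real by blast

lemma smooth_sum: "(\<And>j. j \<in> J \<Longrightarrow> smooth (f j)) \<Longrightarrow> smooth (\<lambda>x. \<Sum>j\<in>J. f j x)"
  by (induction J rule: infinite_finite_induct) auto

lemma partial_sum: "(\<And>j. j \<in> J \<Longrightarrow> smooth (f j)) \<Longrightarrow>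
   partial i (\<lambda>x. \<Sum>j\<in>J. f j x) = (\<lambda>x. \<Sum>j\<in>J. partial i (f j) x)"
  by (induction J rule: infinite_finite_induct) (auto simp: partial_const partial_add smooth_sum)

lemma smooth_coord: "smooth (\<lambda>x. x $ i)"
proof (rule smooth_coinduct[where K="\<lambda>u. u = (\<lambda>x. x $ i) \<or> (\<exists>c. u = (\<lambda>x. c))"])
  have "partial j (\<lambda>x. x $ i) = (\<lambda>x. axis j 1 $ i)" for j
    by (rule ext, rule partial_eq) (rule bounded_linear_imp_has_derivative, simp add: bounded_linear_vec_nth)
  then show "f = (\<lambda>x. x $ i) \<or> (\<exists>c. f = (\<lambda>x. c)) \<Longrightarrow> partial j f = (\<lambda>x. x $ i) \<or> (\<exists>c. partial j f = (\<lambda>x. c))" for f :: "real^'a \<Rightarrow> real" and j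
    by (auto simp: partial_const)
  show "f = (\<lambda>x. x $ i) \<or> (\<exists>c. f = (\<lambda>x. c)) \<Longrightarrow> f differentiable (at x)" for f :: "real^'a \<Rightarrow> real" and x
    by (auto intro: bounded_linear_imp_differentiable bounded_linear_vec_nth)
qed simp

text \<open>Derivatives of a product are again sums of products of smooth functions, so this set is
  closed under differentiation.\<close>

inductive_set product_sums :: "(real^'d::finite \<Rightarrow> 'b::real_normed_algebra) set" where
  prod: "smooth f \<Longrightarrow> smooth g \<Longrightarrow> (\<lambda>x. f x * g x) \<in> product_sums"
| add: "u \<in> product_sums \<Longrightarrow> v \<in> product_sums \<Longrightarrow> (\<lambda>x. u x + v x) \<in> product_sums"

lemma smooth_mult [intro]:
  fixes f g :: "real^'d::finite \<Rightarrow> 'b::real_normed_algebra"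
  assumes "smooth f" "smooth g" shows "smooth (\<lambda>x. f x * g x)"
proof (rule smooth_coinduct[where K="\<lambda>u. u \<in> product_sums"])
  show "(\<lambda>x. f x * g x) \<in> product_sums" using assms by (rule product_sums.prod)
next
  fix u :: "real^'d \<Rightarrow> 'b" and x assume "u \<in> product_sums"
  then show "u differentiable (at x)"
    by induction (auto intro: differentiable_add
        differentiableI[OF has_derivative_mult[OF smooth_has_derivative smooth_has_derivative]])
next
  fix u :: "real^'d \<Rightarrow> 'b" and i assume "u \<in> product_sums"
  then have "u \<in> product_sums \<and> (\<forall>x. u differentiable (at x)) \<and> partial i u \<in> product_sums"
  proof induction
    case (prod f g)
    then show ?case
      by (auto simp: partial_mult intro!: product_sums.intros smooth_partial
        differentiableI[OF has_derivative_mult[OF smooth_has_derivative smooth_has_derivative]])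
  next
    case (add u v)
    then have "(u has_derivative frechet_derivative u (at x)) (at x)"
      "(v has_derivative frechet_derivative v (at x)) (at x)" for x
      using frechet_derivative_works by blast+
    then have "partial i (\<lambda>x. u x + v x) = (\<lambda>x. partial i u x + partial i v x)"
      by (intro ext) (subst partial_eq[OF has_derivative_add], auto simp: partial_def)
    then show ?case using add by (auto intro!: product_sums.intros differentiable_add)
  qed
  then show "partial i u \<in> product_sums" by blast
qed

lemma smooth_cmult: "smooth f \<Longrightarrow> smooth (\<lambda>x. c * f x :: 'b::real_normed_algebra)"
  by (intro smooth_mult smooth_const)

lemma partial_cmult:
  fixes f :: "real^'d::finite \<Rightarrow> 'b::real_normed_algebra"
  assumes "smooth f"
  shows "partial i (\<lambda>x. c * f x) = (\<lambda>x. c * partial i f x)"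
  using partial_mult[OF smooth_const assms] by (simp add: partial_const)

lemma partials_cmult:
  fixes f :: "real^'d::finite \<Rightarrow> 'b::real_normed_algebra"
  assumes "smooth f"
  shows "partials w (\<lambda>x. c * f x) = (\<lambda>x. c * partials w f x)"
  by (induction w) (auto simp: partial_cmult smooth_partials assms)

lemma partials_add:
  assumes "smooth f" "smooth g"
  shows "partials w (\<lambda>x. f x + g x) = (\<lambda>x. partials w f x + partials w g x)"
  by (induction w) (auto simp: partial_add smooth_partials assms)

lemma partials_of_real:
  assumes "smooth f"
  shows "partials w (\<lambda>x. of_real (f x) :: complex) = (\<lambda>x. of_real (partials w f x))"
proof (induction w)
  case (Cons i w)
  then show ?case using partial_linear[OF bounded_linear_of_real smooth_partials[OF assms]] by simp
qed simp

lemma partial_chain: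
  fixes D D' :: "real \<Rightarrow> 'b::real_normed_vector" and s :: "real^'d::finite \<Rightarrow> real"
  assumes "\<And>t. (D has_vector_derivative D' t) (at t)" "smooth s"
  shows "(\<lambda>x. D (s x)) differentiable (at x)"
    and "partial i (\<lambda>x. D (s x)) = (\<lambda>x. partial i s x *\<^sub>R D' (s x))"
proof -
  have *: "((\<lambda>x. D (s x)) has_derivative (\<lambda>v. frechet_derivative s (at x) v *\<^sub>R D' (s x))) (at x)" for x
    using diff_chain_at[OF smooth_has_derivative[OF assms(2)]] assms(1)
    unfolding has_vector_derivative_def o_def by fastforce
  then show "(\<lambda>x. D (s x)) differentiable (at x)" unfolding differentiable_def by blast
  show "partial i (\<lambda>x. D (s x)) = (\<lambda>x. partial i s x *\<^sub>R D' (s x))"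
    by (rule ext, subst partial_eq[OF *]) (simp add: partial_def)
qed

text \<open>If \<open>D (Suc n)\<close> is the derivative of \<open>D n\<close>, then the derivatives of \<open>D 0 \<circ> s\<close> are sums of
  smooth multiples of the functions \<open>D n \<circ> s\<close>.\<close>

inductive_set chain_sums :: "(nat \<Rightarrow> real \<Rightarrow> 'b::real_normed_vector) \<Rightarrow> (real^'d::finite \<Rightarrow> real) \<Rightarrow> (real^'d \<Rightarrow> 'b) set"
  for D s where
  prod: "smooth p \<Longrightarrow> (\<lambda>x. p x *\<^sub>R D n (s x)) \<in> chain_sums D s"
| add: "u \<in> chain_sums D s \<Longrightarrow> v \<in> chain_sums D s \<Longrightarrow> (\<lambda>x. u x + v x) \<in> chain_sums D s"

lemma smooth_chain:
  fixes D :: "nat \<Rightarrow> real \<Rightarrow> 'b::real_normed_vector" and s :: "real^'d::finite \<Rightarrow> real"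
  assumes D: "\<And>n t. (D n has_vector_derivative D (Suc n) t) (at t)" and s: "smooth s"
  shows "smooth (\<lambda>x. D 0 (s x))"
proof -
  have *: "(\<forall>x. u differentiable (at x)) \<and> partial i u \<in> chain_sums D s" if "u \<in> chain_sums D s" for u i
    using that
  proof induction
    case (prod p n)
    have d: "((\<lambda>x. D n (s x)) has_derivative frechet_derivative (\<lambda>x. D n (s x)) (at x)) (at x)" for x
      using frechet_derivative_works partial_chain(1)[OF D s] by blast
    have d2: "((\<lambda>x. p x *\<^sub>R D n (s x)) has_derivative
      (\<lambda>v. p x *\<^sub>R frechet_derivative (\<lambda>x. D n (s x)) (at x) v + frechet_derivative p (at x) v *\<^sub>R D n (s x))) (at x)" for x
      by (rule has_derivative_scaleR[OF smooth_has_derivative[OF prod] d])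
    have "partial i (\<lambda>x. p x *\<^sub>R D n (s x)) =
        (\<lambda>x. p x *\<^sub>R partial i (\<lambda>x. D n (s x)) x + partial i p x *\<^sub>R D n (s x))"
      by (rule ext, subst partial_eq[OF d2]) (simp add: partial_def)
    also have "\<dots> = (\<lambda>x. (p x * partial i s x) *\<^sub>R D (Suc n) (s x) + partial i p x *\<^sub>R D n (s x))"
      by (subst partial_chain(2)[OF D s]) simp
    also have "\<dots> \<in> chain_sums D s"
      by (intro chain_sums.intros smooth_mult smooth_partial prod s)
    finally show ?case using d2 unfolding differentiable_def by blast
  next
    case (add u v)
    then have "(u has_derivative frechet_derivative u (at x)) (at x)"
      "(v has_derivative frechet_derivative v (at x)) (at x)" for x
      using frechet_derivative_works by blast+
    then have "partial i (\<lambda>x. u x + v x) = (\<lambda>x. partial i u x + partial i v x)"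
      by (intro ext) (subst partial_eq[OF has_derivative_add], auto simp: partial_def)
    then show ?case using add by (auto intro!: chain_sums.intros differentiable_add)
  qed
  have "(\<lambda>x. 1 *\<^sub>R D 0 (s x)) \<in> chain_sums D s" by (intro chain_sums.prod smooth_const)
  then have "(\<lambda>x. D 0 (s x)) \<in> chain_sums D s" by simp
  then show ?thesis
    by (rule smooth_coinduct[where K="\<lambda>u. u \<in> chain_sums D s"]) (use * in auto)
qed

section \<open>Symmetry of iterated partial derivatives\<close>

lemma has_vector_derivative_line:
  fixes f :: "real^'d::finite \<Rightarrow> 'b::real_normed_vector"
  assumes "smooth f"
  shows "((\<lambda>t. f (x + t *\<^sub>R axis i 1)) has_vector_derivative partial i f (x + t *\<^sub>R axis i 1)) (at t)"
proof -
  have 1: "((\<lambda>t. x + t *\<^sub>R axis i 1) has_derivative (\<lambda>t. t *\<^sub>R axis i 1)) (at t)"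
    by (auto intro!: derivative_eq_intros)
  have "((\<lambda>t. f (x + t *\<^sub>R axis i 1)) has_derivative
     (\<lambda>t'. frechet_derivative f (at (x + t *\<^sub>R axis i 1)) (t' *\<^sub>R axis i 1))) (at t)"
    using diff_chain_at[OF 1 smooth_has_derivative[OF assms]] by (simp add: o_def)
  moreover have "frechet_derivative f (at (x + t *\<^sub>R axis i 1)) (t' *\<^sub>R axis i 1) = t' *\<^sub>R partial i f (x + t *\<^sub>R axis i 1)" for t'
    unfolding partial_def
    by (subst linear_cmul[OF has_derivative_linear[OF smooth_has_derivative[OF assms]]]) simp
  ultimately show ?thesis by (simp add: has_vector_derivative_def)
qed

lemma has_real_derivative_line:
  fixes f :: "real^'d::finite \<Rightarrow> real"
  assumes "smooth f"
  shows "((\<lambda>t. f (x + t *\<^sub>R axis i 1)) has_real_derivative partial i f (x + t *\<^sub>R axis i 1)) (at t)"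
  using has_vector_derivative_line[OF assms] by (simp add: has_real_derivative_iff_has_vector_derivative)

text \<open>The mean value theorem is applied in direction \<open>i\<close> and then in direction \<open>j\<close>. The second
  difference on the left is symmetric in \<open>i\<close> and \<open>j\<close>.\<close>

lemma second_difference_mean_value:
  fixes f :: "real^'d::finite \<Rightarrow> real"
  assumes "smooth f" "t > 0"
  shows "\<exists>a b. 0 < a \<and> a < t \<and> 0 < b \<and> b < t \<and>
     f (x + t *\<^sub>R axis i 1 + t *\<^sub>R axis j 1) - f (x + t *\<^sub>R axis i 1) - f (x + t *\<^sub>R axis j 1) + f x
      = t * t * partial j (partial i f) (x + a *\<^sub>R axis i 1 + b *\<^sub>R axis j 1)"
proof -
  define g where "g s = f ((x + t *\<^sub>R axis j 1) + s *\<^sub>R axis i 1) - f (x + s *\<^sub>R axis i 1)" for s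
  have "(g has_real_derivative (partial i f ((x + t *\<^sub>R axis j 1) + s *\<^sub>R axis i 1) - partial i f (x + s *\<^sub>R axis i 1))) (at s)" for s
    unfolding g_def by (intro derivative_intros has_real_derivative_line assms)
  from MVT2[OF assms(2), of g, OF this] obtain a where a: "0 < a" "a < t"
    "g t - g 0 = t * (partial i f (x + t *\<^sub>R axis j 1 + a *\<^sub>R axis i 1) - partial i f (x + a *\<^sub>R axis i 1))"
    by auto
  from MVT2[OF assms(2), of "\<lambda>s. partial i f ((x + a *\<^sub>R axis i 1) + s *\<^sub>R axis j 1)", OF has_real_derivative_line[OF smooth_partial[OF assms(1)]]]
  obtain b where b: "0 < b" "b < t"
    "partial i f (x + a *\<^sub>R axis i 1 + t *\<^sub>R axis j 1) - partial i f (x + a *\<^sub>R axis i 1) =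
     t * partial j (partial i f) (x + a *\<^sub>R axis i 1 + b *\<^sub>R axis j 1)"
    by auto
  show ?thesis
    using a b by (intro exI[of _ a] exI[of _ b]) (auto simp: g_def algebra_simps)
qed

text \<open>Both mixed derivatives, taken at points that tend to \<open>x\<close>, agree with the same second
  difference quotient; the claim follows by continuity.\<close>

lemma partial_commute_real:
  fixes f :: "real^'d::finite \<Rightarrow> real"
  assumes "smooth f"
  shows "partial i (partial j f) x = partial j (partial i f) x"
proof -
  have "\<forall>n. \<exists>a b c d. 0 < a \<and> a < inverse (real (Suc n)) \<and> 0 < b \<and> b < inverse (real (Suc n)) \<and>
      0 < c \<and> c < inverse (real (Suc n)) \<and> 0 < d \<and> d < inverse (real (Suc n)) \<and>
      partial j (partial i f) (x + a *\<^sub>R axis i 1 + b *\<^sub>R axis j 1) = partial i (partial j f) (x + c *\<^sub>R axis j 1 + d *\<^sub>R axis i 1)"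
  proof
    fix n
    have t: "inverse (real (Suc n)) > 0" by simp
    let ?t = "inverse (real (Suc n))"
    obtain a b where ab: "0 < a" "a < ?t" "0 < b" "b < ?t"
      "f (x + ?t *\<^sub>R axis i 1 + ?t *\<^sub>R axis j 1) - f (x + ?t *\<^sub>R axis i 1) - f (x + ?t *\<^sub>R axis j 1) + f x
      = ?t * ?t * partial j (partial i f) (x + a *\<^sub>R axis i 1 + b *\<^sub>R axis j 1)"
      using second_difference_mean_value[OF assms t] by blast
    obtain c d where cd: "0 < c" "c < ?t" "0 < d" "d < ?t"
      "f (x + ?t *\<^sub>R axis j 1 + ?t *\<^sub>R axis i 1) - f (x + ?t *\<^sub>R axis j 1) - f (x + ?t *\<^sub>R axis i 1) + f x
      = ?t * ?t * partial i (partial j f) (x + c *\<^sub>R axis j 1 + d *\<^sub>R axis i 1)"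
      using second_difference_mean_value[OF assms t] by blast
    have "f (x + ?t *\<^sub>R axis i 1 + ?t *\<^sub>R axis j 1) = f (x + ?t *\<^sub>R axis j 1 + ?t *\<^sub>R axis i 1)"
      by (simp add: add.commute add.left_commute)
    then have "?t * ?t * partial j (partial i f) (x + a *\<^sub>R axis i 1 + b *\<^sub>R axis j 1) = ?t * ?t * partial i (partial j f) (x + c *\<^sub>R axis j 1 + d *\<^sub>R axis i 1)"
      using ab(5) cd(5) by linarith
    then have "partial j (partial i f) (x + a *\<^sub>R axis i 1 + b *\<^sub>R axis j 1) = partial i (partial j f) (x + c *\<^sub>R axis j 1 + d *\<^sub>R axis i 1)"
      by simp
    then show "\<exists>a b c d. 0 < a \<and> a < ?t \<and> 0 < b \<and> b < ?t \<and> 0 < c \<and> c < ?t \<and> 0 < d \<and> d < ?t \<and>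
      partial j (partial i f) (x + a *\<^sub>R axis i 1 + b *\<^sub>R axis j 1) = partial i (partial j f) (x + c *\<^sub>R axis j 1 + d *\<^sub>R axis i 1)"
      using ab cd by blast
  qed
  then obtain a b c d where abcd: "\<And>n. 0 < a n \<and> a n < inverse (real (Suc n))" "\<And>n. 0 < b n \<and> b n < inverse (real (Suc n))"
     "\<And>n. 0 < c n \<and> c n < inverse (real (Suc n))" "\<And>n. 0 < d n \<and> d n < inverse (real (Suc n))"
    and eq: "\<And>n. partial j (partial i f) (x + a n *\<^sub>R axis i 1 + b n *\<^sub>R axis j 1) = partial i (partial j f) (x + c n *\<^sub>R axis j 1 + d n *\<^sub>R axis i 1)"
    by metis
  have lim0: "a \<longlonglongrightarrow> 0" if "\<And>n. 0 < a n \<and> a n < inverse (real (Suc n))" for a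
    by (rule real_tendsto_sandwich[OF _ _ tendsto_const LIMSEQ_inverse_real_of_nat])
      (use that in \<open>auto intro!: always_eventually simp: less_imp_le\<close>)
  have cont: "isCont (partial i (partial j f)) x" for i j
    by (rule differentiable_imp_continuous_within)
      (intro smooth_differentiable smooth_partial assms)
  have 1: "(\<lambda>n. partial j (partial i f) (x + a n *\<^sub>R axis i 1 + b n *\<^sub>R axis j 1)) \<longlonglongrightarrow> partial j (partial i f) x"
  proof (rule isCont_tendsto_compose[OF cont])
    have "(\<lambda>n. x + a n *\<^sub>R axis i 1 + b n *\<^sub>R axis j 1) \<longlonglongrightarrow> x + 0 *\<^sub>R axis i 1 + 0 *\<^sub>R axis j 1"
      by (intro tendsto_intros lim0 abcd)
    then show "(\<lambda>n. x + a n *\<^sub>R axis i 1 + b n *\<^sub>R axis j 1) \<longlonglongrightarrow> x" by simp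
  qed
  have 2: "(\<lambda>n. partial i (partial j f) (x + c n *\<^sub>R axis j 1 + d n *\<^sub>R axis i 1)) \<longlonglongrightarrow> partial i (partial j f) x"
  proof (rule isCont_tendsto_compose[OF cont])
    have "(\<lambda>n. x + c n *\<^sub>R axis j 1 + d n *\<^sub>R axis i 1) \<longlonglongrightarrow> x + 0 *\<^sub>R axis j 1 + 0 *\<^sub>R axis i 1"
      by (intro tendsto_intros lim0 abcd)
    then show "(\<lambda>n. x + c n *\<^sub>R axis j 1 + d n *\<^sub>R axis i 1) \<longlonglongrightarrow> x" by simp
  qed
  show ?thesis
    using LIMSEQ_unique[OF 1] 2 eq by simp
qed

text \<open>The real case applies to every component \<open>f x \<bullet> v\<close>.\<close>

lemma partial_commute:
  fixes f :: "real^'d::finite \<Rightarrow> 'b::real_inner"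
  assumes "smooth f"
  shows "partial i (partial j f) = partial j (partial i f)"
proof
  fix x
  have "partial i (partial j f) x \<bullet> v = partial j (partial i f) x \<bullet> v" for v
  proof -
    have L: "bounded_linear (\<lambda>y. y \<bullet> v)" by (rule bounded_linear_inner_left)
    have "partial i (partial j (\<lambda>x. f x \<bullet> v)) x = partial j (partial i (\<lambda>x. f x \<bullet> v)) x"
      by (rule partial_commute_real) (rule smooth_linear[OF L assms])
    then show ?thesis
      by (simp add: partial_linear[OF L] assms smooth_partial)
  qed
  then show "partial i (partial j f) x = partial j (partial i f) x"
    using vector_eq_rdot by metis
qed

lemma partials_move:
  fixes f :: "real^'d::finite \<Rightarrow> 'b::real_inner"
  assumes "smooth f"
  shows "partials (as @ i # bs) f = partial i (partials (as @ bs) f)"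
  by (induction as) (auto simp: partial_commute smooth_partials assms)

lemma partials_perm:
  fixes f :: "real^'d::finite \<Rightarrow> 'b::real_inner"
  assumes "smooth f"
  shows "mset as = mset bs \<Longrightarrow> partials as f = partials bs f"
proof (induction as arbitrary: bs)
  case (Cons i as)
  then have "i \<in> set bs" by (metis list.set_intros(1) mset_eq_setD)
  then obtain b1 b2 where bs: "bs = b1 @ i # b2" by (meson split_list)
  then have "partials as f = partials (b1 @ b2) f" using Cons by (auto intro!: Cons.IH)
  then show ?case using bs partials_move[OF assms] by simp
qed auto

section \<open>Integrals of rapidly decreasing functions\<close>

lemma Basis_vec_real: "(Basis :: (real^'d::finite) set) = range (\<lambda>i. axis i 1)"
  by (auto simp: Basis_vec_def)

lemma
  fixes f :: "'d::finite \<Rightarrow> real \<Rightarrow> 'b::{real_normed_field,banach,second_countable_topology}"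
  assumes f: "\<And>j. integrable lborel (f j)"
  shows integrable_lborel_vec_prod: "integrable lborel (\<lambda>x::real^'d. \<Prod>j\<in>UNIV. f j (x $ j))"
    and integral_lborel_vec_prod: "(LINT x|lborel. (\<Prod>j\<in>UNIV. f j (x $ j))) = (\<Prod>j\<in>UNIV. LINT t|lborel. f j t)"
proof -
  interpret product_sigma_finite "\<lambda>_::real^'d. lborel :: real measure" ..
  let ?B = "Basis :: (real^'d) set"
  have [measurable]: "f j \<in> borel_measurable borel" for j using f[of j] by (simp add: integrable_iff_bounded)
  have prodB: "(\<Prod>j\<in>UNIV. g j (axis j 1 :: real^'d)) = (\<Prod>b\<in>?B. g (axis_index b) b)" for g :: "'d \<Rightarrow> real^'d \<Rightarrow> 'b"
    unfolding Basis_vec_real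
    by (subst prod.reindex) (auto simp: inj_on_def axis_eq_axis axis_index_axis)
  have nth: "(\<Sum>b\<in>?B. g b *\<^sub>R b) $ j = g (axis j 1)" for g :: "real^'d \<Rightarrow> real" and j
  proof -
    have "(\<Sum>b\<in>?B. g b *\<^sub>R b) $ j = (\<Sum>b\<in>?B. g b *\<^sub>R b) \<bullet> axis j 1"
      by (simp add: inner_axis)
    also have "\<dots> = (\<Sum>b\<in>?B. g b * (b \<bullet> axis j 1))" by (simp add: inner_sum_left)
    also have "\<dots> = (\<Sum>b\<in>?B. if b = axis j 1 then g b else 0)"
      by (rule sum.cong) (auto simp: inner_Basis)
    also have "\<dots> = g (axis j 1)" by simp
    finally show ?thesis .
  qed
  have eq: "(\<Prod>j\<in>UNIV. f j ((\<Sum>b\<in>?B. g b *\<^sub>R b) $ j)) = (\<Prod>b\<in>?B. f (axis_index b) (g b))" for g :: "real^'d \<Rightarrow> real"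
    unfolding nth by (rule prodB)
  have m: "(\<lambda>x::real^'d. \<Prod>j\<in>UNIV. f j (x $ j)) \<in> borel_measurable borel" by measurable
  have T: "(\<lambda>g. \<Sum>b\<in>?B. g b *\<^sub>R b) \<in> measurable (\<Pi>\<^sub>M b\<in>?B. lborel) borel" by measurable
  show "integrable lborel (\<lambda>x::real^'d. \<Prod>j\<in>UNIV. f j (x $ j))"
    by (subst lborel_eq, subst integrable_distr_eq[OF T m], unfold eq)
      (intro product_integrable_prod f, simp)
  show "(LINT x|lborel. (\<Prod>j\<in>UNIV. f j ((x::real^'d) $ j))) = (\<Prod>j\<in>UNIV. LINT t|lborel. f j t)"
    by (subst lborel_eq, subst integral_distr[OF T m], unfold eq, subst product_integral_prod)
      (auto intro: f simp: prodB[of "\<lambda>j _. LINT t|lborel. f j t"])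
qed

text \<open>A product of one-dimensional integrable functions, hence integrable by Fubini; it serves as
  the majorant for everything that decays like the power \<open>- 2 * CARD('d)\<close> of the norm.\<close>

definition cauchy_weight :: "real^'d::finite \<Rightarrow> real" where
  "cauchy_weight x = (\<Prod>j\<in>UNIV. inverse (1 + (x $ j)\<^sup>2))"

lemma integrable_cauchy_weight: "integrable lborel cauchy_weight"
proof -
  have "integrable lborel (\<lambda>x::real. inverse (1 + x\<^sup>2))"
    using integrable_inverse_1_plus_square by (simp add: set_integrable_def)
  then show ?thesis
    unfolding cauchy_weight_def[abs_def] by (rule integrable_lborel_vec_prod)
qed

lemma cauchy_weight_ge: "inverse ((1 + norm x) ^ (2 * CARD('d))) \<le> cauchy_weight (x :: real^'d::finite)"
proof -
  have "inverse ((1 + norm x) ^ (2 * CARD('d))) = (\<Prod>j\<in>(UNIV::'d set). inverse ((1 + norm x)\<^sup>2))"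
    by (simp add: power_mult power_inverse)
  also have "\<dots> \<le> cauchy_weight x"
    unfolding cauchy_weight_def
  proof (rule prod_mono, safe)
    fix j
    have "(x $ j)\<^sup>2 \<le> (norm x)\<^sup>2" using component_le_norm_cart[of x j] by (simp add: abs_le_square_iff[symmetric])
    then have "1 + (x $ j)\<^sup>2 \<le> (1 + norm x)\<^sup>2" by (simp add: power2_sum) (smt (verit) norm_ge_zero)
    then show "inverse ((1 + norm x)\<^sup>2) \<le> inverse (1 + (x $ j)\<^sup>2)"
      by (rule le_imp_inverse_le) (auto intro: add_pos_nonneg)
  qed auto
  finally show ?thesis .
qed

lemma integrable_decay:
  fixes f :: "real^'d::finite \<Rightarrow> 'b::{banach,second_countable_topology}"
  assumes "f \<in> borel_measurable borel" "\<And>x. (1 + norm x) ^ (2 * CARD('d)) * norm (f x) \<le> C"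
  shows "integrable lborel f"
proof (rule Bochner_Integration.integrable_bound)
  show "integrable lborel (\<lambda>x. C * cauchy_weight x)"
    using integrable_cauchy_weight by (rule integrable_mult_right)
  show "AE x in lborel. norm (f x) \<le> norm (C * cauchy_weight x)"
  proof (rule AE_I2)
    fix x :: "real^'d"
    have C: "C \<ge> 0" using assms(2)[of 0] by (simp add: order_trans[OF norm_ge_zero])
    have "norm (f x) \<le> C * inverse ((1 + norm x) ^ (2 * CARD('d)))"
      using assms(2)[of x] by (simp add: field_simps add_pos_nonneg)
    also have "\<dots> \<le> C * cauchy_weight x" by (intro mult_left_mono cauchy_weight_ge C)
    also have "\<dots> \<le> norm (C * cauchy_weight x)" by simp
    finally show "norm (f x) \<le> norm (C * cauchy_weight x)" .
  qed
qed (use assms in simp)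

lemma smooth_measurable [measurable_dest]: "smooth f \<Longrightarrow> f \<in> borel_measurable borel"
  by (rule borel_measurable_continuous_onI[OF smooth_continuous_on])

lemma integral_translate:
  fixes f :: "'a::euclidean_space \<Rightarrow> 'b::{banach,second_countable_topology}"
  assumes "f \<in> borel_measurable borel"
  shows "(LINT x|lborel. f (x + c)) = (LINT x|lborel. f x)"
    and "integrable lborel f \<Longrightarrow> integrable lborel (\<lambda>x. f (x + c))"
proof -
  have m: "(+) c \<in> measurable lborel borel" by measurable
  show "(LINT x|lborel. f (x + c)) = (LINT x|lborel. f x)"
    by (subst (2) lborel_distr_plus[of c, symmetric], subst integral_distr[OF m assms]) (simp add: add.commute)
  assume "integrable lborel f"
  then have "integrable (distr lborel borel ((+) c)) f" by (simp add: lborel_distr_plus)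
  then show "integrable lborel (\<lambda>x. f (x + c))"
    by (subst (asm) integrable_distr_eq[OF m assms]) (simp add: add.commute)
qed

text \<open>The derivative is a limit of difference quotients along one axis, whose integrals vanish by
  translation invariance. The decay of the derivative dominates the quotients, via the mean
  value theorem.\<close>

lemma integral_partial_eq_0:
  fixes f :: "real^'d::finite \<Rightarrow> 'b::{real_inner,banach,second_countable_topology}"
  assumes "smooth f" "integrable lborel f"
    and bound: "\<And>x. (1 + norm x) ^ (2 * CARD('d)) * norm (partial i f x) \<le> C"
  shows "(LINT x|lborel. partial i f x) = 0"
proof -
  define N where "N = 2 * CARD('d)"
  define t where "t n = inverse (real (Suc n))" for n
  define e :: "real^'d" where "e = axis i 1"
  have t: "0 < t n" "t n \<le> 1" for n unfolding t_def by (auto simp: field_simps)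
  have [measurable]: "f \<in> borel_measurable borel" "partial i f \<in> borel_measurable borel"
    using assms(1) smooth_measurable smooth_partial by blast+
  have C: "C \<ge> 0" using bound[of 0] by (simp add: order_trans[OF norm_ge_zero])
  define q where "q n x = (f (x + t n *\<^sub>R e) - f x) /\<^sub>R t n" for n x
  have q0: "(LINT x|lborel. q n x) = 0" for n
    unfolding q_def
    by (subst integral_scaleR_right, subst Bochner_Integration.integral_diff)
      (auto simp: integral_translate assms)
  have "(\<lambda>n. LINT x|lborel. q n x) \<longlonglongrightarrow> (LINT x|lborel. partial i f x)"
  proof (rule integral_dominated_convergence[where w="\<lambda>x. 2 ^ N * C * cauchy_weight x"])
    show "integrable lborel (\<lambda>x::real^'d. 2 ^ N * C * cauchy_weight x)"
      using integrable_cauchy_weight by (rule integrable_mult_right)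
    show "AE x in lborel. (\<lambda>n. q n x) \<longlonglongrightarrow> partial i f x"
    proof (rule AE_I2)
      fix x
      have "((\<lambda>s. (f (x + s *\<^sub>R e) - f x) /\<^sub>R s) \<longlongrightarrow> partial i f x) (at 0)"
        using has_vector_derivative_line[OF assms(1), of x i 0]
        unfolding has_vector_derivative_def has_derivative_at e_def[symmetric]
      proof -
        assume "bounded_linear (\<lambda>xa. xa *\<^sub>R partial i f (x + 0 *\<^sub>R e)) \<and>
          (\<lambda>h. norm (f (x + (0 + h) *\<^sub>R e) - f (x + 0 *\<^sub>R e) - h *\<^sub>R partial i f (x + 0 *\<^sub>R e)) / norm h) \<midarrow>0\<rightarrow> 0"
        then have "((\<lambda>h. norm (f (x + h *\<^sub>R e) - f x - h *\<^sub>R partial i f x) / norm h) \<longlongrightarrow> 0) (at 0)" by simp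
        then have "((\<lambda>h. norm ((f (x + h *\<^sub>R e) - f x - h *\<^sub>R partial i f x) /\<^sub>R h)) \<longlongrightarrow> 0) (at 0)"
          by (simp add: divide_inverse mult.commute)
        then have "((\<lambda>h. (f (x + h *\<^sub>R e) - f x - h *\<^sub>R partial i f x) /\<^sub>R h) \<longlongrightarrow> 0) (at 0)"
          by (rule tendsto_norm_zero_cancel)
        moreover have "\<forall>\<^sub>F h in at 0. (f (x + h *\<^sub>R e) - f x - h *\<^sub>R partial i f x) /\<^sub>R h = (f (x + h *\<^sub>R e) - f x) /\<^sub>R h - partial i f x"
          by (auto simp: eventually_at_filter scaleR_diff_right)
        ultimately have "((\<lambda>h. (f (x + h *\<^sub>R e) - f x) /\<^sub>R h - partial i f x) \<longlongrightarrow> 0) (at 0)"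
          by (rule Lim_transform_eventually)
        then show ?thesis by (simp add: LIM_zero_iff)
      qed
      moreover have "filterlim t (at 0) sequentially"
        using LIMSEQ_inverse_real_of_nat unfolding t_def filterlim_at by auto
      ultimately show "(\<lambda>n. q n x) \<longlonglongrightarrow> partial i f x"
        unfolding q_def by (rule filterlim_compose)
    qed
    show "AE x in lborel. norm (q n x) \<le> 2 ^ N * C * cauchy_weight x" for n
    proof (rule AE_I2)
      fix x
      have "\<exists>s\<in>{0<..<t n}. norm (f (x + t n *\<^sub>R e) - f (x + 0 *\<^sub>R e)) \<le> norm ((t n - 0) *\<^sub>R partial i f (x + s *\<^sub>R e))"
        by (rule mvt_general[where f="\<lambda>s. f (x + s *\<^sub>R e)" and f'="\<lambda>s h. h *\<^sub>R partial i f (x + s *\<^sub>R e)"])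
          (use has_vector_derivative_line[OF assms(1), of x i] t in
            \<open>auto simp: e_def has_vector_derivative_def intro!: continuous_at_imp_continuous_on has_derivative_continuous\<close>)
      then obtain s where s: "0 < s" "s < t n" "norm (f (x + t n *\<^sub>R e) - f x) \<le> t n * norm (partial i f (x + s *\<^sub>R e))"
        using t[of n] by auto
      have "norm (q n x) \<le> norm (partial i f (x + s *\<^sub>R e))"
      proof -
        have "norm (q n x) = norm (f (x + t n *\<^sub>R e) - f x) / t n"
          using t[of n] by (simp add: q_def divide_inverse mult.commute)
        then show ?thesis using s(3) t[of n] by (simp add: pos_divide_le_eq mult.commute)
      qed
      also have "\<dots> \<le> C * inverse ((1 + norm (x + s *\<^sub>R e)) ^ N)"
        using bound[of "x + s *\<^sub>R e"] by (simp add: N_def field_simps add_pos_nonneg)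
      also have "\<dots> \<le> C * (2 ^ N * inverse ((1 + norm x) ^ N))"
      proof (intro mult_left_mono C)
        have "norm x \<le> norm (x + s *\<^sub>R e) + norm (s *\<^sub>R e)" by (metis add_diff_cancel norm_triangle_ineq4)
        also have "norm (s *\<^sub>R e) \<le> 1" using s t[of n] by (simp add: e_def)
        finally have "1 + norm x \<le> 2 * (1 + norm (x + s *\<^sub>R e))" by (smt (verit) norm_ge_zero)
        then have "(1 + norm x) ^ N \<le> 2 ^ N * (1 + norm (x + s *\<^sub>R e)) ^ N"
          by (metis add_nonneg_nonneg norm_ge_zero power_mono power_mult_distrib zero_le_one)
        then show "inverse ((1 + norm (x + s *\<^sub>R e)) ^ N) \<le> 2 ^ N * inverse ((1 + norm x) ^ N)"
          by (simp add: field_simps add_pos_nonneg)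
      qed
      also have "\<dots> \<le> C * (2 ^ N * cauchy_weight x)"
        unfolding N_def by (intro mult_left_mono C cauchy_weight_ge) auto
      finally show "norm (q n x) \<le> 2 ^ N * C * cauchy_weight x" by (simp add: mult_ac)
    qed
  qed (auto simp: q_def)
  then show ?thesis using LIMSEQ_unique[OF _ tendsto_const] q0 by auto
qed

section \<open>Schwartz functions\<close>

lemma schwartz_smooth: "schwartz \<psi> \<Longrightarrow> smooth \<psi>"
  by (simp add: schwartz_def)

lemma schwartz_iff:
  "schwartz \<psi> \<longleftrightarrow> smooth \<psi> \<and> (\<forall>k w. \<exists>C. \<forall>x. (1 + norm x) ^ k * norm (partials w \<psi> x) \<le> C)"
proof -
  have "norm ((1 + norm x) ^ k *\<^sub>R y) = (1 + norm x) ^ k * norm y" for x :: "real^'a" and y :: complex and k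
    by simp
  then show ?thesis unfolding schwartz_def bounded_iff by simp
qed

lemma schwartz_bound:
  assumes "schwartz \<psi>" obtains C where "\<And>x. (1 + norm x) ^ k * norm (partials w \<psi> x) \<le> C"
  using assms unfolding schwartz_iff by meson

lemma schwartz_partials: "schwartz \<psi> \<Longrightarrow> schwartz (partials w \<psi>)"
  unfolding schwartz_iff by (metis partials_append smooth_partials)

lemma schwartz_partial: "schwartz \<psi> \<Longrightarrow> schwartz (partial i \<psi>)"
  using schwartz_partials[of \<psi> "[i]"] by simp

lemma schwartz_add:
  assumes "schwartz \<psi>" "schwartz \<eta>" shows "schwartz (\<lambda>x. \<psi> x + \<eta> x)"
  unfolding schwartz_iff
proof (intro conjI allI)
  show "smooth (\<lambda>x. \<psi> x + \<eta> x)" using assms schwartz_smooth by blast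
  fix k w
  obtain C D where C: "\<And>x. (1 + norm x) ^ k * norm (partials w \<psi> x) \<le> C" and D: "\<And>x. (1 + norm x) ^ k * norm (partials w \<eta> x) \<le> D"
    using schwartz_bound assms by metis
  have "(1 + norm x) ^ k * norm (partials w \<psi> x + partials w \<eta> x) \<le> C + D" for x
  proof -
    have "(1 + norm x) ^ k * norm (partials w \<psi> x + partials w \<eta> x) \<le>
      (1 + norm x) ^ k * norm (partials w \<psi> x) + (1 + norm x) ^ k * norm (partials w \<eta> x)"
      unfolding distrib_left[symmetric] by (intro mult_left_mono norm_triangle_ineq) auto
    then show ?thesis using C[of x] D[of x] by linarith
  qed
  then show "\<exists>C. \<forall>x. (1 + norm x) ^ k * norm (partials w (\<lambda>x. \<psi> x + \<eta> x) x) \<le> C"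
    using assms by (auto simp: partials_add schwartz_smooth)
qed

lemma schwartz_cmult:
  assumes "schwartz \<psi>" shows "schwartz (\<lambda>x. c * \<psi> x)"
  unfolding schwartz_iff
proof (intro conjI allI)
  show "smooth (\<lambda>x. c * \<psi> x)" using assms schwartz_smooth smooth_cmult by blast
  fix k w
  obtain C where C: "\<And>x. (1 + norm x) ^ k * norm (partials w \<psi> x) \<le> C"
    using schwartz_bound assms by metis
  have "(1 + norm x) ^ k * norm (c * partials w \<psi> x) \<le> norm c * C" for x
    using mult_left_mono[OF C[of x] norm_ge_zero[of c]] by (simp add: norm_mult mult_ac)
  then show "\<exists>C. \<forall>x. (1 + norm x) ^ k * norm (partials w (\<lambda>x. c * \<psi> x) x) \<le> C"
    using assms by (auto simp: partials_cmult schwartz_smooth)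
qed

lemma schwartz_zero: "schwartz (\<lambda>x. 0)"
proof -
  have "partials w (\<lambda>x. 0::complex) = (\<lambda>x. 0)" for w :: "'a list" by (induction w) (auto simp: partial_const)
  then show ?thesis unfolding schwartz_iff by auto
qed

lemma schwartz_sum: "(\<And>j. j \<in> J \<Longrightarrow> schwartz (f j)) \<Longrightarrow> schwartz (\<lambda>x. \<Sum>j\<in>J. f j x)"
  by (induction J rule: infinite_finite_induct) (auto simp: schwartz_add schwartz_zero)

lemma schwartz_integrable: "schwartz \<psi> \<Longrightarrow> integrable lborel \<psi>"
  by (metis integrable_decay partials.simps(1) schwartz_bound schwartz_smooth smooth_measurable)

lemma schwartz_bounded: assumes "schwartz \<psi>" obtains C where "\<And>x. norm (\<psi> x) \<le> C"
  using schwartz_bound[OF assms, of 0 "[]"] by auto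

section \<open>The Fourier transform of Schwartz functions\<close>

definition kernel :: "real \<Rightarrow> real^'d::finite \<Rightarrow> real^'d \<Rightarrow> complex" where
  "kernel h y q = exp ((\<i> / of_real h) * of_real (y \<bullet> q))"

lemma kernel_eq_cis: "kernel h y q = cis ((y \<bullet> q) / h)"
  by (simp add: kernel_def cis_conv_exp)

lemma cis_measurable [measurable]:
  "f \<in> borel_measurable M \<Longrightarrow> (\<lambda>x. cis (f x)) \<in> borel_measurable M"
  unfolding cis_conv_exp by measurable

lemma norm_kernel [simp]: "norm (kernel h y q) = 1"
  by (simp add: kernel_eq_cis)

lemma kernel_measurable [measurable]:
  assumes [measurable]: "f \<in> borel_measurable M" "g \<in> borel_measurable M"
  shows "(\<lambda>x. kernel h (f x) (g x)) \<in> borel_measurable M"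
  unfolding kernel_def by measurable

lemma inv_fourier_kernel: "inv_fourier h \<psi> y = (LINT q|lborel. kernel h y q * \<psi> q) / of_real ((2 * pi * h) ^ CARD('d))"
  for y :: "real^'d::finite"
  by (simp add: inv_fourier_def kernel_def)

lemma fourier_kernel: "fourier h \<psi> q = (LINT y|lborel. kernel h y (- q) * \<psi> y)"
  by (simp add: fourier_def kernel_def)

lemma smooth_inner: "smooth (\<lambda>x. y \<bullet> x)"
proof -
  have "smooth (\<lambda>x. \<Sum>j\<in>UNIV. y $ j * x $ j)"
    by (intro smooth_sum smooth_cmult smooth_coord)
  then show ?thesis by (simp add: inner_vec_def)
qed

lemma partial_inner: "partial j (\<lambda>x. y \<bullet> x) x = y $ j"
proof -
  have "((\<lambda>x. y \<bullet> x) has_derivative (\<lambda>x. y \<bullet> x)) (at x)"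
    by (rule bounded_linear_imp_has_derivative[OF bounded_linear_inner_right])
  from partial_eq[OF this, of j] show ?thesis by (simp add: inner_axis)
qed

lemma exp_line_has_vector_derivative:
  "((\<lambda>t. c ^ n * exp (c * of_real t)) has_vector_derivative (c ^ Suc n * exp (c * of_real t))) (at t)"
  for c :: complex
proof -
  have "((\<lambda>z. c ^ n * exp (c * z)) has_field_derivative (c ^ Suc n * exp (c * of_real t))) (at (of_real t))"
    by (auto intro!: derivative_eq_intros)
  then show ?thesis by (rule has_vector_derivative_real_field)
qed

lemma smooth_exp:
  assumes "smooth s" shows "smooth (\<lambda>x. exp (c * of_real (s x)) :: complex)"
  using smooth_chain[where D="\<lambda>n t. c ^ n * exp (c * of_real t)", OF exp_line_has_vector_derivative assms] by simp

lemma partial_exp: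
  assumes "smooth s"
  shows "partial i (\<lambda>x. exp (c * of_real (s x)) :: complex) = (\<lambda>x. c * of_real (partial i s x) * exp (c * of_real (s x)))"
  using partial_chain(2)[OF exp_line_has_vector_derivative[of c 0] assms]
  by (simp add: scaleR_conv_of_real mult_ac)

lemma smooth_kernel: "smooth (kernel h y)"
  unfolding kernel_def[abs_def] by (intro smooth_exp smooth_inner)

lemma partial_kernel: "partial j (kernel h y) = (\<lambda>q. \<i> / of_real h * of_real (y $ j) * kernel h y q)"
proof -
  have "kernel h y = (\<lambda>q. exp ((\<i> / of_real h) * of_real (y \<bullet> q)))" by (simp add: kernel_def fun_eq_iff)
  then show ?thesis using partial_exp[OF smooth_inner[of y], of j "\<i> / of_real h"] by (simp only: partial_inner)
qed

lemma integrable_kernel_mult: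
  assumes "integrable lborel \<psi>"
  shows "integrable lborel (\<lambda>q. kernel h y q * \<psi> q)"
  using integrable_norm[OF assms]
  by (rule Bochner_Integration.integrable_bound) (use assms in \<open>auto simp: norm_mult integrable_iff_bounded\<close>)

text \<open>A factor \<open>y\<^sub>j\<close> amounts to a derivative of the kernel with respect to \<open>q\<^sub>j\<close>, which is moved
  to the function by partial integration.\<close>

lemma coord_mult_inv_fourier:
  fixes y :: "real^'d::finite"
  assumes \<psi>: "schwartz \<psi>" and h: "h > 0"
  shows "of_real (y $ j) * inv_fourier h \<psi> y = inv_fourier h (\<lambda>q. (\<i> * of_real h) * partial j \<psi> q) y"
proof -
  let ?f = "\<lambda>q. kernel h y q * \<psi> q"
  let ?c = "\<i> / of_real h * of_real (y $ j) :: complex"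
  have pf: "partial j ?f = (\<lambda>q. ?c * (kernel h y q * \<psi> q) + kernel h y q * partial j \<psi> q)"
    by (subst partial_mult[OF smooth_kernel schwartz_smooth[OF \<psi>]]) (simp add: partial_kernel mult.assoc)
  obtain A B where A: "\<And>q. (1 + norm q) ^ (2 * CARD('d)) * norm (partials [] \<psi> q) \<le> A"
    and B: "\<And>q. (1 + norm q) ^ (2 * CARD('d)) * norm (partials [j] \<psi> q) \<le> B"
    using schwartz_bound[OF \<psi>] by metis
  have "(LINT q|lborel. partial j ?f q) = 0"
  proof (rule integral_partial_eq_0)
    fix q :: "real^'d"
    let ?w = "(1 + norm q) ^ (2 * CARD('d))"
    have "?w * norm (partial j ?f q) \<le> ?w * (norm ?c * norm (\<psi> q) + norm (partial j \<psi> q))"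
      unfolding pf by (intro mult_left_mono norm_triangle_le add_mono) (auto simp: norm_mult norm_divide)
    also have "\<dots> = norm ?c * (?w * norm (\<psi> q)) + ?w * norm (partial j \<psi> q)"
      by (simp add: algebra_simps)
    also have "\<dots> \<le> norm ?c * A + B"
      using A[of q] B[of q] by (intro add_mono mult_left_mono) auto
    finally show "?w * norm (partial j ?f q) \<le> norm ?c * A + B" .
  qed (intro smooth_mult smooth_kernel schwartz_smooth \<psi> integrable_kernel_mult schwartz_integrable)+
  moreover have i1: "integrable lborel (\<lambda>q. ?c * (kernel h y q * \<psi> q))"
    by (intro integrable_mult_right integrable_kernel_mult schwartz_integrable \<psi>)
  have i2: "integrable lborel (\<lambda>q. kernel h y q * partial j \<psi> q)"
    by (intro integrable_kernel_mult schwartz_integrable schwartz_partial \<psi>)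
  ultimately have "?c * (LINT q|lborel. kernel h y q * \<psi> q) = - (LINT q|lborel. kernel h y q * partial j \<psi> q)"
    unfolding pf
    by (subst (asm) Bochner_Integration.integral_add[OF i1 i2]) (simp add: eq_neg_iff_add_eq_0)
  then have hi: "of_real h * (LINT q|lborel. kernel h y q * partial j \<psi> q) = - (\<i> * (of_real (y $ j) * (LINT q|lborel. kernel h y q * \<psi> q)))"
    using h by (simp add: field_simps)
  have "(\<i> * of_real h) * (LINT q|lborel. kernel h y q * partial j \<psi> q) = of_real (y $ j) * (LINT q|lborel. kernel h y q * \<psi> q)"
    unfolding mult.assoc hi by simp
  moreover have "(LINT q|lborel. kernel h y q * ((\<i> * of_real h) * partial j \<psi> q)) = (\<i> * of_real h) * (LINT q|lborel. kernel h y q * partial j \<psi> q)"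
    by (subst integral_mult_right_zero[symmetric]) (simp add: mult_ac)
  ultimately show ?thesis by (simp add: inv_fourier_kernel)
qed

lemma word_mult_inv_fourier:
  fixes y :: "real^'d::finite"
  assumes \<psi>: "schwartz \<psi>" and h: "h > 0"
  shows "(\<Prod>a\<leftarrow>w. of_real (y $ a)) * inv_fourier h \<psi> y = inv_fourier h (\<lambda>q. (\<i> * of_real h) ^ length w * partials w \<psi> q) y"
proof (induction w)
  case (Cons j w)
  have "(\<Prod>a\<leftarrow>j # w. of_real (y $ a)) * inv_fourier h \<psi> y = of_real (y $ j) * inv_fourier h (\<lambda>q. (\<i> * of_real h) ^ length w * partials w \<psi> q) y"
    unfolding Cons.IH[symmetric] by (simp add: mult_ac)
  also have "\<dots> = inv_fourier h (\<lambda>q. (\<i> * of_real h) * partial j (\<lambda>q. (\<i> * of_real h) ^ length w * partials w \<psi> q) q) y"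
    by (intro coord_mult_inv_fourier schwartz_cmult schwartz_partials \<psi> h)
  also have "partial j (\<lambda>q. (\<i> * of_real h) ^ length w * partials w \<psi> q) = (\<lambda>q. (\<i> * of_real h) ^ length w * partial j (partials w \<psi>) q)"
    by (intro partial_cmult schwartz_smooth schwartz_partials \<psi>)
  finally show ?case by (simp add: mult_ac)
qed simp

lemma inv_fourier_add:
  assumes "integrable lborel \<psi>" "integrable lborel \<eta>"
  shows "inv_fourier h (\<lambda>q. \<psi> q + \<eta> q) y = inv_fourier h \<psi> y + inv_fourier h \<eta> y"
  by (simp add: inv_fourier_kernel ring_distribs integrable_kernel_mult assms add_divide_distrib)

lemma inv_fourier_cmult: "inv_fourier h (\<lambda>q. c * \<psi> q) y = c * inv_fourier h \<psi> y"
proof -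
  have "(LINT q|lborel. kernel h y q * (c * \<psi> q)) = c * (LINT q|lborel. kernel h y q * \<psi> q)"
    by (subst integral_mult_right_zero[symmetric]) (simp add: mult_ac)
  then show ?thesis by (simp add: inv_fourier_kernel)
qed

lemma inv_fourier_sum:
  assumes "finite J" "\<And>j. j \<in> J \<Longrightarrow> integrable lborel (\<psi> j)"
  shows "inv_fourier h (\<lambda>q. \<Sum>j\<in>J. \<psi> j q) y = (\<Sum>j\<in>J. inv_fourier h (\<psi> j) y)"
  using assms
proof (induction J)
  case empty
  then show ?case by (simp add: inv_fourier_kernel)
qed (simp add: inv_fourier_add)

lemma measurable_inv_fourier [measurable]:
  assumes [measurable]: "\<psi> \<in> borel_measurable borel"
  shows "inv_fourier h \<psi> \<in> borel_measurable borel"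
proof -
  have "(\<lambda>y. LINT q|lborel. kernel h y q * \<psi> q) \<in> borel_measurable borel"
    by (rule sigma_finite_measure.borel_measurable_lebesgue_integral[OF sigma_finite_lborel]) measurable
  then show ?thesis unfolding inv_fourier_kernel[abs_def] by measurable
qed

lemma norm_inv_fourier_le:
  fixes y :: "real^'d::finite"
  shows "h > 0 \<Longrightarrow> norm (inv_fourier h \<psi> y) \<le> (LINT q|lborel. norm (\<psi> q)) / (2 * pi * h) ^ CARD('d)"
  unfolding inv_fourier_kernel
  by (auto simp: norm_divide norm_mult norm_power intro!: divide_right_mono order_trans[OF integral_norm_bound])

text \<open>Multiplying by \<open>1 + y\<^sub>j\<^sup>2\<close> for every \<open>j\<close> yields the transform of another Schwartz function,
  which is bounded. So the transform decays like \<open>cauchy_weight\<close>.\<close>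

lemma integrable_inv_fourier:
  fixes \<psi> :: "real^'d::finite \<Rightarrow> complex"
  assumes \<psi>: "schwartz \<psi>" and h: "h > 0"
  shows "integrable lborel (inv_fourier h \<psi>)"
proof -
  have "\<exists>\<eta>. schwartz \<eta> \<and> (\<forall>y. of_real (\<Prod>j\<in>J. 1 + (y $ j)\<^sup>2) * inv_fourier h \<psi> y = inv_fourier h \<eta> y)" if "finite J" for J
    using that
  proof induction
    case empty
    then show ?case using \<psi> by auto
  next
    case (insert j J)
    then obtain \<eta> where \<eta>: "schwartz \<eta>" "\<And>y. of_real (\<Prod>j\<in>J. 1 + (y $ j)\<^sup>2) * inv_fourier h \<psi> y = inv_fourier h \<eta> y" by blast
    let ?\<eta> = "\<lambda>q. \<eta> q + (\<i> * of_real h)\<^sup>2 * partials [j, j] \<eta> q"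
    have s: "schwartz ?\<eta>" by (intro schwartz_add schwartz_cmult schwartz_partials \<eta>)
    have "of_real (\<Prod>j\<in>insert j J. 1 + (y $ j)\<^sup>2) * inv_fourier h \<psi> y = inv_fourier h ?\<eta> y" for y
    proof -
      have "of_real (\<Prod>j\<in>insert j J. 1 + (y $ j)\<^sup>2) * inv_fourier h \<psi> y = inv_fourier h \<eta> y + (\<Prod>a\<leftarrow>[j, j]. of_real (y $ a)) * inv_fourier h \<eta> y"
        using insert by (simp add: \<eta>(2)[symmetric] power2_eq_square algebra_simps)
      also have "\<dots> = inv_fourier h ?\<eta> y"
        by (subst word_mult_inv_fourier[OF \<eta>(1) h], subst inv_fourier_add[symmetric])
          (auto intro!: schwartz_integrable \<eta>(1) schwartz_cmult schwartz_partial simp: power2_eq_square)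
      finally show ?thesis .
    qed
    then show ?case using s by blast
  qed
  from this[of UNIV] obtain \<eta> where \<eta>: "\<And>y. of_real (\<Prod>j\<in>UNIV. 1 + (y $ j)\<^sup>2) * inv_fourier h \<psi> y = inv_fourier h \<eta> y" by auto
  define C where "C = (LINT q|lborel. norm (\<eta> q)) / (2 * pi * h) ^ CARD('d)"
  have C: "norm (inv_fourier h \<eta> y) \<le> C" for y unfolding C_def using h by (rule norm_inv_fourier_le)
  show ?thesis
  proof (rule Bochner_Integration.integrable_bound)
    show "integrable lborel (\<lambda>x::real^'d. C * cauchy_weight x)"
      using integrable_cauchy_weight by (rule integrable_mult_right)
    have [measurable]: "\<psi> \<in> borel_measurable borel" using \<psi> schwartz_smooth smooth_measurable by blast
    show "inv_fourier h \<psi> \<in> borel_measurable lborel" by measurable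
    show "AE y in lborel. norm (inv_fourier h \<psi> y) \<le> norm (C * cauchy_weight y)"
    proof (rule AE_I2)
      fix y :: "real^'d"
      define P where "P = (\<Prod>j\<in>UNIV. 1 + (y $ j)\<^sup>2)"
      have P: "P > 0" unfolding P_def by (auto intro!: prod_pos add_pos_nonneg)
      have "P * norm (inv_fourier h \<psi> y) = norm (of_real P * inv_fourier h \<psi> y)" using P by (simp add: norm_mult)
      also have "\<dots> \<le> C" unfolding P_def \<eta> by (rule C)
      finally have "norm (inv_fourier h \<psi> y) \<le> C * inverse P" using P by (simp add: field_simps)
      also have "inverse P = cauchy_weight y" by (simp add: P_def cauchy_weight_def prod_inversef[symmetric] o_def)
      finally show "norm (inv_fourier h \<psi> y) \<le> norm (C * cauchy_weight y)" by simp
    qed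
  qed
qed

section \<open>Fourier inversion by Gaussian regularisation\<close>

lemma integrable_gaussian:
  assumes "e > 0" shows "integrable lborel (\<lambda>s::real. exp (- (e * s)\<^sup>2 / 2))"
proof -
  have "integrable lborel (\<lambda>s. sqrt (2 * pi) * std_normal_density s)"
    using integrable_std_normal_moment[of 0] by (intro integrable_mult_right) simp
  then have "integrable lborel (\<lambda>s::real. exp (- s\<^sup>2 / 2))" by (simp add: std_normal_density_def)
  then show ?thesis using lborel_integrable_real_affine_iff[of e "\<lambda>s. exp (- s\<^sup>2 / 2)" 0] assms by simp
qed

text \<open>Up to scaling this is the characteristic function of the standard normal distribution.\<close>

lemma fourier_gaussian_real:
  assumes "e > 0"
  shows "(LINT s|lborel. cis (u * s) * of_real (exp (- (e * s)\<^sup>2 / 2))) = of_real (sqrt (2 * pi) / e * exp (- (u / e)\<^sup>2 / 2))"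
proof -
  have [simp]: "e * (inverse e * s) = s" for s using assms by (simp add: mult.assoc[symmetric])
  have "(LINT s|lborel. cis (u * s) * of_real (exp (- (e * s)\<^sup>2 / 2))) =
    inverse e *\<^sub>R (LINT s|lborel. cis (u * (inverse e * s)) * of_real (exp (- s\<^sup>2 / 2)))"
    using assms by (subst lborel_integral_real_affine[of "inverse e" _ 0]) auto
  also have "(LINT s|lborel. cis (u * (inverse e * s)) * of_real (exp (- s\<^sup>2 / 2))) =
      (LINT s|lborel. of_real (sqrt (2 * pi)) * (std_normal_density s *\<^sub>R cis (u / e * s)))"
    by (rule Bochner_Integration.integral_cong) (auto simp: std_normal_density_def scaleR_conv_of_real field_simps)
  also have "\<dots> = of_real (sqrt (2 * pi)) * (LINT s|lborel. std_normal_density s *\<^sub>R cis (u / e * s))"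
    by (rule integral_mult_right_zero)
  also have "(LINT s|lborel. std_normal_density s *\<^sub>R cis (u / e * s)) = (LINT s|density lborel std_normal_density. cis (u / e * s))"
    by (subst integral_density) auto
  also have "\<dots> = char std_normal_distribution (u / e)"
    by (simp add: char_def cis_conv_exp)
  also have "\<dots> = of_real (exp (- (u / e)\<^sup>2 / 2))"
    by (subst char_std_normal_distribution) simp
  finally show ?thesis using assms by (simp add: scaleR_conv_of_real field_simps)
qed

lemma integral_scale:
  fixes f :: "real^'d::finite \<Rightarrow> 'b::{banach,second_countable_topology}"
  assumes [measurable]: "f \<in> borel_measurable borel" and "c > 0"
  shows "(LINT x|lborel. f x) = c ^ CARD('d) *\<^sub>R (LINT x|lborel. f (t + c *\<^sub>R x))"
proof -
  have "(LINT x|lborel. f x) = (LINT x|density (distr lborel borel (\<lambda>x. t + c *\<^sub>R x)) (\<lambda>_. ennreal (\<bar>c\<bar> ^ DIM(real^'d))). f x)"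
    using lborel_affine[of c t] assms by simp
  also have "\<dots> = (LINT x|distr lborel borel (\<lambda>x. t + c *\<^sub>R x). c ^ CARD('d) *\<^sub>R f x)"
    using assms by (subst integral_density) auto
  also have "\<dots> = (LINT x|lborel. c ^ CARD('d) *\<^sub>R f (t + c *\<^sub>R x))"
    by (subst integral_distr) auto
  also have "\<dots> = c ^ CARD('d) *\<^sub>R (LINT x|lborel. f (t + c *\<^sub>R x))"
    by simp
  finally show ?thesis .
qed

lemma kernel_eq_prod: "kernel h y z = (\<Prod>j\<in>UNIV. cis ((z $ j / h) * y $ j))"
proof -
  have cis_sum: "cis (\<Sum>j\<in>J. g j) = (\<Prod>j\<in>J. cis (g j))" if "finite J" for J and g :: "'a \<Rightarrow> real"
    using that by induction (auto simp: cis_mult[symmetric])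
  have "(y \<bullet> z) / h = (\<Sum>j\<in>UNIV. (z $ j / h) * y $ j)"
    by (simp add: inner_vec_def sum_divide_distrib mult.commute)
  then show ?thesis by (simp add: kernel_eq_cis cis_sum)
qed

definition gauss :: "real \<Rightarrow> real^'d::finite \<Rightarrow> real" where
  "gauss e y = (\<Prod>j\<in>UNIV. exp (- (e * y $ j)\<^sup>2 / 2))"

lemma gauss_measurable [measurable]: "gauss e \<in> borel_measurable borel"
  unfolding gauss_def[abs_def] by measurable

lemma gauss_pos: "gauss e y > 0" and gauss_le_1: "gauss e y \<le> 1"
  by (auto simp: gauss_def intro!: prod_pos prod_le_1)

lemma abs_gauss [simp]: "\<bar>gauss e y\<bar> = gauss e y"
  using gauss_pos by (rule abs_of_pos)

lemma integrable_gauss: "e > 0 \<Longrightarrow> integrable lborel (gauss e)"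
  unfolding gauss_def[abs_def] by (intro integrable_lborel_vec_prod integrable_gaussian)

lemma fourier_gauss:
  fixes z :: "real^'d::finite"
  assumes "e > 0"
  shows "(LINT y|lborel. kernel h y z * of_real (gauss e y)) = of_real ((sqrt (2 * pi) / e) ^ CARD('d) * gauss (inverse (e * h)) z)"
proof -
  have int: "integrable lborel (\<lambda>s. cis (u * s) * complex_of_real (exp (- (e * s)\<^sup>2 / 2)))" for u
    using integrable_gaussian[OF assms]
    by (rule Bochner_Integration.integrable_bound) (auto simp: norm_mult)
  have "(LINT y|lborel. kernel h y z * of_real (gauss e y)) = (LINT y|lborel. (\<Prod>j\<in>UNIV. cis ((z $ j / h) * y $ j) * of_real (exp (- (e * y $ j)\<^sup>2 / 2))))"
    unfolding kernel_eq_prod gauss_def by (simp add: prod.distrib)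
  also have "\<dots> = (\<Prod>j\<in>UNIV. of_real (sqrt (2 * pi) / e * exp (- (z $ j / h / e)\<^sup>2 / 2)))"
    by (rule trans[OF integral_lborel_vec_prod[where f="\<lambda>j s. cis ((z $ j / h) * s) * of_real (exp (- (e * s)\<^sup>2 / 2))", OF int]
        prod.cong[OF refl fourier_gaussian_real[OF assms]]])
  also have "\<dots> = of_real ((sqrt (2 * pi) / e) ^ CARD('d) * gauss (inverse (e * h)) z)"
  proof -
    have "(- (z $ j / h / e)\<^sup>2 / 2) = (- (inverse (e * h) * z $ j)\<^sup>2 / 2)" for j
    proof -
      have "z $ j / h / e = inverse (e * h) * z $ j" by (simp add: field_simps)
      then show ?thesis by (simp only:)
    qed
    then have "(\<Prod>j\<in>UNIV. sqrt (2 * pi) / e * exp (- (z $ j / h / e)\<^sup>2 / 2)) = (sqrt (2 * pi) / e) ^ CARD('d) * gauss (inverse (e * h)) z"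
      by (simp only: prod.distrib prod_constant gauss_def)
    then show ?thesis by (simp only: of_real_prod[symmetric])
  qed
  finally show ?thesis .
qed

text \<open>The double integral is not absolutely convergent. Inserting the factor \<open>gauss e y\<close> makes
  Fubini applicable, and the transform of this factor is an approximate identity concentrated
  at \<open>x\<close>. As \<open>e\<close> tends to 0, the regularised integral converges both to the left side and to
  the value at \<open>x\<close>.\<close>

theorem fourier_inv_fourier:
  fixes \<psi> :: "real^'d::finite \<Rightarrow> complex"
  assumes \<psi>: "schwartz \<psi>" and h: "h > 0"
  shows "fourier h (inv_fourier h \<psi>) = \<psi>"
proof
  fix x :: "real^'d"
  define c where "c = complex_of_real ((2 * pi * h) ^ CARD('d))"
  define t where "t n = inverse (real (Suc n))" for n
  have t: "t n > 0" for n by (simp add: t_def)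
  have t0: "t \<longlonglongrightarrow> 0" using LIMSEQ_inverse_real_of_nat by (simp add: t_def[abs_def])
  have [measurable]: "\<psi> \<in> borel_measurable borel" using \<psi> schwartz_smooth smooth_measurable by blast
  \<comment> \<open>the regularised inversion integral at \<open>x\<close>\<close>
  define J where "J n = (LINT y|lborel. kernel h y (- x) * inv_fourier h \<psi> y * of_real (gauss (t n) y))" for n
  have "J \<longlonglongrightarrow> (LINT y|lborel. kernel h y (- x) * inv_fourier h \<psi> y)"
    unfolding J_def
  proof (rule integral_dominated_convergence[where w="\<lambda>y. norm (inv_fourier h \<psi> y)"])
    show "integrable lborel (\<lambda>y. norm (inv_fourier h \<psi> y))"
      using integrable_inv_fourier[OF \<psi> h] by (rule integrable_norm)
    show "AE y in lborel. (\<lambda>n. kernel h y (- x) * inv_fourier h \<psi> y * of_real (gauss (t n) y)) \<longlonglongrightarrow> kernel h y (- x) * inv_fourier h \<psi> y"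
    proof (rule AE_I2)
      fix y :: "real^'d"
      have "(\<lambda>n. gauss (t n) y) \<longlonglongrightarrow> (\<Prod>j\<in>UNIV. exp (- (0 * y $ j)\<^sup>2 / 2))"
        unfolding gauss_def by (intro tendsto_intros t0) auto
      then have "(\<lambda>n. kernel h y (- x) * inv_fourier h \<psi> y * of_real (gauss (t n) y)) \<longlonglongrightarrow> kernel h y (- x) * inv_fourier h \<psi> y * of_real 1"
        by (intro tendsto_intros) simp
      then show "(\<lambda>n. kernel h y (- x) * inv_fourier h \<psi> y * of_real (gauss (t n) y)) \<longlonglongrightarrow> kernel h y (- x) * inv_fourier h \<psi> y" by simp
    qed
    show "AE y in lborel. norm (kernel h y (- x) * inv_fourier h \<psi> y * of_real (gauss (t n) y)) \<le> norm (inv_fourier h \<psi> y)" for n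
      by (intro AE_I2) (simp add: norm_mult mult_left_le gauss_le_1)
  qed measurable
  then have lim1: "J \<longlonglongrightarrow> fourier h (inv_fourier h \<psi>) x" by (simp add: fourier_kernel)
  \<comment> \<open>Fubini, the transform of the Gaussian, and the substitution \<open>q = x + (t n * h) *\<^sub>R v\<close>\<close>
  have J_eq: "J n = (LINT v|lborel. \<psi> (x + (t n * h) *\<^sub>R v) * of_real (gauss 1 v)) / of_real (sqrt (2 * pi) ^ CARD('d))" for n
  proof -
    have kk: "kernel h y (- x) * kernel h y q = kernel h y (q - x)" for y q
      by (simp add: kernel_eq_cis cis_mult inner_diff_right diff_divide_distrib)
    have "J n = (LINT y|lborel. (LINT q|lborel. kernel h y (q - x) * of_real (gauss (t n) y) * \<psi> q)) / c"
    proof -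
      have "J n = (LINT y|lborel. (LINT q|lborel. kernel h y (q - x) * of_real (gauss (t n) y) * \<psi> q) / c)"
        unfolding J_def
      proof (rule Bochner_Integration.integral_cong[OF refl])
        fix y :: "real^'d"
        have "(LINT q|lborel. kernel h y (q - x) * of_real (gauss (t n) y) * \<psi> q) =
          (LINT q|lborel. (kernel h y (- x) * of_real (gauss (t n) y)) * (kernel h y q * \<psi> q))"
          by (simp add: kk[symmetric] mult_ac)
        also have "\<dots> = (kernel h y (- x) * of_real (gauss (t n) y)) * (LINT q|lborel. kernel h y q * \<psi> q)"
          by (rule integral_mult_right_zero)
        finally show "kernel h y (- x) * inv_fourier h \<psi> y * of_real (gauss (t n) y) = (LINT q|lborel. kernel h y (q - x) * of_real (gauss (t n) y) * \<psi> q) / c"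
          by (simp add: inv_fourier_kernel c_def mult_ac)
      qed
      then show ?thesis by simp
    qed
    also have "(LINT y|lborel. (LINT q|lborel. kernel h y (q - x) * of_real (gauss (t n) y) * \<psi> q)) =
       (LINT q|lborel. (LINT y|lborel. kernel h y (q - x) * of_real (gauss (t n) y) * \<psi> q))"
    proof (rule lborel_pair.Fubini_integral[symmetric], rule lborel_pair.Fubini_integrable)
      show "(\<lambda>(y, q). kernel h y (q - x) * of_real (gauss (t n) y) * \<psi> q) \<in> borel_measurable (lborel \<Otimes>\<^sub>M lborel)"
        by measurable
      have "integrable lborel (\<lambda>y. gauss (t n) y * (LINT q|lborel. norm (\<psi> q)))"
        by (intro integrable_mult_left integrable_gauss t)
      then show "integrable lborel (\<lambda>y. LINT q|lborel. norm (case (y, q) of (y, q) \<Rightarrow> kernel h y (q - x) * of_real (gauss (t n) y) * \<psi> q))"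
        using gauss_pos[of "t n"] by (simp add: norm_mult abs_of_pos)
      have "integrable lborel (\<lambda>q. kernel h y (q - x) * of_real (gauss (t n) y) * \<psi> q)" for y
      proof (rule Bochner_Integration.integrable_bound[OF schwartz_integrable[OF \<psi>]])
        show "AE q in lborel. norm (kernel h y (q - x) * of_real (gauss (t n) y) * \<psi> q) \<le> norm (\<psi> q)"
          using gauss_le_1[of "t n" y] gauss_pos[of "t n" y] by (intro AE_I2) (simp add: norm_mult mult_left_le_one_le less_imp_le)
      qed measurable
      then show "AE y in lborel. integrable lborel (\<lambda>q. case (y, q) of (y, q) \<Rightarrow> kernel h y (q - x) * of_real (gauss (t n) y) * \<psi> q)"
        by simp
    qed
    also have "\<dots> = (LINT q|lborel. of_real ((sqrt (2 * pi) / t n) ^ CARD('d) * gauss (inverse (t n * h)) (q - x)) * \<psi> q)"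
      by (simp add: fourier_gauss[OF t])
    also have "\<dots> = (t n * h) ^ CARD('d) *\<^sub>R (LINT v|lborel. of_real ((sqrt (2 * pi) / t n) ^ CARD('d) * gauss (inverse (t n * h)) ((t n * h) *\<^sub>R v)) * \<psi> (x + (t n * h) *\<^sub>R v))"
      using t h by (subst integral_scale[where c="t n * h" and t=x]) auto
    also have "\<dots> = of_real ((h * sqrt (2 * pi)) ^ CARD('d)) * (LINT v|lborel. \<psi> (x + (t n * h) *\<^sub>R v) * of_real (gauss 1 v))"
    proof -
      have "inverse (t n * h) * ((t n * h) * s) = s" for s :: real using t[of n] h by (simp add: field_simps)
      then have g: "gauss (inverse (t n * h)) ((t n * h) *\<^sub>R v) = gauss 1 v" for v :: "real^'d"
        unfolding gauss_def vector_scaleR_component real_scaleR_def by (simp only: mult_1)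
      have "(LINT v|lborel. of_real ((sqrt (2 * pi) / t n) ^ CARD('d) * gauss 1 v) * \<psi> (x + (t n * h) *\<^sub>R v))
          = of_real ((sqrt (2 * pi) / t n) ^ CARD('d)) * (LINT v|lborel. \<psi> (x + (t n * h) *\<^sub>R v) * of_real (gauss 1 v))"
        by (subst integral_mult_right_zero[symmetric]) (simp add: mult_ac)
      moreover have "(t n * h) ^ CARD('d) * (sqrt (2 * pi) / t n) ^ CARD('d) = (h * sqrt (2 * pi)) ^ CARD('d)"
        using t[of n] by (simp add: power_mult_distrib[symmetric])
      ultimately show ?thesis
        unfolding g scaleR_conv_of_real[where 'a=complex] by (simp only: mult.assoc[symmetric] of_real_mult[symmetric])
    qed
    also have "c = of_real ((h * sqrt (2 * pi)) ^ CARD('d)) * of_real (sqrt (2 * pi) ^ CARD('d))"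
      unfolding c_def of_real_mult[symmetric] by (subst power_mult_distrib[symmetric]) (simp add: mult_ac)
    finally show ?thesis using h by (simp del: of_real_power)
  qed
  obtain C where C: "\<And>x. norm (\<psi> x) \<le> C" using schwartz_bounded[OF \<psi>] by metis
  have cont: "isCont \<psi> x"
    using smooth_continuous_on[OF schwartz_smooth[OF \<psi>], of UNIV] by (simp add: continuous_on_eq_continuous_at)
  have "(\<lambda>n. LINT v|lborel. \<psi> (x + (t n * h) *\<^sub>R v) * of_real (gauss 1 v)) \<longlonglongrightarrow> (LINT v|lborel. \<psi> x * of_real (gauss 1 (v :: real^'d)))"
  proof (rule integral_dominated_convergence[where w="\<lambda>v::real^'d. C * gauss 1 v"])
    show "integrable lborel (\<lambda>v::real^'d. C * gauss 1 v)" by (intro integrable_mult_right integrable_gauss) simp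
    show "AE v in lborel. (\<lambda>n. \<psi> (x + (t n * h) *\<^sub>R v) * of_real (gauss 1 v)) \<longlonglongrightarrow> \<psi> x * of_real (gauss 1 v)"
    proof (rule AE_I2)
      fix v :: "real^'d"
      have "(\<lambda>n. x + (t n * h) *\<^sub>R v) \<longlonglongrightarrow> x + (0 * h) *\<^sub>R v" by (intro tendsto_intros t0)
      then have "(\<lambda>n. \<psi> (x + (t n * h) *\<^sub>R v)) \<longlonglongrightarrow> \<psi> x" by (intro isCont_tendsto_compose[OF cont]) simp
      then show "(\<lambda>n. \<psi> (x + (t n * h) *\<^sub>R v) * of_real (gauss 1 v)) \<longlonglongrightarrow> \<psi> x * of_real (gauss 1 v)" by (intro tendsto_intros)
    qed
    show "AE v in lborel. norm (\<psi> (x + (t n * h) *\<^sub>R v) * of_real (gauss 1 v)) \<le> C * gauss 1 v" for n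
      by (intro AE_I2) (auto simp: norm_mult less_imp_le[OF gauss_pos] intro!: mult_right_mono C)
  qed measurable
  also have "(LINT v|lborel. \<psi> x * of_real (gauss 1 (v :: real^'d))) = \<psi> x * of_real (sqrt (2 * pi) ^ CARD('d))"
  proof -
    have "(LINT y|lborel. complex_of_real (gauss 1 (y :: real^'d))) = of_real (sqrt (2 * pi) ^ CARD('d))"
      using fourier_gauss[of 1 1 "0 :: real^'d"] by (simp add: kernel_def gauss_def)
    then show ?thesis by (subst integral_mult_right_zero) (simp del: of_real_power)
  qed
  finally have "(\<lambda>n. (LINT v|lborel. \<psi> (x + (t n * h) *\<^sub>R v) * of_real (gauss 1 v)) / of_real (sqrt (2 * pi) ^ CARD('d))) \<longlonglongrightarrow> \<psi> x * of_real (sqrt (2 * pi) ^ CARD('d)) / of_real (sqrt (2 * pi) ^ CARD('d))"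
    by (intro tendsto_intros) auto
  then have "J \<longlonglongrightarrow> \<psi> x" unfolding J_eq[abs_def] by simp
  then show "fourier h (inv_fourier h \<psi>) x = \<psi> x" using lim1 LIMSEQ_unique by blast
qed

section \<open>Test functions\<close>

text \<open>The \<open>n\<close>-th derivative of \<open>exp (- 1 / t)\<close>, extended by 0 to \<open>t \<le> 0\<close>. In terms of \<open>s = 1 / t\<close>,
  the derivative of \<open>p s * exp (- s)\<close> with respect to \<open>t\<close> is \<open>s\<^sup>2 * (p s - p' s) * exp (- s)\<close>,
  whence the recursion for the polynomials.\<close>

definition bump_deriv :: "nat \<Rightarrow> real \<Rightarrow> real" where
  "bump_deriv n t = (if t > 0 then
     poly (((\<lambda>p. [:0, 0, 1:] * (p - pderiv p)) ^^ n) 1) (inverse t) * exp (- inverse t) else 0)"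

lemma poly_mult_exp_minus_tendsto_0: "((\<lambda>s. poly p s * exp (- s)) \<longlongrightarrow> 0) at_top" for p :: "real poly"
proof -
  have "((\<lambda>s. \<Sum>i\<le>degree p. coeff p i * (s ^ i / exp s)) \<longlongrightarrow> (\<Sum>i\<le>degree p. coeff p i * 0)) at_top"
    by (intro tendsto_intros tendsto_power_div_exp_0)
  then show ?thesis by (simp add: poly_altdef sum_distrib_right exp_minus divide_inverse mult.assoc)
qed

lemma poly_inverse_mult_exp_tendsto_0: "((\<lambda>t. poly p (inverse t) * exp (- inverse t)) \<longlongrightarrow> 0) (at_right 0)" for p :: "real poly"
  using poly_mult_exp_minus_tendsto_0 filterlim_inverse_at_top_right by (rule filterlim_compose)

text \<open>The only delicate point is 0, where the difference quotient from the right is again a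
  polynomial in \<open>1 / t\<close> times \<open>exp (- 1 / t)\<close>.\<close>

lemma bump_deriv_has_derivative:
  "(bump_deriv n has_real_derivative bump_deriv (Suc n) t) (at t)"
proof -
  define p where "p = ((\<lambda>p. [:0, 0, 1:] * (p - pderiv p)) ^^ n) (1 :: real poly)"
  have D: "bump_deriv n t = (if t > 0 then poly p (inverse t) * exp (- inverse t) else 0)" for t
    by (simp add: bump_deriv_def p_def)
  have D': "bump_deriv (Suc n) t = (if t > 0 then (inverse t)\<^sup>2 * (poly p (inverse t) - poly (pderiv p) (inverse t)) * exp (- inverse t) else 0)" for t
    by (simp add: bump_deriv_def p_def power2_eq_square)
  consider "t > 0" | "t < 0" | "t = 0" by linarith
  then show ?thesis
  proof cases
    case 1
    have "((\<lambda>t. poly p (inverse t) * exp (- inverse t)) has_real_derivative bump_deriv (Suc n) t) (at t)"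
      using 1 unfolding D'
      by (auto intro!: derivative_eq_intros poly_DERIV[THEN DERIV_chain2] simp: power2_eq_square algebra_simps)
    then show ?thesis
      by (rule has_field_derivative_transform_within_open[where S="{0<..}"]) (use 1 in \<open>auto simp: D\<close>)
  next
    case 2
    have "((\<lambda>t. 0) has_real_derivative bump_deriv (Suc n) t) (at t)" using 2 by (simp add: D')
    then show ?thesis
      by (rule has_field_derivative_transform_within_open[where S="{..<0}"]) (use 2 in \<open>auto simp: D\<close>)
  next
    case 3
    have l: "((\<lambda>y. bump_deriv n y / y) \<longlongrightarrow> 0) (at_left 0)"
      by (rule tendsto_eventually) (auto simp: D eventually_at_left_field intro: exI[of _ "-1"])
    have r: "((\<lambda>y. bump_deriv n y / y) \<longlongrightarrow> 0) (at_right 0)"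
    proof (rule Lim_transform_eventually[OF poly_inverse_mult_exp_tendsto_0[of "pCons 0 p"]])
      show "\<forall>\<^sub>F y in at_right 0. poly (pCons 0 p) (inverse y) * exp (- inverse y) = bump_deriv n y / y"
        by (auto simp: D eventually_at_right_field divide_inverse intro!: exI[of _ 1])
    qed
    have "((\<lambda>y. (bump_deriv n y - bump_deriv n 0) / (y - 0)) \<longlongrightarrow> 0) (at 0)"
      using l r by (simp add: D filterlim_at_split)
    then show ?thesis using 3 by (simp add: has_field_derivative_iff D')
  qed
qed

definition bump :: "real^'d::finite \<Rightarrow> real \<Rightarrow> real^'d \<Rightarrow> real" where
  "bump x0 r x = bump_deriv 0 (r\<^sup>2 - (norm (x - x0))\<^sup>2)"

lemma smooth_bump: "smooth (bump x0 r)"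
proof -
  have "smooth (\<lambda>x. r\<^sup>2 + (-1) * (\<Sum>j\<in>UNIV. (x $ j + - (x0 $ j)) * (x $ j + - (x0 $ j))))"
    by (intro smooth_add smooth_const smooth_mult smooth_sum smooth_coord)
  moreover have "(bump_deriv n has_vector_derivative bump_deriv (Suc n) t) (at t)" for n t
    using bump_deriv_has_derivative has_real_derivative_iff_has_vector_derivative by blast
  ultimately have "smooth (\<lambda>x. bump_deriv 0 (r\<^sup>2 + (-1) * (\<Sum>j\<in>UNIV. (x $ j + - (x0 $ j)) * (x $ j + - (x0 $ j)))))"
    by (rule smooth_chain[where D=bump_deriv, rotated])
  then show ?thesis
    by (simp add: bump_def[abs_def] power2_norm_eq_inner inner_vec_def)
qed

lemma bump_pos_iff: "r > 0 \<Longrightarrow> bump x0 r x > 0 \<longleftrightarrow> dist x x0 < r"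
proof -
  assume r: "r > 0"
  have "bump x0 r x > 0 \<longleftrightarrow> (norm (x - x0))\<^sup>2 < r\<^sup>2" by (simp add: bump_def bump_deriv_def)
  also have "\<dots> \<longleftrightarrow> norm (x - x0) < r"
    using power_strict_mono[of "norm (x - x0)" r 2] power_less_imp_less_base[of "norm (x - x0)" 2 r] r by auto
  finally show ?thesis by (simp add: dist_norm)
qed

lemma bump_nonneg: "bump x0 r x \<ge> 0"
  by (simp add: bump_def bump_deriv_def)

lemma test_function_iff: "test_function \<psi> \<longleftrightarrow> smooth \<psi> \<and> bounded {x. \<psi> x \<noteq> 0}"
  by (simp add: test_function_def compact_closure)

lemma test_function_smooth: "test_function \<psi> \<Longrightarrow> smooth \<psi>"
  by (simp add: test_function_def)

lemma test_function_bump: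
  assumes "r > 0" shows "test_function (\<lambda>x. of_real (bump x0 r x))"
proof -
  have "{x. complex_of_real (bump x0 r x) \<noteq> 0} \<subseteq> cball x0 r"
  proof
    fix x assume "x \<in> {x. complex_of_real (bump x0 r x) \<noteq> 0}"
    then have "bump x0 r x > 0" using bump_nonneg[of x0 r x] by simp
    then show "x \<in> cball x0 r" using bump_pos_iff[OF assms, of x0 x] by (simp add: dist_commute)
  qed
  then have "bounded {x. complex_of_real (bump x0 r x) \<noteq> 0}" by (rule bounded_subset[OF bounded_cball])
  then show ?thesis
    unfolding test_function_def compact_closure by (intro conjI smooth_of_real smooth_bump)
qed

lemma partials_zero_on_open:
  assumes "smooth f" "open U" "\<And>x. x \<in> U \<Longrightarrow> f x = 0" "x \<in> U"
  shows "partials w f x = 0"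
  using assms(4)
proof (induction w arbitrary: x)
  case (Cons i w)
  have "((\<lambda>x. 0) has_derivative (\<lambda>x. 0)) (at x)" by simp
  then have "(partials w f has_derivative (\<lambda>x. 0)) (at x)"
    by (rule has_derivative_transform_within_open[OF _ assms(2) Cons.prems]) (simp add: Cons.IH)
  then show ?case using partial_eq by fastforce
qed (use assms in auto)

lemma test_function_partials:
  assumes "test_function \<psi>" shows "test_function (partials w \<psi>)"
proof -
  let ?K = "closure {x. \<psi> x \<noteq> 0}"
  have zero: "\<psi> x = 0" if "x \<in> - ?K" for x
    using that closure_subset[of "{x. \<psi> x \<noteq> 0}"] by blast
  have "partials w \<psi> x = 0" if "x \<in> - ?K" for x
    using partials_zero_on_open[OF test_function_smooth[OF assms] _ zero that] by (simp add: open_Compl)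
  then have "{x. partials w \<psi> x \<noteq> 0} \<subseteq> ?K" by blast
  moreover have "bounded ?K" using assms by (simp add: test_function_iff bounded_closure)
  ultimately show ?thesis
    using smooth_partials[OF test_function_smooth[OF assms]] bounded_subset unfolding test_function_iff by blast
qed

lemma test_function_partial: "test_function \<psi> \<Longrightarrow> test_function (partial i \<psi>)"
  using test_function_partials[of \<psi> "[i]"] by simp

lemma test_function_mult:
  assumes "smooth u" "test_function \<psi>" shows "test_function (\<lambda>x. u x * \<psi> x)"
proof -
  have "{x. u x * \<psi> x \<noteq> 0} \<subseteq> {x. \<psi> x \<noteq> 0}" by auto
  then have "bounded {x. u x * \<psi> x \<noteq> 0}"
    using assms(2) bounded_subset unfolding test_function_iff by blast
  then show ?thesis using assms smooth_mult[of u \<psi>] unfolding test_function_iff by simp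
qed

lemma test_function_decay:
  assumes "test_function \<psi>" shows "\<exists>C. \<forall>x. (1 + norm x) ^ k * norm (\<psi> x) \<le> C"
proof -
  let ?K = "closure {x. \<psi> x \<noteq> 0}" and ?g = "\<lambda>x. (1 + norm x) ^ k * norm (\<psi> x)"
  have "continuous_on ?K \<psi>" using assms by (intro smooth_continuous_on test_function_smooth)
  then have "continuous_on ?K ?g" by (intro continuous_on_mult continuous_on_norm continuous_on_power continuous_on_add continuous_on_const continuous_on_id)
  moreover have "compact ?K" using assms by (simp only: test_function_def)
  ultimately have "bounded (?g ` ?K)" by (intro compact_imp_bounded compact_continuous_image)
  then obtain C where C: "\<forall>y\<in>?g ` ?K. norm y \<le> C" unfolding bounded_iff ..
  have "?g x \<le> max C 0" for x
  proof (cases "x \<in> ?K")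
    case True
    from bspec[OF C imageI[OF this]] have "?g x \<le> C" by (simp only: real_norm_def abs_le_iff)
    then show ?thesis by simp
  next
    case False
    then have "\<psi> x = 0" using closure_subset[of "{x. \<psi> x \<noteq> 0}"] by blast
    then show ?thesis by simp
  qed
  then show ?thesis by blast
qed

lemma test_function_schwartz: "test_function \<psi> \<Longrightarrow> schwartz \<psi>"
  unfolding schwartz_iff using test_function_decay[OF test_function_partials] test_function_smooth by blast

lemma integral_by_parts:
  assumes u: "smooth u" and \<psi>: "test_function \<psi>"
  shows "(LINT x|lborel. u x * partial i \<psi> x) = - (LINT x|lborel. partial i u x * \<psi> x)"
proof -
  have t: "test_function (\<lambda>x. u x * \<psi> x)" by (rule test_function_mult[OF u \<psi>])
  have i1: "integrable lborel (\<lambda>x. partial i u x * \<psi> x)"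
    by (intro schwartz_integrable test_function_schwartz test_function_mult smooth_partial u \<psi>)
  have i2: "integrable lborel (\<lambda>x. u x * partial i \<psi> x)"
    by (intro schwartz_integrable test_function_schwartz test_function_mult test_function_partial u \<psi>)
  obtain C where "\<And>x. (1 + norm x) ^ (2 * CARD('a)) * norm (partial i (\<lambda>x. u x * \<psi> x) x) \<le> C"
    using test_function_decay[OF test_function_partial[OF t]] by blast
  then have "(LINT x|lborel. partial i (\<lambda>x. u x * \<psi> x) x) = 0"
    by (rule integral_partial_eq_0[OF test_function_smooth[OF t] schwartz_integrable[OF test_function_schwartz[OF t]]])
  moreover have "partial i (\<lambda>x. u x * \<psi> x) = (\<lambda>x. partial i u x * \<psi> x + u x * partial i \<psi> x)"
    by (rule partial_mult[OF u test_function_smooth[OF \<psi>]])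
  ultimately have "(LINT x|lborel. partial i u x * \<psi> x) + (LINT x|lborel. u x * partial i \<psi> x) = 0"
    by (simp only: Bochner_Integration.integral_add[OF i1 i2])
  then show ?thesis by (simp only: add_eq_0_iff)
qed

lemma integral_by_parts_word:
  assumes "smooth u" and "test_function \<psi>"
  shows "(LINT x|lborel. u x * partials w \<psi> x) = (-1) ^ length w * (LINT x|lborel. partials (rev w) u x * \<psi> x)"
  using assms(1)
proof (induction w arbitrary: u)
  case (Cons i w)
  have "(LINT x|lborel. u x * partials (i # w) \<psi> x) = - (LINT x|lborel. partial i u x * partials w \<psi> x)"
    using integral_by_parts[OF Cons.prems test_function_partials[OF assms(2)]] by simp
  also have "\<dots> = - ((-1) ^ length w * (LINT x|lborel. partials (rev w) (partial i u) x * \<psi> x))"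
    by (simp add: Cons.IH[OF smooth_partial[OF Cons.prems]])
  finally show ?case by (simp add: partials_append)
qed simp

text \<open>If \<open>f\<close> and \<open>g\<close> differ at \<open>x0\<close>, then \<open>f - g\<close> times the conjugate of its value at \<open>x0\<close> has
  positive real part near \<open>x0\<close>. Its integral against a bump function supported there cannot
  vanish.\<close>

lemma continuous_eq_if_distr_eq:
  assumes f: "continuous_on UNIV f" and g: "continuous_on UNIV g"
    and eq: "\<And>\<psi>. test_function \<psi> \<Longrightarrow> distr_of f \<psi> = distr_of g \<psi>"
  shows "f = g"
proof (rule ccontr)
  assume "f \<noteq> g"
  then obtain x0 where x0: "f x0 \<noteq> g x0" by blast
  define e where "e x = Re (cnj (f x0 - g x0) * (f x - g x))" for x
  have e_cont: "continuous_on UNIV e" unfolding e_def by (intro continuous_intros f g)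
  have "e x0 = (cmod (f x0 - g x0))\<^sup>2" by (simp add: e_def mult.commute[of "cnj _"] complex_norm_square[symmetric] del: complex_cnj_diff)
  then have e0: "e x0 > 0" using x0 by simp
  have "open {x. e x > 0}" by (rule open_Collect_less[OF continuous_on_const e_cont])
  then obtain r where r: "r > 0" "\<And>x. dist x x0 < r \<Longrightarrow> e x > 0"
    using e0 unfolding open_dist by auto
  let ?\<psi> = "\<lambda>x. complex_of_real (bump x0 r x)"
  have t: "test_function ?\<psi>" by (rule test_function_bump[OF r(1)])
  have int: "integrable lborel (\<lambda>x. a x * ?\<psi> x)" if "continuous_on UNIV a" for a
  proof -
    let ?K = "closure {x. ?\<psi> x \<noteq> 0}"
    have K: "compact ?K" using t by (simp add: test_function_def)
    have c: "continuous_on ?K (\<lambda>x. a x * ?\<psi> x)"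
      by (rule continuous_on_mult[OF continuous_on_subset[OF that] smooth_continuous_on[OF test_function_smooth[OF t]]]) simp
    have "integrable lborel (\<lambda>x. indicator ?K x *\<^sub>R (a x * ?\<psi> x))"
      by (rule borel_integrable_compact[OF K c])
    moreover have "indicator ?K x *\<^sub>R (a x * ?\<psi> x) = a x * ?\<psi> x" for x
    proof (cases "x \<in> ?K")
      case False
      then have "?\<psi> x = 0" using closure_subset[of "{x. ?\<psi> x \<noteq> 0}"] by blast
      then show ?thesis by (simp only: mult_zero_right scaleR_zero_right)
    qed simp
    ultimately show ?thesis by (simp only:)
  qed
  have "(LINT x|lborel. f x * ?\<psi> x - g x * ?\<psi> x) = 0"
    using eq[OF t] by (simp add: Bochner_Integration.integral_diff int f g distr_of_def)
  then have "(LINT x|lborel. cnj (f x0 - g x0) * (f x * ?\<psi> x - g x * ?\<psi> x)) = 0"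
    by simp
  moreover have "integrable lborel (\<lambda>x. cnj (f x0 - g x0) * (f x * ?\<psi> x - g x * ?\<psi> x))"
    by (intro integrable_mult_right Bochner_Integration.integrable_diff int f g)
  ultimately have "(LINT x|lborel. Re (cnj (f x0 - g x0) * (f x * ?\<psi> x - g x * ?\<psi> x))) = 0"
    and i: "integrable lborel (\<lambda>x. Re (cnj (f x0 - g x0) * (f x * ?\<psi> x - g x * ?\<psi> x)))"
    by (simp_all only: integral_Re integrable_Re zero_complex.sel)
  moreover have Re_eq: "Re (cnj (f x0 - g x0) * (f x * ?\<psi> x - g x * ?\<psi> x)) = e x * bump x0 r x" for x
    by (simp add: e_def algebra_simps)
  ultimately have z: "(LINT x|lborel. e x * bump x0 r x) = 0" and i: "integrable lborel (\<lambda>x. e x * bump x0 r x)"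
    by (simp_all only:)
  have "e x * bump x0 r x \<ge> 0" for x
  proof (cases "dist x x0 < r")
    case True
    then show ?thesis using r(2) bump_nonneg[of x0 r x] by (simp add: less_imp_le)
  next
    case False
    then have "bump x0 r x = 0" using bump_pos_iff[OF r(1), of x0 x] bump_nonneg[of x0 r x] by linarith
    then show ?thesis by simp
  qed
  then have "AE x in lborel. e x * bump x0 r x = 0"
    using integral_nonneg_eq_0_iff_AE[OF i] z by simp
  then have ae: "AE x in lebesgue. e x * bump x0 r x = 0" by (rule AE_completion)
  have "closed {x. e x * bump x0 r x = 0}"
    by (intro closed_Collect_eq continuous_intros e_cont smooth_continuous_on smooth_bump)
  then have "x0 \<in> {x. e x * bump x0 r x = 0}"
    by (rule mem_closed_if_AE_lebesgue) (use ae in simp)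
  then show False using e0 bump_pos_iff[OF r(1), of x0 x0] r by simp
qed

section \<open>Differential operators as Fourier multipliers\<close>

definition word_poly :: "('d::finite list \<Rightarrow> complex) \<Rightarrow> 'd list set \<Rightarrow> real^'d \<Rightarrow> complex" where
  "word_poly c W q = (\<Sum>w\<in>W. c w * (\<Prod>a\<leftarrow>w. of_real (q $ a)))"

definition multiplier_distr :: "real \<Rightarrow> (real^'d::finite \<Rightarrow> complex) \<Rightarrow> (real^'d \<Rightarrow> complex) \<Rightarrow> 'd distr" where
  "multiplier_distr h p u = inv_fourier_distr h (mult_distr p (fourier_distr h (distr_of u)))"

text \<open>The inverse transform turns multiplication by a polynomial into a differential operator with
  constant coefficients, by \<open>word_mult_inv_fourier\<close>; what remains is a Fourier transform of an
  inverse Fourier transform.\<close>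

lemma multiplier_distr_eq:
  assumes "schwartz \<psi>" "h > 0" "finite W"
  shows "multiplier_distr h (word_poly c W) u \<psi> =
    distr_of u (\<lambda>y. \<Sum>w\<in>W. c w * (\<i> * of_real h) ^ length w * partials w \<psi> y)"
proof -
  let ?\<eta> = "\<lambda>y. \<Sum>w\<in>W. c w * ((\<i> * of_real h) ^ length w * partials w \<psi> y)"
  have s: "schwartz (\<lambda>y. c w * ((\<i> * of_real h) ^ length w * partials w \<psi> y))" for w
    by (intro schwartz_cmult schwartz_partials assms)
  have "(\<lambda>q. word_poly c W q * inv_fourier h \<psi> q) = inv_fourier h ?\<eta>"
  proof
    fix q
    have "word_poly c W q * inv_fourier h \<psi> q = (\<Sum>w\<in>W. c w * ((\<Prod>a\<leftarrow>w. of_real (q $ a)) * inv_fourier h \<psi> q))"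
      by (simp add: word_poly_def sum_distrib_right mult.assoc)
    also have "\<dots> = (\<Sum>w\<in>W. inv_fourier h (\<lambda>y. c w * ((\<i> * of_real h) ^ length w * partials w \<psi> y)) q)"
      by (simp only: word_mult_inv_fourier[OF assms(1,2)] inv_fourier_cmult)
    also have "\<dots> = inv_fourier h ?\<eta> q"
      by (rule inv_fourier_sum[symmetric]) (use assms s schwartz_integrable in blast)+
    finally show "word_poly c W q * inv_fourier h \<psi> q = inv_fourier h ?\<eta> q" .
  qed
  moreover have "fourier h (inv_fourier h ?\<eta>) = ?\<eta>"
    by (intro fourier_inv_fourier schwartz_sum s assms)
  ultimately show ?thesis
    by (simp add: multiplier_distr_def inv_fourier_distr_def mult_distr_def fourier_distr_def mult.assoc)
qed

lemma integrable_bounded_mult: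
  fixes u \<psi> :: "real^'d::finite \<Rightarrow> complex"
  assumes "smooth u" "\<And>x. norm (u x) \<le> 1" "integrable lborel \<psi>"
  shows "integrable lborel (\<lambda>x. u x * \<psi> x)"
proof (rule Bochner_Integration.integrable_bound[OF assms(3)])
  have [measurable]: "u \<in> borel_measurable borel" "\<psi> \<in> borel_measurable borel"
    using assms smooth_measurable by auto
  show "(\<lambda>x. u x * \<psi> x) \<in> borel_measurable lborel" by measurable
  show "AE x in lborel. norm (u x * \<psi> x) \<le> norm (\<psi> x)"
    using assms(2) by (intro AE_I2) (simp add: norm_mult mult_left_le_one_le)
qed

lemma schwartz_norm_bound:
  fixes \<psi> :: "real^'d::finite \<Rightarrow> complex"
  assumes "schwartz \<psi>" "length w \<le> k"
  shows "(1 + norm x) ^ k * norm (partials w \<psi> x) \<le> schwartz_norm k \<psi>"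
proof -
  have fin: "finite {w :: 'd list. length w \<le> k}"
    using finite_lists_length_le[of "UNIV :: 'd set" k] by simp
  have bdd: "bdd_above (range (\<lambda>x. (1 + norm x) ^ k * norm (partials v \<psi> x)))" for v
    using assms(1) unfolding schwartz_iff bdd_above_def by blast
  have ge: "(1 + norm x) ^ k * norm (partials v \<psi> x) \<le> (SUP x. (1 + norm x) ^ k * norm (partials v \<psi> x))" for v x
    by (rule cSUP_upper[OF UNIV_I bdd])
  have nonneg: "0 \<le> (SUP x. (1 + norm x) ^ k * norm (partials v \<psi> x))" for v
    using ge[of 0 v] by (rule order_trans[rotated]) simp
  have "(1 + norm x) ^ k * norm (partials w \<psi> x) \<le> (SUP x. (1 + norm x) ^ k * norm (partials w \<psi> x))" by (rule ge)
  also have "\<dots> \<le> schwartz_norm k \<psi>"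
    unfolding schwartz_norm_def using fin assms(2) by (intro member_le_sum nonneg) auto
  finally show ?thesis .
qed

lemma integral_norm_partials_le:
  fixes \<psi> :: "real^'d::finite \<Rightarrow> complex"
  assumes "schwartz \<psi>" "length w + 2 * CARD('d) \<le> k"
  shows "(LINT x|lborel. norm (partials w \<psi> x)) \<le> (LINT x|lborel. cauchy_weight (x :: real^'d)) * schwartz_norm k \<psi>"
proof -
  have "(LINT x|lborel. norm (partials w \<psi> x)) \<le> (LINT x|lborel. cauchy_weight (x :: real^'d) * schwartz_norm k \<psi>)"
  proof (rule integral_mono)
    show "integrable lborel (\<lambda>x. norm (partials w \<psi> x))"
      by (intro integrable_norm schwartz_integrable schwartz_partials assms)
    show "integrable lborel (\<lambda>x::real^'d. cauchy_weight x * schwartz_norm k \<psi>)"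
      by (intro integrable_mult_left integrable_cauchy_weight)
    fix x :: "real^'d"
    have "(1 + norm x) ^ (2 * CARD('d)) * norm (partials w \<psi> x) \<le> (1 + norm x) ^ k * norm (partials w \<psi> x)"
      using assms(2) by (intro mult_right_mono power_increasing) auto
    also have "\<dots> \<le> schwartz_norm k \<psi>" using assms by (intro schwartz_norm_bound) auto
    finally have *: "(1 + norm x) ^ (2 * CARD('d)) * norm (partials w \<psi> x) \<le> schwartz_norm k \<psi>" .
    have "0 \<le> (1 + norm x) ^ (2 * CARD('d)) * norm (partials w \<psi> x)" by simp
    then have n: "0 \<le> schwartz_norm k \<psi>" using * by linarith
    have "norm (partials w \<psi> x) \<le> inverse ((1 + norm x) ^ (2 * CARD('d))) * schwartz_norm k \<psi>"
      using * by (simp add: field_simps add_pos_nonneg)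
    also have "\<dots> \<le> cauchy_weight x * schwartz_norm k \<psi>"
      by (intro mult_right_mono cauchy_weight_ge n)
    finally show "norm (partials w \<psi> x) \<le> cauchy_weight x * schwartz_norm k \<psi>" .
  qed
  then show ?thesis by simp
qed

text \<open>The operator moves to \<open>\<psi>\<close>, and the derivatives of \<open>\<psi>\<close> are integrable with a bound in terms
  of a Schwartz norm, while \<open>u\<close> is bounded by 1.\<close>

lemma tempered_multiplier_distr:
  fixes u :: "real^'d::finite \<Rightarrow> complex"
  assumes h: "h > 0" and W: "finite W" and u: "smooth u" "\<And>x. norm (u x) \<le> 1"
  shows "tempered (multiplier_distr h (word_poly c W) u)"
proof -
  let ?P = "\<lambda>\<psi> y. \<Sum>w\<in>W. c w * (\<i> * of_real h) ^ length w * partials w \<psi> y"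
  have P: "schwartz (?P \<psi>)" if "schwartz \<psi>" for \<psi>
    by (intro schwartz_sum schwartz_cmult schwartz_partials that)
  have i: "integrable lborel (\<lambda>x. u x * ?P \<psi> x)" if "schwartz \<psi>" for \<psi>
    by (intro integrable_bounded_mult u schwartz_integrable P that)
  show ?thesis
    unfolding tempered_def
  proof (intro conjI allI impI)
    fix \<psi> \<eta> :: "real^'d \<Rightarrow> complex" assume s: "schwartz \<psi>" "schwartz \<eta>"
    have "?P (\<lambda>x. \<psi> x + \<eta> x) = (\<lambda>y. ?P \<psi> y + ?P \<eta> y)"
      by (simp add: partials_add schwartz_smooth s distrib_left sum.distrib)
    then have "multiplier_distr h (word_poly c W) u (\<lambda>x. \<psi> x + \<eta> x) = (LINT x|lborel. u x * ?P \<psi> x + u x * ?P \<eta> x)"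
      by (simp add: multiplier_distr_eq[OF schwartz_add[OF s] h W] distr_of_def distrib_left)
    also have "\<dots> = (LINT x|lborel. u x * ?P \<psi> x) + (LINT x|lborel. u x * ?P \<eta> x)"
      by (rule Bochner_Integration.integral_add[OF i[OF s(1)] i[OF s(2)]])
    finally show "multiplier_distr h (word_poly c W) u (\<lambda>x. \<psi> x + \<eta> x) = multiplier_distr h (word_poly c W) u \<psi> + multiplier_distr h (word_poly c W) u \<eta>"
      by (simp add: multiplier_distr_eq s h W distr_of_def)
  next
    fix a and \<psi> :: "real^'d \<Rightarrow> complex" assume s: "schwartz \<psi>"
    have eqP: "?P (\<lambda>x. a * \<psi> x) = (\<lambda>y. a * ?P \<psi> y)"
      by (simp add: partials_cmult schwartz_smooth s sum_distrib_left mult_ac)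
    have "multiplier_distr h (word_poly c W) u (\<lambda>x. a * \<psi> x) = (LINT x|lborel. a * (u x * ?P \<psi> x))"
      by (simp only: multiplier_distr_eq[OF schwartz_cmult[OF s] h W] eqP distr_of_def mult.left_commute[of _ a])
    also have "\<dots> = a * (LINT x|lborel. u x * ?P \<psi> x)" by (rule integral_mult_right_zero)
    finally show "multiplier_distr h (word_poly c W) u (\<lambda>x. a * \<psi> x) = a * multiplier_distr h (word_poly c W) u \<psi>"
      by (simp add: multiplier_distr_eq s h W distr_of_def)
  next
    \<comment> \<open>\<open>2 * CARD('d)\<close> additional powers of the norm make the derivatives integrable\<close>
    define k where "k = Max (length ` W) + 2 * CARD('d)"
    have k: "length w + 2 * CARD('d) \<le> k" if "w \<in> W" for w
      using that W by (simp add: k_def)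
    define M where "M = (LINT x|lborel. cauchy_weight (x :: real^'d))"
    define C where "C = (\<Sum>w\<in>W. norm (c w * (\<i> * of_real h) ^ length w) * M)"
    show "\<exists>C k. \<forall>\<psi>. schwartz \<psi> \<longrightarrow> norm (multiplier_distr h (word_poly c W) u \<psi>) \<le> C * schwartz_norm k \<psi>"
    proof (intro exI[of _ C] exI[of _ k] allI impI)
      fix \<psi> :: "real^'d \<Rightarrow> complex" assume s: "schwartz \<psi>"
      have ip: "integrable lborel (\<lambda>x. norm (c w * (\<i> * of_real h) ^ length w * partials w \<psi> x))" for w
        by (intro integrable_norm schwartz_integrable schwartz_cmult schwartz_partials s)
      have "norm (multiplier_distr h (word_poly c W) u \<psi>) = norm (LINT x|lborel. u x * ?P \<psi> x)"
        by (simp add: multiplier_distr_eq s h W distr_of_def)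
      also have "\<dots> \<le> (LINT x|lborel. norm (u x * ?P \<psi> x))" by (rule integral_norm_bound)
      also have "\<dots> \<le> (LINT x|lborel. (\<Sum>w\<in>W. norm (c w * (\<i> * of_real h) ^ length w * partials w \<psi> x)))"
      proof (rule integral_mono)
        show "integrable lborel (\<lambda>x. norm (u x * ?P \<psi> x))" by (rule integrable_norm[OF i[OF s]])
        show "integrable lborel (\<lambda>x. \<Sum>w\<in>W. norm (c w * (\<i> * of_real h) ^ length w * partials w \<psi> x))"
          by (intro Bochner_Integration.integrable_sum ip)
        fix x
        have "norm (u x * ?P \<psi> x) \<le> norm (?P \<psi> x)"
          using u(2)[of x] by (simp add: norm_mult mult_left_le_one_le)
        also have "\<dots> \<le> (\<Sum>w\<in>W. norm (c w * (\<i> * of_real h) ^ length w * partials w \<psi> x))" by (rule norm_sum)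
        finally show "norm (u x * ?P \<psi> x) \<le> (\<Sum>w\<in>W. norm (c w * (\<i> * of_real h) ^ length w * partials w \<psi> x))" .
      qed
      also have "\<dots> = (\<Sum>w\<in>W. LINT x|lborel. norm (c w * (\<i> * of_real h) ^ length w * partials w \<psi> x))"
        by (rule Bochner_Integration.integral_sum[OF ip])
      also have "\<dots> = (\<Sum>w\<in>W. norm (c w * (\<i> * of_real h) ^ length w) * (LINT x|lborel. norm (partials w \<psi> x)))"
        by (simp only: norm_mult[of _ "partials _ _ _"] integral_mult_right_zero)
      also have "\<dots> \<le> (\<Sum>w\<in>W. norm (c w * (\<i> * of_real h) ^ length w) * (M * schwartz_norm k \<psi>))"
        unfolding M_def by (intro sum_mono mult_left_mono integral_norm_partials_le s k norm_ge_zero)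
      also have "\<dots> = C * schwartz_norm k \<psi>" by (simp add: C_def sum_distrib_right mult.assoc)
      finally show "norm (multiplier_distr h (word_poly c W) u \<psi>) \<le> C * schwartz_norm k \<psi>" .
    qed
  qed
qed

text \<open>Against test functions, partial integration moves the operator from \<open>\<psi>\<close> to \<open>u\<close>; the sign \<open>(-
  1) ^ length w\<close> turns the powers of \<open>\<i> * h\<close> into powers of \<open>- \<i> * h\<close>. Only test functions are
  admitted here, because the derivatives of \<open>u\<close> may grow arbitrarily fast.\<close>

theorem distr_eval_multiplier_distr:
  fixes u :: "real^'d::finite \<Rightarrow> complex"
  assumes h: "h > 0" and W: "finite W" and u: "smooth u" "\<And>x. norm (u x) \<le> 1"
  shows "distr_eval (multiplier_distr h (word_poly c W) u) x =
    (\<Sum>w\<in>W. c w * (- \<i> * of_real h) ^ length w * partials (rev w) u x)"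
proof -
  define f where "f x = (\<Sum>w\<in>W. c w * (- \<i> * of_real h) ^ length w * partials (rev w) u x)" for x
  have f_smooth: "smooth f" unfolding f_def[abs_def] by (intro smooth_sum smooth_cmult smooth_partials u)
  have "multiplier_distr h (word_poly c W) u \<psi> = distr_of f \<psi>" if t: "test_function \<psi>" for \<psi>
  proof -
    have s: "schwartz \<psi>" by (rule test_function_schwartz[OF t])
    have i: "integrable lborel (\<lambda>x. a * (u x * partials w \<psi> x))" for w and a :: complex
      by (intro integrable_mult_right integrable_bounded_mult u schwartz_integrable schwartz_partials s)
    have i': "integrable lborel (\<lambda>x. a * (partials w u x * \<psi> x))" for w and a :: complex
      by (intro integrable_mult_right schwartz_integrable test_function_schwartz test_function_mult smooth_partials u t)
    have "multiplier_distr h (word_poly c W) u \<psi> = (LINT x|lborel. (\<Sum>w\<in>W. (c w * (\<i> * of_real h) ^ length w) * (u x * partials w \<psi> x)))"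
      by (simp add: multiplier_distr_eq[OF s h W] distr_of_def sum_distrib_left mult_ac)
    also have "\<dots> = (\<Sum>w\<in>W. (c w * (\<i> * of_real h) ^ length w) * (LINT x|lborel. u x * partials w \<psi> x))"
      by (simp only: Bochner_Integration.integral_sum[OF i] integral_mult_right_zero)
    also have "\<dots> = (\<Sum>w\<in>W. (c w * (- \<i> * of_real h) ^ length w) * (LINT x|lborel. partials (rev w) u x * \<psi> x))"
    proof (rule sum.cong[OF refl])
      fix w :: "'d list"
      have "(- \<i> * of_real h) ^ length w = (\<i> * of_real h) ^ length w * (-1 :: complex) ^ length w"
        by (simp add: power_mult_distrib[symmetric])
      then show "(c w * (\<i> * of_real h) ^ length w) * (LINT x|lborel. u x * partials w \<psi> x) =
        (c w * (- \<i> * of_real h) ^ length w) * (LINT x|lborel. partials (rev w) u x * \<psi> x)"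
        by (simp only: integral_by_parts_word[OF u(1) t] mult.assoc)
    qed
    also have "\<dots> = (LINT x|lborel. (\<Sum>w\<in>W. (c w * (- \<i> * of_real h) ^ length w) * (partials (rev w) u x * \<psi> x)))"
      by (simp only: Bochner_Integration.integral_sum[OF i'] integral_mult_right_zero)
    also have "\<dots> = distr_of f \<psi>"
      by (simp only: distr_of_def f_def sum_distrib_right mult.assoc)
    finally show ?thesis .
  qed
  then have "is_function (multiplier_distr h (word_poly c W) u) f"
    unfolding is_function_def using tempered_multiplier_distr[OF h W u] smooth_continuous_on[OF f_smooth] by blast
  moreover have "g = f" if "is_function (multiplier_distr h (word_poly c W) u) g" for g
    using continuous_eq_if_distr_eq that calculation unfolding is_function_def by metis
  ultimately have "(THE f. is_function (multiplier_distr h (word_poly c W) u) f) = f" by blast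
  then show ?thesis by (simp add: distr_eval_def f_def)
qed

section \<open>The exponential formula\<close>

lemma fps_linear_ode_unique:
  fixes F E H :: "'a::field_char_0 fps"
  assumes "fps_deriv F = H * F" "fps_deriv E = H * E" "F $ 0 = E $ 0"
  shows "F = E"
proof (rule fps_ext)
  fix n show "F $ n = E $ n"
  proof (induction n rule: less_induct)
    case (less n)
    show ?case
    proof (cases n)
      case (Suc m)
      have "of_nat (Suc m) * F $ Suc m = (H * F) $ m" using arg_cong[OF assms(1), of "\<lambda>X. X $ m"] by simp
      also have "\<dots> = (H * E) $ m" using less Suc by (auto simp: fps_mult_nth intro!: sum.cong)
      also have "\<dots> = of_nat (Suc m) * E $ Suc m" using arg_cong[OF assms(2), of "\<lambda>X. X $ m"] by simp
      finally show ?thesis unfolding Suc by (metis mult_cancel_left of_nat_eq_0_iff nat.distinct(1))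
    qed (use assms in simp)
  qed
qed

text \<open>The recursion says that the generating functions satisfy \<open>F' = G' * F\<close>. The exponential of
  \<open>G\<close> satisfies the same linear differential equation with the same constant coefficient.\<close>

lemma exponential_formula_recursion:
  fixes f g :: "nat \<Rightarrow> 'a::field_char_0"
  assumes f0: "f 0 = 1" and rec: "\<And>n. f (Suc n) = (\<Sum>k\<le>n. of_nat (n choose k) * g (Suc k) * f (n - k))"
  shows "Abs_fps (\<lambda>n. f n / fact n) = fps_exp 1 oo Abs_fps (\<lambda>n. if n = 0 then 0 else g n / fact n)"
proof -
  define G where "G = Abs_fps (\<lambda>n. if n = 0 then 0 else g n / fact n)"
  define F where "F = Abs_fps (\<lambda>n. f n / fact n)"
  have fact_Suc_div: "of_nat (Suc n) * (x / fact (Suc n)) = x / fact n" for n and x :: 'a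
  proof -
    have "(of_nat (Suc n) :: 'a) \<noteq> 0" by (metis of_nat_eq_0_iff nat.distinct(1))
    then show ?thesis unfolding fact_Suc by (simp del: of_nat_Suc)
  qed
  have "fps_deriv F = fps_deriv G * F"
  proof (rule fps_ext)
    fix n
    have "fps_deriv F $ n = f (Suc n) / fact n"
      using fact_Suc_div[of n "f (Suc n)"] by (simp add: F_def)
    also have "\<dots> = (\<Sum>k\<le>n. g (Suc k) / fact k * (f (n - k) / fact (n - k)))"
      unfolding rec sum_divide_distrib
    proof (rule sum.cong[OF refl])
      fix k assume "k \<in> {..n}"
      then have "(of_nat (n choose k) :: 'a) = fact n / (fact k * fact (n - k))" by (simp add: binomial_fact)
      then show "of_nat (n choose k) * g (Suc k) * f (n - k) / fact n = g (Suc k) / fact k * (f (n - k) / fact (n - k))"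
        by simp
    qed
    also have "\<dots> = (fps_deriv G * F) $ n"
    proof -
      have "fps_deriv G $ k = g (Suc k) / fact k" for k using fact_Suc_div[of k "g (Suc k)"] by (simp add: G_def)
      then show ?thesis by (simp add: fps_mult_nth F_def atLeast0AtMost)
    qed
    finally show "fps_deriv F $ n = (fps_deriv G * F) $ n" .
  qed
  moreover have "fps_deriv (fps_exp 1 oo G) = fps_deriv G * (fps_exp 1 oo G)"
    by (subst fps_compose_deriv) (auto simp: G_def mult.commute)
  ultimately have "F = fps_exp 1 oo G"
    by (rule fps_linear_ode_unique) (simp add: F_def f0)
  then show ?thesis by (simp only: F_def G_def)
qed

lemma sum_Pow_card:
  fixes h :: "nat \<Rightarrow> 'a::comm_semiring_1"
  assumes "finite X"
  shows "(\<Sum>A\<in>Pow X. h (card A)) = (\<Sum>k\<le>card X. of_nat (card X choose k) * h k)"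
proof -
  have "(\<Sum>A\<in>Pow X. h (card A)) = (\<Sum>k\<le>card X. \<Sum>A\<in>{A \<in> Pow X. card A = k}. h (card A))"
    by (rule sum.group[symmetric]) (use assms in \<open>auto intro: card_mono\<close>)
  also have "\<dots> = (\<Sum>k\<le>card X. of_nat (card X choose k) * h k)"
  proof (rule sum.cong[OF refl])
    fix k
    have "card {A \<in> Pow X. card A = k} = card X choose k" using n_subsets[OF assms, of k] by (simp add: Pow_def)
    then show "(\<Sum>A\<in>{A \<in> Pow X. card A = k}. h (card A)) = of_nat (card X choose k) * h k" by simp
  qed
  finally show ?thesis .
qed

lemma sum_subsets_containing:
  assumes "finite E" "e \<in> E"
  shows "(\<Sum>A | e \<in> A \<and> A \<subseteq> E. F A) = (\<Sum>A\<in>Pow (E - {e}). F (insert e A))"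
proof -
  have "{A. e \<in> A \<and> A \<subseteq> E} = insert e ` Pow (E - {e})"
  proof safe
    fix A assume "e \<in> A" "A \<subseteq> E"
    then show "A \<in> insert e ` Pow (E - {e})" by (intro image_eqI[of _ _ "A - {e}"]) auto
  qed (use assms in auto)
  moreover have "inj_on (insert e) (Pow (E - {e}))" by (auto simp: inj_on_def)
  ultimately show ?thesis by (simp add: sum.reindex)
qed

text \<open>The set \<open>A\<close> in the recursion is the component of the element \<open>e\<close>. As both functions depend
  on cardinalities only, the sum over \<open>A\<close> becomes a binomial convolution.\<close>

theorem exponential_formula:
  fixes f g :: "nat set \<Rightarrow> 'a::field_char_0"
  assumes f_empty: "f {} = 1"
    and rec: "\<And>E e. finite E \<Longrightarrow> e \<in> E \<Longrightarrow> f E = (\<Sum>A | e \<in> A \<and> A \<subseteq> E. g A * f (E - A))"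
    and f_card: "\<And>E E'. finite E \<Longrightarrow> finite E' \<Longrightarrow> card E = card E' \<Longrightarrow> f E = f E'"
    and g_card: "\<And>E E'. finite E \<Longrightarrow> finite E' \<Longrightarrow> E \<noteq> {} \<Longrightarrow> card E = card E' \<Longrightarrow> g E = g E'"
  shows "Abs_fps (\<lambda>n. f {..<n} / fact n) = fps_exp 1 oo Abs_fps (\<lambda>n. if n = 0 then 0 else g {..<n} / fact n)"
proof (rule exponential_formula_recursion)
  fix n :: nat
  have "f {..<Suc n} = (\<Sum>A\<in>Pow {..<n}. g (insert n A) * f ({..<Suc n} - insert n A))"
    by (subst rec[of _ n], simp, simp, subst sum_subsets_containing) (auto simp: lessThan_Suc)
  also have "\<dots> = (\<Sum>A\<in>Pow {..<n}. g {..<Suc (card A)} * f {..<n - card A})"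
  proof (rule sum.cong[OF refl])
    fix A assume "A \<in> Pow {..<n}"
    then have A: "finite A" "A \<subseteq> {..<n}" "n \<notin> A" using finite_subset by auto
    have "g (insert n A) = g {..<Suc (card A)}" using A by (intro g_card) auto
    moreover have "{..<Suc n} - insert n A = {..<n} - A" by auto
    then have "f ({..<Suc n} - insert n A) = f {..<n - card A}"
      using A by (intro f_card) (auto simp: card_Diff_subset)
    ultimately show "g (insert n A) * f ({..<Suc n} - insert n A) = g {..<Suc (card A)} * f {..<n - card A}" by simp
  qed
  also have "\<dots> = (\<Sum>k\<le>n. of_nat (n choose k) * (g {..<Suc k} * f {..<n - k}))"
    using sum_Pow_card[of "{..<n}" "\<lambda>k. g {..<Suc k} * f {..<n - k}"] by simp
  finally show "f {..<Suc n} = (\<Sum>k\<le>n. of_nat (n choose k) * g {..<Suc k} * f {..<n - k})"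
    by (simp add: mult.assoc)
qed (simp add: f_empty)

section \<open>Sums over set partitions\<close>

definition parts :: "'a set \<Rightarrow> 'a set set set" where
  "parts E = {P. partition_on E P}"

lemma finite_parts [simp]: "finite E \<Longrightarrow> finite (parts E)"
  by (simp add: parts_def finitely_many_partition_on)

lemma parts_empty [simp]: "parts {} = {{}}"
  by (auto simp: parts_def partition_on_empty)

lemma partsD:
  assumes "P \<in> parts E"
  shows "\<Union>P = E" "B \<in> P \<Longrightarrow> B \<noteq> {}" "B \<in> P \<Longrightarrow> B \<subseteq> E" "B \<in> P \<Longrightarrow> C \<in> P \<Longrightarrow> x \<in> B \<Longrightarrow> x \<in> C \<Longrightarrow> B = C"
    "finite E \<Longrightarrow> finite P"
  using assms unfolding parts_def partition_on_def disjoint_def by (auto intro: finite_elements simp: partition_on_def disjoint_def)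

lemma parts_insert:
  assumes "A \<subseteq> E" "A \<noteq> {}" "P \<in> parts (E - A)"
  shows "insert A P \<in> parts E" "A \<notin> P"
  using assms by (auto simp: parts_def partition_on_def disjoint_def)

text \<open>A partition consists of the block \<open>A\<close> containing \<open>e\<close> and a partition of the rest.\<close>

lemma sum_parts_rec:
  assumes "finite E" "e \<in> E"
  shows "(\<Sum>P\<in>parts E. F P) = (\<Sum>A | e \<in> A \<and> A \<subseteq> E. \<Sum>P\<in>parts (E - A). F (insert A P))"
proof -
  have "(\<Sum>A | e \<in> A \<and> A \<subseteq> E. \<Sum>P\<in>parts (E - A). F (insert A P))
     = (\<Sum>(A, P)\<in>Sigma {A. e \<in> A \<and> A \<subseteq> E} (\<lambda>A. parts (E - A)). F (insert A P))"
    using assms by (intro sum.Sigma) (auto simp: finite_subset)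
  also have "\<dots> = (\<Sum>x\<in>Sigma {A. e \<in> A \<and> A \<subseteq> E} (\<lambda>A. parts (E - A)). F (insert (fst x) (snd x)))"
    by (simp add: case_prod_unfold)
  also have "\<dots> = (\<Sum>P\<in>parts E. F P)"
  proof (rule sum.reindex_bij_betw[where h="\<lambda>x. insert (fst x) (snd x)"])
    show "bij_betw (\<lambda>p. insert (fst p) (snd p)) (Sigma {A. e \<in> A \<and> A \<subseteq> E} (\<lambda>A. parts (E - A))) (parts E)"
    proof (rule bij_betwI')
      fix x y assume x: "x \<in> Sigma {A. e \<in> A \<and> A \<subseteq> E} (\<lambda>A. parts (E - A))"
        and y: "y \<in> Sigma {A. e \<in> A \<and> A \<subseteq> E} (\<lambda>A. parts (E - A))"
      obtain A P A' P' where xy: "x = (A, P)" "y = (A', P')" by (cases x, cases y)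
      show "insert (fst x) (snd x) = insert (fst y) (snd y) \<longleftrightarrow> x = y"
      proof
        assume eq: "insert (fst x) (snd x) = insert (fst y) (snd y)"
        have A: "e \<in> A" "A \<subseteq> E" "P \<in> parts (E - A)" and A': "e \<in> A'" "A' \<subseteq> E" "P' \<in> parts (E - A')"
          using x y unfolding xy by simp_all
        have "A \<noteq> {}" "A' \<noteq> {}" using A A' by auto
        note p = parts_insert[OF A(2) this(1) A(3)] parts_insert[OF A'(2) this(2) A'(3)]
        have eq': "insert A P = insert A' P'" using eq by (simp add: xy)
        have "A' \<in> insert A P" unfolding eq' by simp
        from partsD(4)[OF p(1) _ this A(1) A'(1)] have AA: "A = A'" by simp
        have "P = P'" using p(2,4) eq' unfolding AA by (rule insert_ident[THEN iffD1])
        then show "x = y" by (simp only: xy AA)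
      next
        assume "x = y" then show "insert (fst x) (snd x) = insert (fst y) (snd y)" by (rule arg_cong)
      qed
    next
      fix x assume x: "x \<in> Sigma {A. e \<in> A \<and> A \<subseteq> E} (\<lambda>A. parts (E - A))"
      then have "e \<in> fst x" "fst x \<subseteq> E" "snd x \<in> parts (E - fst x)" by auto
      then show "insert (fst x) (snd x) \<in> parts E" using parts_insert(1)[of "fst x" E "snd x"] by blast
    next
      fix P assume P: "P \<in> parts E"
      then obtain A where A: "e \<in> A" "A \<in> P" using assms(2) partsD(1) by blast
      have "\<Union>(P - {A}) = E - A"
      proof
        show "\<Union>(P - {A}) \<subseteq> E - A" using partsD(3)[OF P] partsD(4)[OF P _ A(2)] by blast
        show "E - A \<subseteq> \<Union>(P - {A})" using partsD(1)[OF P] by blast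
      qed
      then have "P - {A} \<in> parts (E - A)"
        using P pairwise_subset[of disjnt P "P - {A}"] unfolding parts_def partition_on_def by simp
      moreover have "A \<subseteq> E" using partsD(3)[OF P A(2)] .
      ultimately have "(A, P - {A}) \<in> Sigma {A. e \<in> A \<and> A \<subseteq> E} (\<lambda>A. parts (E - A))" using A by simp
      then show "\<exists>x\<in>Sigma {A. e \<in> A \<and> A \<subseteq> E} (\<lambda>A. parts (E - A)). P = insert (fst x) (snd x)"
        using A by (intro bexI[of _ "(A, P - {A})"]) auto
    qed
  qed
  finally show ?thesis by simp
qed

lemma sum_parts_prod_rec:
  fixes g :: "'a set \<Rightarrow> 'b::comm_semiring_1"
  assumes "finite E" "e \<in> E"
  shows "(\<Sum>P\<in>parts E. \<Prod>B\<in>P. g B) = (\<Sum>A | e \<in> A \<and> A \<subseteq> E. g A * (\<Sum>P\<in>parts (E - A). \<Prod>B\<in>P. g B))"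
  unfolding sum_parts_rec[OF assms]
proof (rule sum.cong[OF refl])
  fix A assume A: "A \<in> {A. e \<in> A \<and> A \<subseteq> E}"
  have "(\<Prod>B\<in>insert A P. g B) = g A * (\<Prod>B\<in>P. g B)" if P: "P \<in> parts (E - A)" for P
    using parts_insert(2)[of A E P] A P partsD(5)[OF P] assms(1) by (subst prod.insert) auto
  then show "(\<Sum>P\<in>parts (E - A). \<Prod>B\<in>insert A P. g B) = g A * (\<Sum>P\<in>parts (E - A). \<Prod>B\<in>P. g B)"
    by (simp add: sum_distrib_left)
qed

lemma image_parts:
  assumes "P \<in> parts E" "inj_on p E"
  shows "(`) p ` P \<in> parts (p ` E)"
proof -
  have "{} \<notin> (`) p ` P" using partsD(2)[OF assms(1)] by auto
  then have "(`) p ` P - {{}} = (`) p ` P" by simp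
  then show ?thesis using partition_on_inj_image[of E P p] assms by (simp add: parts_def)
qed

lemma sum_parts_bij:
  assumes "inj_on p E"
  shows "(\<Sum>P\<in>parts (p ` E). F P) = (\<Sum>P\<in>parts E. F ((`) p ` P))"
proof -
  have inv: "(`) (inv_into E p) ` (`) p ` P = P" if "P \<in> parts E" for P
  proof -
    have "inv_into E p ` p ` B = B" if "B \<in> P" for B
      using inv_into_image_cancel[OF assms partsD(3)[OF \<open>P \<in> parts E\<close> that]] .
    then show ?thesis by (simp add: image_image)
  qed
  have inv': "(`) p ` (`) (inv_into E p) ` P = P" if "P \<in> parts (p ` E)" for P
  proof -
    have "p ` inv_into E p ` B = B" if "B \<in> P" for B
      using image_inv_into_cancel[OF refl partsD(3)[OF \<open>P \<in> parts (p ` E)\<close> that]] .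
    then show ?thesis by (simp add: image_image)
  qed
  have a: "(`) p ` P \<in> parts (p ` E)" if "P \<in> parts E" for P
    by (rule image_parts[OF that assms])
  have b: "(`) (inv_into E p) ` P \<in> parts E" if "P \<in> parts (p ` E)" for P
  proof -
    have "inj_on (inv_into E p) (p ` E)" by (simp add: inj_on_inv_into)
    moreover have "inv_into E p ` p ` E = E" using inv_into_image_cancel[OF assms order_refl] .
    ultimately show ?thesis using image_parts[OF that, of "inv_into E p"] by simp
  qed
  have "bij_betw ((`) ((`) p)) (parts E) (parts (p ` E))"
    by (rule bij_betw_byWitness[where f'="(`) ((`) (inv_into E p))"]) (use inv inv' a b in auto)
  then show ?thesis using sum.reindex_bij_betw[of "(`) ((`) p)" "parts E" "parts (p ` E)" F] by simp
qed

section \<open>Sums over functions on a disjoint union\<close>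

lemma bij_betw_restrict_Un:
  fixes A B :: "'a set"
  assumes "A \<inter> B = {}"
  shows "bij_betw (\<lambda>a. (restrict a A, restrict a B)) ((A \<union> B) \<rightarrow>\<^sub>E (UNIV :: 'd set)) ((A \<rightarrow>\<^sub>E (UNIV :: 'd set)) \<times> (B \<rightarrow>\<^sub>E (UNIV :: 'd set)))"
proof (rule bij_betw_byWitness[where f'="\<lambda>p x. if x \<in> A then fst p x else snd p x"])
  show "\<forall>a\<in>(A \<union> B) \<rightarrow>\<^sub>E (UNIV :: 'd set). (\<lambda>x. if x \<in> A then fst (restrict a A, restrict a B) x else snd (restrict a A, restrict a B) x) = a"
  proof (intro ballI ext)
    fix a x assume "a \<in> (A \<union> B) \<rightarrow>\<^sub>E (UNIV :: 'd set)"
    from PiE_arb[OF this, of x]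
    show "(if x \<in> A then fst (restrict a A, restrict a B) x else snd (restrict a A, restrict a B) x) = a x" by simp
  qed
  show "\<forall>p\<in>(A \<rightarrow>\<^sub>E (UNIV :: 'd set)) \<times> (B \<rightarrow>\<^sub>E (UNIV :: 'd set)).
    (restrict (\<lambda>x. if x \<in> A then fst p x else snd p x) A, restrict (\<lambda>x. if x \<in> A then fst p x else snd p x) B) = p"
  proof
    fix p :: "('a \<Rightarrow> 'd) \<times> ('a \<Rightarrow> 'd)" assume "p \<in> (A \<rightarrow>\<^sub>E (UNIV :: 'd set)) \<times> (B \<rightarrow>\<^sub>E (UNIV :: 'd set))"
    then have p: "fst p \<in> A \<rightarrow>\<^sub>E UNIV" "snd p \<in> B \<rightarrow>\<^sub>E UNIV" by (simp_all only: mem_Times_iff)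
    have 1: "restrict (\<lambda>x. if x \<in> A then fst p x else snd p x) A = fst p"
    proof (rule ext)
      fix x show "restrict (\<lambda>x. if x \<in> A then fst p x else snd p x) A x = fst p x"
        by (cases "x \<in> A") (simp_all add: PiE_arb[OF p(1)])
    qed
    have 2: "restrict (\<lambda>x. if x \<in> A then fst p x else snd p x) B = snd p"
    proof (rule ext)
      fix x show "restrict (\<lambda>x. if x \<in> A then fst p x else snd p x) B x = snd p x"
        using assms by (cases "x \<in> B") (auto simp: PiE_arb[OF p(2)])
    qed
    show "(restrict (\<lambda>x. if x \<in> A then fst p x else snd p x) A, restrict (\<lambda>x. if x \<in> A then fst p x else snd p x) B) = p"
      unfolding 1 2 by (rule prod.collapse)
  qed
  show "(\<lambda>a. (restrict a A, restrict a B)) ` ((A \<union> B) \<rightarrow>\<^sub>E (UNIV :: 'd set)) \<subseteq> (A \<rightarrow>\<^sub>E (UNIV :: 'd set)) \<times> (B \<rightarrow>\<^sub>E (UNIV :: 'd set))"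
    by auto
  show "(\<lambda>p x. if x \<in> A then fst p x else snd p x) ` ((A \<rightarrow>\<^sub>E (UNIV :: 'd set)) \<times> (B \<rightarrow>\<^sub>E (UNIV :: 'd set))) \<subseteq> (A \<union> B) \<rightarrow>\<^sub>E UNIV"
  proof
    fix f assume "f \<in> (\<lambda>p x. if x \<in> A then fst p x else snd p x) ` ((A \<rightarrow>\<^sub>E (UNIV :: 'd set)) \<times> (B \<rightarrow>\<^sub>E (UNIV :: 'd set)))"
    then obtain p where f: "f = (\<lambda>x. if x \<in> A then fst p x else snd p x)" and "p \<in> (A \<rightarrow>\<^sub>E (UNIV :: 'd set)) \<times> (B \<rightarrow>\<^sub>E (UNIV :: 'd set))" by (rule imageE)
    then have p: "snd p \<in> B \<rightarrow>\<^sub>E UNIV" by (simp only: mem_Times_iff)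
    show "f \<in> (A \<union> B) \<rightarrow>\<^sub>E UNIV" unfolding f by (rule PiE_I) (simp_all add: PiE_arb[OF p])
  qed
qed

lemma sum_PiE_Un:
  fixes F G :: "('a \<Rightarrow> 'd::finite) \<Rightarrow> 'b::comm_semiring_1"
  assumes "finite A" "finite B" "A \<inter> B = {}"
  shows "(\<Sum>a\<in>(A \<union> B) \<rightarrow>\<^sub>E UNIV. F (restrict a A) * G (restrict a B)) = (\<Sum>a\<in>A \<rightarrow>\<^sub>E UNIV. F a) * (\<Sum>b\<in>B \<rightarrow>\<^sub>E UNIV. G b)"
proof -
  have "(\<Sum>a\<in>A \<rightarrow>\<^sub>E UNIV. F a) * (\<Sum>b\<in>B \<rightarrow>\<^sub>E UNIV. G b) = (\<Sum>(a, b)\<in>(A \<rightarrow>\<^sub>E UNIV) \<times> (B \<rightarrow>\<^sub>E UNIV). F a * G b)"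
    by (simp add: sum_product sum.cartesian_product)
  also have "\<dots> = (\<Sum>a\<in>(A \<union> B) \<rightarrow>\<^sub>E UNIV. case (restrict a A, restrict a B) of (a, b) \<Rightarrow> F a * G b)"
    by (rule sum.reindex_bij_betw[OF bij_betw_restrict_Un[OF assms(3)], symmetric])
  finally show ?thesis by simp
qed

text \<open>Expanding the product, independent choices on the disjoint blocks amount to one choice on
  their union, since a factor depends only on the values on its own block.\<close>

lemma prod_sum_PiE_Union:
  fixes F :: "'a set \<Rightarrow> ('a \<Rightarrow> 'd::finite) \<Rightarrow> 'b::comm_semiring_1"
  assumes "finite P" "\<And>B. B \<in> P \<Longrightarrow> finite B" "disjoint P"
    and F: "\<And>B a a'. B \<in> P \<Longrightarrow> (\<And>x. x \<in> B \<Longrightarrow> a x = a' x) \<Longrightarrow> F B a = F B a'"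
  shows "(\<Prod>B\<in>P. \<Sum>a\<in>B \<rightarrow>\<^sub>E UNIV. F B a) = (\<Sum>a\<in>\<Union>P \<rightarrow>\<^sub>E UNIV. \<Prod>B\<in>P. F B a)"
  using assms
proof (induction P)
  case (insert A P)
  have dis: "A \<inter> \<Union>P = {}" using disjointD[OF insert.prems(2)] insert.hyps(2) by blast
  have IH: "(\<Prod>B\<in>P. \<Sum>a\<in>B \<rightarrow>\<^sub>E UNIV. F B a) = (\<Sum>a\<in>\<Union>P \<rightarrow>\<^sub>E UNIV. \<Prod>B\<in>P. F B a)"
  proof (rule insert.IH)
    show "disjoint P" using insert.prems(2) by (rule pairwise_subset) auto
  qed (use insert.prems in blast)+
  have "(\<Prod>B\<in>insert A P. \<Sum>a\<in>B \<rightarrow>\<^sub>E UNIV. F B a) = (\<Sum>a\<in>A \<rightarrow>\<^sub>E UNIV. F A a) * (\<Sum>a\<in>\<Union>P \<rightarrow>\<^sub>E UNIV. \<Prod>B\<in>P. F B a)"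
    using insert.hyps by (simp add: IH)
  also have "\<dots> = (\<Sum>a\<in>(A \<union> \<Union>P) \<rightarrow>\<^sub>E UNIV. F A (restrict a A) * (\<Prod>B\<in>P. F B (restrict a (\<Union>P))))"
    using insert.hyps insert.prems dis by (intro sum_PiE_Un[symmetric]) auto
  also have "\<dots> = (\<Sum>a\<in>(A \<union> \<Union>P) \<rightarrow>\<^sub>E UNIV. \<Prod>B\<in>insert A P. F B a)"
  proof (rule sum.cong[OF refl])
    fix a :: "'a \<Rightarrow> 'd"
    have "F A (restrict a A) = F A a" by (rule insert.prems(3)) auto
    moreover have "F B (restrict a (\<Union>P)) = F B a" if "B \<in> P" for B
      by (rule insert.prems(3)) (use that in auto)
    ultimately show "F A (restrict a A) * (\<Prod>B\<in>P. F B (restrict a (\<Union>P))) = (\<Prod>B\<in>insert A P. F B a)"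
      using insert.hyps by simp
  qed
  finally show ?case by simp
qed simp

lemma bij_betw_map_PiE_lists:
  assumes "distinct l" "set l = B"
  shows "bij_betw (\<lambda>b. map b l) (B \<rightarrow>\<^sub>E (UNIV :: 'd set)) {as. length as = card B}"
proof (rule bij_betw_byWitness[where f'="\<lambda>as x. if x \<in> B then as ! (THE i. i < length l \<and> l ! i = x) else undefined"])
  have the: "(THE j. j < length l \<and> l ! j = l ! i) = i" if "i < length l" for i
    using that assms(1) by (intro the_equality) (auto simp: nth_eq_iff_index_eq)
  show "\<forall>b\<in>B \<rightarrow>\<^sub>E (UNIV :: 'd set). (\<lambda>x. if x \<in> B then map b l ! (THE i. i < length l \<and> l ! i = x) else undefined) = b"
  proof (intro ballI ext)
    fix b :: "'a \<Rightarrow> 'd" and x assume b: "b \<in> B \<rightarrow>\<^sub>E UNIV"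
    show "(if x \<in> B then map b l ! (THE i. i < length l \<and> l ! i = x) else undefined) = b x"
    proof (cases "x \<in> B")
      case True
      then obtain i where "i < length l" "l ! i = x" using assms(2) by (metis in_set_conv_nth)
      then show ?thesis using True the[of i] by auto
    qed (use b in \<open>auto simp: PiE_def extensional_def\<close>)
  qed
  have len: "length l = card B" using assms distinct_card by fastforce
  show "\<forall>as\<in>{as :: 'd list. length as = card B}. map (\<lambda>x. if x \<in> B then as ! (THE i. i < length l \<and> l ! i = x) else undefined) l = as"
  proof
    fix as :: "'d list" assume "as \<in> {as. length as = card B}"
    then have la: "length as = length l" using len by simp
    show "map (\<lambda>x. if x \<in> B then as ! (THE i. i < length l \<and> l ! i = x) else undefined) l = as"
    proof (rule nth_equalityI)
      fix i assume "i < length (map (\<lambda>x. if x \<in> B then as ! (THE i. i < length l \<and> l ! i = x) else undefined) l)"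
      then have i: "i < length l" by simp
      then have "l ! i \<in> B" using assms(2) nth_mem by blast
      then show "map (\<lambda>x. if x \<in> B then as ! (THE i. i < length l \<and> l ! i = x) else undefined) l ! i = as ! i"
        using i the[OF i] by simp
    qed (simp add: la)
  qed
  show "(\<lambda>b. map b l) ` (B \<rightarrow>\<^sub>E UNIV) \<subseteq> {as. length as = card B}" using len by auto
qed (auto simp: PiE_def extensional_def)

lemma sum_words_eq_sum_PiE:
  assumes "distinct l" "set l = B"
  shows "(\<Sum>as | length as = card B. F as) = (\<Sum>b\<in>B \<rightarrow>\<^sub>E (UNIV :: 'd set). F (map b l))"
  by (rule sum.reindex_bij_betw[OF bij_betw_map_PiE_lists[OF assms], symmetric])

section \<open>Weighted sums over partitions\<close>

text \<open>The elements of \<open>E\<close> are positions carrying the indices \<open>a\<close>. The factor of a block depends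
  only on the multiset of indices on it, because coefficients and derivatives are symmetric.\<close>

definition partition_sum :: "('d multiset \<Rightarrow> 'b) \<Rightarrow> 'e set \<Rightarrow> ('e \<Rightarrow> 'd) \<Rightarrow> 'b::comm_semiring_1" where
  "partition_sum \<alpha> E a = (\<Sum>P\<in>parts E. \<Prod>B\<in>P. \<alpha> (image_mset a (mset_set B)))"

lemma partition_sum_empty [simp]: "partition_sum \<alpha> {} a = 1"
  by (simp add: partition_sum_def)

lemma partition_sum_rec:
  assumes "finite E" "e \<in> E"
  shows "partition_sum \<alpha> E a = (\<Sum>A | e \<in> A \<and> A \<subseteq> E. \<alpha> (image_mset a (mset_set A)) * partition_sum \<alpha> (E - A) a)"
  unfolding partition_sum_def by (rule sum_parts_prod_rec[OF assms])

lemma partition_sum_cong: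
  assumes "finite E" "\<And>x. x \<in> E \<Longrightarrow> a x = a' x"
  shows "partition_sum \<alpha> E a = partition_sum \<alpha> E a'"
  unfolding partition_sum_def
proof (intro sum.cong prod.cong refl)
  fix P B assume "P \<in> parts E" "B \<in> P"
  then have "B \<subseteq> E" by (rule partsD(3))
  then have "image_mset a (mset_set B) = image_mset a' (mset_set B)"
    using assms finite_subset[OF _ assms(1)] by (intro image_mset_cong) auto
  then show "\<alpha> (image_mset a (mset_set B)) = \<alpha> (image_mset a' (mset_set B))" by simp
qed

lemma inj_on_image_block:
  assumes "inj_on p E" "P \<in> parts E" shows "inj_on ((`) p) P"
  by (rule inj_onI) (metis inj_on_image_eq_iff[OF assms(1)] partsD(3)[OF assms(2)])

lemma sum_parts_prod_bij:
  fixes g :: "'a set \<Rightarrow> 'b::comm_semiring_1"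
  assumes "inj_on p E"
  shows "(\<Sum>P\<in>parts (p ` E). \<Prod>B\<in>P. g B) = (\<Sum>P\<in>parts E. \<Prod>B\<in>P. g (p ` B))"
  unfolding sum_parts_bij[OF assms]
  by (rule sum.cong[OF refl]) (simp add: prod.reindex[OF inj_on_image_block[OF assms]])

lemma partition_sum_bij:
  assumes "inj_on p E"
  shows "partition_sum \<alpha> (p ` E) a = partition_sum \<alpha> E (a \<circ> p)"
  unfolding partition_sum_def sum_parts_prod_bij[OF assms]
proof (intro sum.cong prod.cong refl)
  fix P B assume "P \<in> parts E" "B \<in> P"
  then have "inj_on p B" using partsD(3) inj_on_subset[OF assms] by blast
  then show "\<alpha> (image_mset a (mset_set (p ` B))) = \<alpha> (image_mset (a \<circ> p) (mset_set B))"
    by (simp add: image_mset_mset_set[symmetric] multiset.map_comp)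
qed

lemma partition_sum_mult:
  assumes "finite E"
  shows "partition_sum (\<lambda>M. \<alpha> M * z ^ size M) E a = z ^ card E * partition_sum \<alpha> E a"
  unfolding partition_sum_def sum_distrib_left
proof (rule sum.cong[OF refl])
  fix P assume P: "P \<in> parts E"
  have "(\<Sum>B\<in>P. card B) = card E"
    using partsD(1)[OF P] finite_subset[OF partsD(3)[OF P] assms] P
    by (subst card_Union_disjoint[symmetric]) (auto simp: parts_def partition_on_def)
  then have "(\<Prod>B\<in>P. z ^ card B) = z ^ card E" by (simp add: power_sum[symmetric])
  then show "(\<Prod>B\<in>P. \<alpha> (image_mset a (mset_set B)) * z ^ size (image_mset a (mset_set B))) = z ^ card E * (\<Prod>B\<in>P. \<alpha> (image_mset a (mset_set B)))"
    by (simp add: prod.distrib mult.commute)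
qed

section \<open>Derivatives indexed by multisets\<close>

text \<open>The derivative in the directions listed by \<open>M\<close>. For smooth functions the order chosen by
  \<open>SOME\<close> is immaterial.\<close>

definition pd :: "'d::finite multiset \<Rightarrow> (real^'d \<Rightarrow> 'b::real_normed_vector) \<Rightarrow> real^'d \<Rightarrow> 'b" where
  "pd M f = partials (SOME l. mset l = M) f"

lemma partials_eq_pd:
  fixes f :: "real^'d::finite \<Rightarrow> 'b::real_inner"
  assumes "smooth f" shows "partials l f = pd (mset l) f"
  unfolding pd_def by (rule partials_perm[OF assms]) (metis (mono_tags) someI)

lemma smooth_pd: "smooth f \<Longrightarrow> smooth (pd M f)"
  unfolding pd_def by (rule smooth_partials)

lemma pd_empty [simp]: "pd {#} f = f"
  by (simp add: pd_def)

lemma pd_add_mset: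
  fixes f :: "real^'d::finite \<Rightarrow> 'b::real_inner"
  assumes "smooth f"
  shows "pd (add_mset i M) f = partial i (pd M f)" and "pd (add_mset i M) f = pd M (partial i f)"
proof -
  obtain l where l: "mset l = M" using ex_mset by blast
  have "pd (add_mset i M) f = partials (i # l) f" using partials_eq_pd[OF assms, of "i # l"] l by simp
  then show "pd (add_mset i M) f = partial i (pd M f)" using partials_eq_pd[OF assms, of l] l by simp
  have "pd (add_mset i M) f = partials (l @ [i]) f" using partials_eq_pd[OF assms, of "l @ [i]"] l by simp
  also have "\<dots> = partials l (partial i f)" by (simp add: partials_append)
  finally show "pd (add_mset i M) f = pd M (partial i f)"
    using partials_eq_pd[OF smooth_partial[OF assms], of l i] l by simp
qed

lemma pd_cmult_of_real:
  fixes f :: "real^'d::finite \<Rightarrow> real" and c :: complex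
  assumes "smooth f"
  shows "pd M (\<lambda>x. c * of_real (f x)) = (\<lambda>x. c * of_real (pd M f x))"
  unfolding pd_def by (simp add: partials_cmult smooth_of_real assms partials_of_real)

text \<open>The positions in \<open>A\<close> are those whose derivative falls on \<open>f\<close>.\<close>

lemma Leibniz:
  fixes f g :: "real^'d::finite \<Rightarrow> complex"
  assumes f: "smooth f" and g: "smooth g" and "finite E"
  shows "pd (image_mset a (mset_set E)) (\<lambda>x. f x * g x) =
    (\<lambda>x. \<Sum>A\<in>Pow E. pd (image_mset a (mset_set A)) f x * pd (image_mset a (mset_set (E - A))) g x)"
  using assms(3)
proof (induction E)
  case (insert e E)
  let ?D = "\<lambda>A. pd (image_mset a (mset_set A))"
  have fin: "finite A" if "A \<in> Pow E" for A using that insert.hyps finite_subset by blast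
  have "?D (insert e E) (\<lambda>x. f x * g x) = partial (a e) (\<lambda>x. \<Sum>A\<in>Pow E. ?D A f x * ?D (E - A) g x)"
    using insert.hyps by (simp add: pd_add_mset(1) smooth_mult f g insert.IH)
  also have "\<dots> = (\<lambda>x. \<Sum>A\<in>Pow E. partial (a e) (\<lambda>x. ?D A f x * ?D (E - A) g x) x)"
    by (intro partial_sum smooth_mult smooth_pd f g)
  also have "\<dots> = (\<lambda>x. \<Sum>A\<in>Pow E. ?D (insert e A) f x * ?D (E - A) g x + ?D A f x * ?D (insert e E - A) g x)"
  proof (rule ext, rule sum.cong[OF refl])
    fix x A assume A: "A \<in> Pow E"
    then have e: "e \<notin> A" "finite A" using insert.hyps fin by auto
    have 1: "partial (a e) (?D A f) = ?D (insert e A) f"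
      using e by (simp add: pd_add_mset(1) f)
    have "insert e E - A = insert e (E - A)" using e by auto
    then have 2: "partial (a e) (?D (E - A) g) = ?D (insert e E - A) g"
      using insert.hyps by (simp add: pd_add_mset(1) g)
    show "partial (a e) (\<lambda>x. ?D A f x * ?D (E - A) g x) x = ?D (insert e A) f x * ?D (E - A) g x + ?D A f x * ?D (insert e E - A) g x"
      by (subst partial_mult) (simp_all add: smooth_pd f g 1 2)
  qed
  also have "\<dots> = (\<lambda>x. \<Sum>A\<in>Pow (insert e E). ?D A f x * ?D (insert e E - A) g x)"
  proof
    fix x
    have "(\<Sum>A\<in>Pow (insert e E). ?D A f x * ?D (insert e E - A) g x) =
      (\<Sum>A\<in>Pow E. ?D A f x * ?D (insert e E - A) g x) + (\<Sum>A\<in>insert e ` Pow E. ?D A f x * ?D (insert e E - A) g x)"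
      unfolding Pow_insert using insert.hyps by (intro sum.union_disjoint) auto
    also have "(\<Sum>A\<in>insert e ` Pow E. ?D A f x * ?D (insert e E - A) g x) = (\<Sum>A\<in>Pow E. ?D (insert e A) f x * ?D (insert e E - insert e A) g x)"
      using insert.hyps by (subst sum.reindex) (auto simp: inj_on_def)
    also have "\<dots> = (\<Sum>A\<in>Pow E. ?D (insert e A) f x * ?D (E - A) g x)"
      using insert.hyps by (intro sum.cong refl) (auto intro!: arg_cong2[where f="(*)"] arg_cong[where f="\<lambda>X. ?D X g x"])
    finally show "(\<Sum>A\<in>Pow E. ?D (insert e A) f x * ?D (E - A) g x + ?D A f x * ?D (insert e E - A) g x) = (\<Sum>A\<in>Pow (insert e E). ?D A f x * ?D (insert e E - A) g x)"
      by (simp add: sum.distrib add.commute)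
  qed
  finally show ?case .
qed simp

text \<open>One derivative, at the position \<open>e\<close>, turns \<open>u\<close> into \<open>c * \<partial>G * u\<close>. By the Leibniz rule, the
  derivatives that then fall on \<open>\<partial>G\<close> form a block together with \<open>e\<close>, and the others fall on
  \<open>u\<close>; this is the recursion of the partition sum.\<close>

lemma faa_di_bruno_exp:
  fixes G :: "real^'d::finite \<Rightarrow> real" and c :: complex
  assumes G: "smooth G" and "finite E"
  defines "u \<equiv> \<lambda>x. exp (c * of_real (G x))"
  shows "pd (image_mset a (mset_set E)) u x = u x * partition_sum (\<lambda>M. c * of_real (pd M G x)) E a"
  using assms(2)
proof (induction E rule: finite_psubset_induct)
  case (psubset E)
  have u: "smooth u" unfolding u_def by (rule smooth_exp[OF G])
  show ?case
  proof (cases "E = {}")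
    case False
    then obtain e where e: "e \<in> E" by blast
    define E' where "E' = E - {e}"
    have E: "E = insert e E'" "e \<notin> E'" "finite E'" using e psubset.hyps by (auto simp: E'_def)
    let ?D = "\<lambda>A. pd (image_mset a (mset_set A))"
    let ?g = "\<lambda>x. c * of_real (partial (a e) G x)"
    have g: "smooth ?g" by (intro smooth_cmult smooth_of_real smooth_partial G)
    have "?D E u x = ?D E' (partial (a e) u) x"
      unfolding E(1) using E(2,3) by (simp add: pd_add_mset(2) u)
    also have "partial (a e) u = (\<lambda>x. ?g x * u x)"
      unfolding u_def by (rule partial_exp[OF G])
    also have "?D E' (\<lambda>x. ?g x * u x) x = (\<Sum>A\<in>Pow E'. ?D A ?g x * ?D (E' - A) u x)"
      by (simp add: Leibniz[OF g u E(3)])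
    also have "\<dots> = (\<Sum>A\<in>Pow E'. c * of_real (?D (insert e A) G x) * (u x * partition_sum (\<lambda>M. c * of_real (pd M G x)) (E - insert e A) a))"
    proof (rule sum.cong[OF refl])
      fix A assume A: "A \<in> Pow E'"
      then have fA: "finite A" "e \<notin> A" using E finite_subset by auto
      have eq: "E' - A = E - insert e A" using E by auto
      have "?D (E' - A) u x = u x * partition_sum (\<lambda>M. c * of_real (pd M G x)) (E' - A) a"
        by (rule psubset.IH) (use E in auto)
      moreover have "?D A ?g x = c * of_real (?D (insert e A) G x)"
        using fA by (simp add: pd_cmult_of_real smooth_partial G pd_add_mset(2))
      ultimately show "?D A ?g x * ?D (E' - A) u x = c * of_real (?D (insert e A) G x) * (u x * partition_sum (\<lambda>M. c * of_real (pd M G x)) (E - insert e A) a)"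
        by (simp only: eq)
    qed
    also have "\<dots> = u x * partition_sum (\<lambda>M. c * of_real (pd M G x)) E a"
      unfolding partition_sum_rec[OF psubset.hyps e] sum_subsets_containing[OF psubset.hyps e] E'_def[symmetric] sum_distrib_left
      by (intro sum.cong refl) (simp only: mult_ac)
    finally show ?thesis .
  qed simp
qed

section \<open>The polynomials of the expanded exponential\<close>

definition symcoeff :: "('d list \<Rightarrow> complex) \<Rightarrow> 'd multiset \<Rightarrow> complex" where
  "symcoeff S M = S (SOME l. mset l = M)"

lemma symcoeff_mset:
  assumes "symmetric_coeffs S" shows "S l = symcoeff S (mset l)"
  using assms unfolding symcoeff_def symmetric_coeffs_def by (metis (mono_tags) someI)

text \<open>The contribution of one block to the exponential of \<open>c * S_plus S\<close>. The factorial arises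
  because the exponential formula takes the coefficient of \<open>t ^ m / fact m\<close>, whereas \<open>S_plus\<close>
  lists coefficients of \<open>t ^ m\<close>.\<close>

definition black_weight :: "complex \<Rightarrow> ('d list \<Rightarrow> complex) \<Rightarrow> 'd multiset \<Rightarrow> complex" where
  "black_weight c S M = (if size M \<ge> 2 then c * fact (size M) * symcoeff S M else 0)"

lemma fps_exp_compose_const_mult:
  fixes F :: "complex fps"
  assumes "F $ 0 = 0"
  shows "fps_exp c oo F = fps_exp 1 oo (fps_const c * F)"
proof -
  have "fps_exp c = fps_exp 1 oo (fps_const c * fps_X)" by (simp add: fps_exp_compose_linear)
  then have "fps_exp c oo F = (fps_exp 1 oo (fps_const c * fps_X)) oo F" by simp
  also have "\<dots> = fps_exp 1 oo ((fps_const c * fps_X) oo F)"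
    by (rule fps_compose_assoc[symmetric]) (use assms in auto)
  also have "(fps_const c * fps_X) oo F = fps_const c * F"
    using assms by (simp add: fps_compose_mult_distrib)
  finally show ?thesis .
qed

text \<open>Words of length \<open>card B\<close> are index assignments on \<open>B\<close>, once the elements of \<open>B\<close> are ordered.\<close>

lemma S_plus_coeff_eq_sum_PiE:
  fixes q :: "real^'d::finite" and B :: "nat set"
  assumes S: "symmetric_coeffs S" and B: "finite B"
  shows "fact (card B) * (fps_const c * S_plus S q) $ card B =
    (\<Sum>b\<in>B \<rightarrow>\<^sub>E UNIV. black_weight c S (image_mset b (mset_set B)) * (\<Prod>j\<in>B. of_real (q $ b j)))"
proof (cases "card B \<ge> 2")
  case True
  define l where "l = sorted_list_of_set B"
  have l: "distinct l" "set l = B" using B by (auto simp: l_def)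
  have l3: "mset l = mset_set B" using mset_set_set[OF l(1)] unfolding l(2) by simp
  have "(\<Sum>as | length as = card B. S as * (\<Prod>a\<leftarrow>as. of_real (q $ a))) = (\<Sum>b\<in>B \<rightarrow>\<^sub>E UNIV. S (map b l) * (\<Prod>a\<leftarrow>map b l. of_real (q $ a)))"
    by (rule sum_words_eq_sum_PiE[OF l(1,2)])
  also have "\<dots> = (\<Sum>b\<in>B \<rightarrow>\<^sub>E UNIV. symcoeff S (image_mset b (mset_set B)) * (\<Prod>j\<in>B. of_real (q $ b j)))"
  proof (rule sum.cong[OF refl])
    fix b :: "nat \<Rightarrow> 'd"
    have "S (map b l) = symcoeff S (image_mset b (mset_set B))" using symcoeff_mset[OF S, of "map b l"] l3 by simp
    moreover have "(\<Prod>a\<leftarrow>map b l. complex_of_real (q $ a)) = (\<Prod>j\<in>B. of_real (q $ b j))"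
      using prod.distinct_set_conv_list[OF l(1), of "\<lambda>j. complex_of_real (q $ b j)"] l(2) by (simp add: o_def)
    ultimately show "S (map b l) * (\<Prod>a\<leftarrow>map b l. of_real (q $ a)) = symcoeff S (image_mset b (mset_set B)) * (\<Prod>j\<in>B. of_real (q $ b j))"
      by simp
  qed
  finally show ?thesis using True by (simp add: S_plus_def black_weight_def sum_distrib_left mult_ac)
qed (simp add: S_plus_def black_weight_def)

text \<open>The exponential formula writes the coefficient as a sum over partitions of products over the
  blocks. Every factor is a sum over index assignments on its block, and these combine to
  assignments on all positions.\<close>

theorem exp_S_plus_eq_sum_parts:
  fixes q :: "real^'d::finite"
  assumes S: "symmetric_coeffs S"
  shows "exp_S_plus h S n q = (\<Sum>a\<in>{..<n} \<rightarrow>\<^sub>E UNIV.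
     partition_sum (black_weight (\<i> / of_real h) S) {..<n} a * (\<Prod>j<n. of_real (q $ a j))) / fact n"
proof -
  define c where "c = \<i> / complex_of_real h"
  define x where "x m = fact m * (fps_const c * S_plus S q) $ m" for m
  define f where "f E = (\<Sum>P\<in>parts E. \<Prod>B\<in>P. x (card B))" for E :: "nat set"
  have "Abs_fps (\<lambda>n. f {..<n} / fact n) = fps_exp 1 oo Abs_fps (\<lambda>n. if n = 0 then 0 else x (card {..<n}) / fact n)"
  proof (rule exponential_formula)
    show "f {} = 1" by (simp add: f_def)
    show "f E = (\<Sum>A | e \<in> A \<and> A \<subseteq> E. x (card A) * f (E - A))" if "finite E" "e \<in> E" for E e
      unfolding f_def by (rule sum_parts_prod_rec[OF that])
    show "f E = f E'" if E: "finite E" "finite E'" "card E = card E'" for E E'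
    proof -
      obtain p where p: "bij_betw p E E'" using finite_same_card_bij[OF E] by blast
      then have pE: "p ` E = E'" "inj_on p E" by (auto simp: bij_betw_def)
      have "f E' = (\<Sum>P\<in>parts E. \<Prod>B\<in>P. x (card (p ` B)))"
        using sum_parts_prod_bij[OF pE(2), of "\<lambda>B. x (card B)"] by (simp only: f_def pE(1))
      also have "\<dots> = f E" unfolding f_def
      proof (intro sum.cong prod.cong refl)
        fix P B assume "P \<in> parts E" "B \<in> P"
        then show "x (card (p ` B)) = x (card B)" using card_image[OF inj_on_subset[OF pE(2) partsD(3)]] by simp
      qed
      finally show ?thesis by simp
    qed
  qed simp
  also have "Abs_fps (\<lambda>n. if n = 0 then 0 else x (card {..<n}) / fact n) = fps_const c * S_plus S q"
    by (rule fps_ext) (simp add: x_def S_plus_def)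
  also have "fps_exp 1 oo (fps_const c * S_plus S q) = fps_exp c oo S_plus S q"
    by (rule fps_exp_compose_const_mult[symmetric]) (simp add: S_plus_def)
  finally have "exp_S_plus h S n q = f {..<n} / fact n"
    unfolding exp_S_plus_def c_def[symmetric] by (metis fps_nth_Abs_fps)
  also have "f {..<n} = (\<Sum>P\<in>parts {..<n}. \<Sum>a\<in>{..<n} \<rightarrow>\<^sub>E UNIV. (\<Prod>B\<in>P. black_weight c S (image_mset a (mset_set B))) * (\<Prod>j<n. of_real (q $ a j)))"
    unfolding f_def
  proof (rule sum.cong[OF refl])
    fix P assume P: "P \<in> parts {..<n}"
    have finP: "finite P" by (rule partsD(5)[OF P]) simp
    have finB: "finite B" if "B \<in> P" for B using finite_subset[OF partsD(3)[OF P that]] by simp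
    have dis: "disjoint P" using P by (simp add: parts_def partition_on_def)
    let ?F = "\<lambda>B b. black_weight c S (image_mset b (mset_set B)) * (\<Prod>j\<in>B. complex_of_real (q $ b j))"
    have "(\<Prod>B\<in>P. x (card B)) = (\<Prod>B\<in>P. \<Sum>b\<in>B \<rightarrow>\<^sub>E UNIV. ?F B b)"
      unfolding x_def using finB by (intro prod.cong refl S_plus_coeff_eq_sum_PiE[OF S])
    also have "\<dots> = (\<Sum>a\<in>\<Union>P \<rightarrow>\<^sub>E UNIV. \<Prod>B\<in>P. ?F B a)"
    proof (rule prod_sum_PiE_Union[OF finP finB dis])
      fix B and a a' :: "nat \<Rightarrow> 'd" assume B: "B \<in> P" "\<And>x. x \<in> B \<Longrightarrow> a x = a' x"
      have "image_mset a (mset_set B) = image_mset a' (mset_set B)"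
        using B finB by (intro image_mset_cong) auto
      then show "?F B a = ?F B a'" using B by simp
    qed
    also have "\<dots> = (\<Sum>a\<in>\<Union>P \<rightarrow>\<^sub>E UNIV. (\<Prod>B\<in>P. black_weight c S (image_mset a (mset_set B))) * (\<Prod>j\<in>\<Union>P. of_real (q $ a j)))"
    proof (rule sum.cong[OF refl])
      fix a
      have "(\<Prod>j\<in>\<Union>P. complex_of_real (q $ a j)) = (\<Prod>B\<in>P. \<Prod>j\<in>B. of_real (q $ a j))"
        using prod.Union_disjoint[of P "\<lambda>j. complex_of_real (q $ a j)"] finB disjointD[OF dis] by (simp add: o_def)
      then show "(\<Prod>B\<in>P. ?F B a) = (\<Prod>B\<in>P. black_weight c S (image_mset a (mset_set B))) * (\<Prod>j\<in>\<Union>P. of_real (q $ a j))"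
        by (simp add: prod.distrib)
    qed
    finally show "(\<Prod>B\<in>P. x (card B)) = (\<Sum>a\<in>{..<n} \<rightarrow>\<^sub>E UNIV. (\<Prod>B\<in>P. black_weight c S (image_mset a (mset_set B))) * (\<Prod>j<n. of_real (q $ a j)))"
      by (simp only: partsD(1)[OF P])
  qed
  also have "\<dots> = (\<Sum>a\<in>{..<n} \<rightarrow>\<^sub>E UNIV. partition_sum (black_weight c S) {..<n} a * (\<Prod>j<n. of_real (q $ a j)))"
    by (subst sum.swap) (simp add: partition_sum_def sum_distrib_right)
  finally show ?thesis by (simp only: c_def)
qed

section \<open>Pairs of partitions and their connected components\<close>

text \<open>The set \<open>A\<close> is not cut by any block. Reading the elements of \<open>E\<close> as edges and the blocks of
  two partitions as vertices, the sets saturated for both partitions are the unions of edge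
  sets of connected components.\<close>

definition saturated :: "'e set \<Rightarrow> 'e set set \<Rightarrow> bool" where
  "saturated A P \<longleftrightarrow> (\<forall>B\<in>P. B \<subseteq> A \<or> B \<inter> A = {})"

text \<open>For \<open>E = {}\<close> this holds vacuously; the exponential formula leaves out the term of degree 0.\<close>

definition connected_pair :: "'e set \<Rightarrow> 'e set set \<Rightarrow> 'e set set \<Rightarrow> bool" where
  "connected_pair E P Q \<longleftrightarrow> (\<forall>A\<subseteq>E. A \<noteq> {} \<longrightarrow> saturated A P \<longrightarrow> saturated A Q \<longrightarrow> A = E)"

definition pairs :: "'e set \<Rightarrow> ('e set set \<times> 'e set set) set" where
  "pairs E = parts E \<times> parts E"

definition connected_pairs :: "'e set \<Rightarrow> ('e set set \<times> 'e set set) set" where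
  "connected_pairs E = {(P, Q) \<in> pairs E. connected_pair E P Q}"

definition component :: "'e set \<Rightarrow> 'e \<Rightarrow> 'e set set \<times> 'e set set \<Rightarrow> 'e set" where
  "component E e = (\<lambda>(P, Q). \<Inter>{A. A \<subseteq> E \<and> e \<in> A \<and> saturated A P \<and> saturated A Q})"

lemma finite_pairs [simp]: "finite E \<Longrightarrow> finite (pairs E)"
  by (simp add: pairs_def)

lemma saturated_space: "P \<in> parts E \<Longrightarrow> saturated E P"
  using partsD(3) unfolding saturated_def by blast

definition blocks_in :: "'e set \<Rightarrow> 'e set set \<Rightarrow> 'e set set" where
  "blocks_in A P = {B \<in> P. B \<subseteq> A}"

lemma blocks_in_parts:
  assumes P: "P \<in> parts E" and A: "A \<subseteq> E" "saturated A P"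
  shows "blocks_in A P \<in> parts A"
proof -
  have "\<Union>(blocks_in A P) = A"
  proof
    show "A \<subseteq> \<Union>(blocks_in A P)"
    proof
      fix x assume x: "x \<in> A"
      then obtain B where B: "B \<in> P" "x \<in> B" using partsD(1)[OF P] A(1) by blast
      then have "B \<subseteq> A" using A(2) x unfolding saturated_def by blast
      then show "x \<in> \<Union>(blocks_in A P)" using B by (auto simp: blocks_in_def)
    qed
  qed (auto simp: blocks_in_def)
  moreover have "disjoint (blocks_in A P)"
    using P by (auto simp: parts_def partition_on_def blocks_in_def intro: pairwise_subset)
  moreover have "{} \<notin> blocks_in A P" using P by (simp add: parts_def partition_on_def blocks_in_def)
  ultimately show ?thesis by (simp add: parts_def partition_on_def)
qed

lemma saturated_Diff:
  assumes "saturated A P" "P \<in> parts E" shows "saturated (E - A) P"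
  using assms partsD(3)[OF assms(2)] unfolding saturated_def by blast

lemma blocks_in_Un:
  assumes P: "P \<in> parts E" and A: "A \<subseteq> E" "saturated A P"
  shows "blocks_in A P \<union> blocks_in (E - A) P = P"
  using partsD(3)[OF P] A(2) unfolding blocks_in_def saturated_def by blast

lemma parts_Un:
  assumes "P1 \<in> parts A" "P2 \<in> parts (E - A)" "A \<subseteq> E"
  shows "P1 \<union> P2 \<in> parts E" "saturated A (P1 \<union> P2)" "blocks_in A (P1 \<union> P2) = P1" "blocks_in (E - A) (P1 \<union> P2) = P2"
proof -
  have "disjoint (P1 \<union> P2)"
    using assms partsD(1)[OF assms(1)] partsD(1)[OF assms(2)]
    by (intro disjoint_union) (auto simp: parts_def partition_on_def)
  then show "P1 \<union> P2 \<in> parts E"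
    using assms partsD(1)[OF assms(1)] partsD(1)[OF assms(2)] by (auto simp: parts_def partition_on_def)
  show "saturated A (P1 \<union> P2)"
    using partsD(3)[OF assms(1)] partsD(3)[OF assms(2)] unfolding saturated_def by blast
  show "blocks_in A (P1 \<union> P2) = P1"
    using partsD(2,3)[OF assms(1)] partsD(2,3)[OF assms(2)] unfolding blocks_in_def by blast
  show "blocks_in (E - A) (P1 \<union> P2) = P2"
    using partsD(2,3)[OF assms(1)] partsD(2,3)[OF assms(2)] unfolding blocks_in_def by blast
qed

lemma component_props:
  assumes "(P, Q) \<in> pairs E" "e \<in> E"
  shows "component E e (P, Q) \<subseteq> E" "e \<in> component E e (P, Q)"
    "saturated (component E e (P, Q)) P" "saturated (component E e (P, Q)) Q"
proof -
  let ?S = "{A. A \<subseteq> E \<and> e \<in> A \<and> saturated A P \<and> saturated A Q}"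
  have c: "component E e (P, Q) = \<Inter>?S" by (simp add: component_def)
  have E: "E \<in> ?S" using assms saturated_space by (auto simp: pairs_def)
  show "component E e (P, Q) \<subseteq> E" "e \<in> component E e (P, Q)" unfolding c using E by auto
  have "B \<subseteq> \<Inter>?S \<or> B \<inter> \<Inter>?S = {}" if "B \<in> P \<or> B \<in> Q" for B
  proof (cases "\<exists>A\<in>?S. \<not> B \<subseteq> A")
    case True
    then obtain A where "A \<in> ?S" "\<not> B \<subseteq> A" by blast
    then have "B \<inter> A = {}" using that unfolding saturated_def by blast
    then show ?thesis using \<open>A \<in> ?S\<close> by blast
  qed blast
  then show "saturated (component E e (P, Q)) P" "saturated (component E e (P, Q)) Q"
    unfolding c saturated_def by blast+
qed

lemma component_least:
  assumes "A \<subseteq> E" "e \<in> A" "saturated A P" "saturated A Q"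
  shows "component E e (P, Q) \<subseteq> A"
  using assms unfolding component_def by blast

text \<open>A nonempty saturated part of the component of \<open>e\<close>, or else its complement in the component,
  contains \<open>e\<close> and is the whole component by minimality.\<close>

lemma connected_component:
  assumes PQ: "(P, Q) \<in> pairs E" "e \<in> E"
  defines "A \<equiv> component E e (P, Q)"
  shows "(blocks_in A P, blocks_in A Q) \<in> connected_pairs A"
proof -
  note props = component_props[OF PQ, folded A_def]
  have PQ': "P \<in> parts E" "Q \<in> parts E" using PQ by (auto simp: pairs_def)
  have "A' = A" if A': "A' \<subseteq> A" "A' \<noteq> {}" "saturated A' (blocks_in A P)" "saturated A' (blocks_in A Q)" for A'
  proof -
    have sat: "saturated A' R" if "saturated A' (blocks_in A R)" "saturated A R" "R \<in> parts E" for R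
      unfolding saturated_def
    proof
      fix B assume B: "B \<in> R"
      show "B \<subseteq> A' \<or> B \<inter> A' = {}"
      proof (cases "B \<subseteq> A")
        case True
        then show ?thesis using that(1) B unfolding saturated_def blocks_in_def by blast
      next
        case False
        then have "B \<inter> A = {}" using that(2) B unfolding saturated_def by blast
        then show ?thesis using A'(1) by blast
      qed
    qed
    have s: "saturated A' P" "saturated A' Q"
      using sat A' props PQ' by blast+
    show ?thesis
    proof (cases "e \<in> A'")
      case True
      then have "A \<subseteq> A'" unfolding A_def by (intro component_least) (use A' props s in auto)
      then show ?thesis using A' by blast
    next
      case False
      have s': "saturated (A - A') R" if "saturated A R" "saturated A' R" for R
        using that unfolding saturated_def by blast
      have "A \<subseteq> A - A'" unfolding A_def
        by (intro component_least) (use False props s s' in \<open>auto simp: A_def[symmetric]\<close>)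
      then show ?thesis using A' by blast
    qed
  qed
  then show ?thesis
    using blocks_in_parts[OF PQ'(1) props(1,3)] blocks_in_parts[OF PQ'(2) props(1,4)]
    unfolding connected_pairs_def pairs_def connected_pair_def by blast
qed

lemma component_Un:
  assumes A: "A \<subseteq> E" "e \<in> A" and 1: "(P1, Q1) \<in> connected_pairs A" and 2: "(P2, Q2) \<in> pairs (E - A)"
  shows "component E e (P1 \<union> P2, Q1 \<union> Q2) = A"
proof
  have p: "P1 \<in> parts A" "Q1 \<in> parts A" "P2 \<in> parts (E - A)" "Q2 \<in> parts (E - A)"
    using 1 2 by (auto simp: connected_pairs_def pairs_def)
  note P = parts_Un[OF p(1,3) A(1)] and Q = parts_Un[OF p(2,4) A(1)]
  have PQ: "(P1 \<union> P2, Q1 \<union> Q2) \<in> pairs E" using P Q by (simp add: pairs_def)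
  show le: "component E e (P1 \<union> P2, Q1 \<union> Q2) \<subseteq> A"
    by (rule component_least[OF A P(2) Q(2)])
  let ?C = "component E e (P1 \<union> P2, Q1 \<union> Q2)"
  note C = component_props[OF PQ subsetD[OF A]]
  have "saturated ?C P1" "saturated ?C Q1" using C(3,4) unfolding saturated_def by blast+
  then have "?C = A" using 1 le C(2) unfolding connected_pairs_def connected_pair_def by blast
  then show "A \<subseteq> ?C" by simp
qed

text \<open>Splitting off the component of \<open>e\<close>: a pair of partitions consists of a connected pair on the
  component and an arbitrary pair on the remaining elements.\<close>

lemma sum_pairs_component:
  assumes fin: "finite E" and e: "e \<in> E"
  shows "(\<Sum>x\<in>pairs E. F (fst x) (snd x)) =
    (\<Sum>A | e \<in> A \<and> A \<subseteq> E. \<Sum>x\<in>connected_pairs A. \<Sum>y\<in>pairs (E - A). F (fst x \<union> fst y) (snd x \<union> snd y))"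
proof -
  have "(\<Sum>x\<in>pairs E. F (fst x) (snd x)) = (\<Sum>A | e \<in> A \<and> A \<subseteq> E. \<Sum>x\<in>{x \<in> pairs E. component E e x = A}. F (fst x) (snd x))"
  proof (rule sum.group[symmetric])
    show "component E e ` pairs E \<subseteq> {A. e \<in> A \<and> A \<subseteq> E}"
      using component_props(1,2)[OF _ e] by (force simp del: component_def)
  qed (use fin in auto)
  also have "\<dots> = (\<Sum>A | e \<in> A \<and> A \<subseteq> E. \<Sum>x\<in>connected_pairs A. \<Sum>y\<in>pairs (E - A). F (fst x \<union> fst y) (snd x \<union> snd y))"
  proof (rule sum.cong[OF refl])
    fix A assume "A \<in> {A. e \<in> A \<and> A \<subseteq> E}"
    then have A: "A \<subseteq> E" "e \<in> A" by auto
    let ?h = "\<lambda>z. (fst (fst z) \<union> fst (snd z), snd (fst z) \<union> snd (snd z)) :: 'a set set \<times> 'a set set"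
    let ?i = "\<lambda>x. ((blocks_in A (fst x), blocks_in A (snd x)), (blocks_in (E - A) (fst x), blocks_in (E - A) (snd x))) :: ('a set set \<times> 'a set set) \<times> ('a set set \<times> 'a set set)"
    have "bij_betw ?h (connected_pairs A \<times> pairs (E - A)) {x \<in> pairs E. component E e x = A}"
    proof (rule bij_betw_byWitness[where f'="?i"])
      show "\<forall>z\<in>connected_pairs A \<times> pairs (E - A). ?i (?h z) = z"
      proof
        fix z assume z: "z \<in> connected_pairs A \<times> pairs (E - A)"
        obtain P1 Q1 P2 Q2 where zz: "z = ((P1, Q1), (P2, Q2))" by (metis prod.collapse)
        have p: "P1 \<in> parts A" "Q1 \<in> parts A" "P2 \<in> parts (E - A)" "Q2 \<in> parts (E - A)"
          using z unfolding zz by (auto simp: connected_pairs_def pairs_def)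
        show "?i (?h z) = z"
          unfolding zz using parts_Un(3,4)[OF p(1,3) A(1)] parts_Un(3,4)[OF p(2,4) A(1)] by simp
      qed
      show "\<forall>x\<in>{x \<in> pairs E. component E e x = A}. ?h (?i x) = x"
      proof
        fix x assume x: "x \<in> {x \<in> pairs E. component E e x = A}"
        obtain P Q where xx: "x = (P, Q)" by (cases x)
        have PQ: "(P, Q) \<in> pairs E" "component E e (P, Q) = A" using x xx by auto
        note c = component_props[OF PQ(1) e, unfolded PQ(2)]
        have p: "P \<in> parts E" "Q \<in> parts E" using PQ by (auto simp: pairs_def)
        show "?h (?i x) = x"
          unfolding xx using blocks_in_Un[OF p(1) c(1,3)] blocks_in_Un[OF p(2) c(1,4)] by simp
      qed
      show "?h ` (connected_pairs A \<times> pairs (E - A)) \<subseteq> {x \<in> pairs E. component E e x = A}"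
      proof
        fix x assume "x \<in> ?h ` (connected_pairs A \<times> pairs (E - A))"
        then obtain z where z: "z \<in> connected_pairs A \<times> pairs (E - A)" and x: "x = ?h z" by (rule imageE)
        obtain P1 Q1 P2 Q2 where zz: "z = ((P1, Q1), (P2, Q2))" by (metis prod.collapse)
        have z1: "(P1, Q1) \<in> connected_pairs A" and z2: "(P2, Q2) \<in> pairs (E - A)" using z unfolding zz by auto
        then have p: "P1 \<in> parts A" "Q1 \<in> parts A" "P2 \<in> parts (E - A)" "Q2 \<in> parts (E - A)"
          by (auto simp: connected_pairs_def pairs_def)
        show "x \<in> {x \<in> pairs E. component E e x = A}"
          unfolding x zz using component_Un[OF A z1 z2] parts_Un(1)[OF p(1,3) A(1)] parts_Un(1)[OF p(2,4) A(1)]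
          by (simp add: pairs_def)
      qed
      show "?i ` {x \<in> pairs E. component E e x = A} \<subseteq> connected_pairs A \<times> pairs (E - A)"
      proof
        fix z assume "z \<in> ?i ` {x \<in> pairs E. component E e x = A}"
        then obtain x where x: "x \<in> {x \<in> pairs E. component E e x = A}" and z: "z = ?i x" by (rule imageE)
        obtain P Q where xx: "x = (P, Q)" by (cases x)
        have PQ: "(P, Q) \<in> pairs E" "component E e (P, Q) = A" using x xx by auto
        note c = component_props[OF PQ(1) e, unfolded PQ(2)]
        have p: "P \<in> parts E" "Q \<in> parts E" using PQ by (auto simp: pairs_def)
        have "(blocks_in A P, blocks_in A Q) \<in> connected_pairs A"
          using connected_component[OF PQ(1) e] unfolding PQ(2) .
        moreover have "blocks_in (E - A) P \<in> parts (E - A)" "blocks_in (E - A) Q \<in> parts (E - A)"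
          using blocks_in_parts saturated_Diff p c by blast+
        ultimately show "z \<in> connected_pairs A \<times> pairs (E - A)"
          unfolding z xx by (simp add: pairs_def)
      qed
    qed
    then have "(\<Sum>x\<in>{x \<in> pairs E. component E e x = A}. F (fst x) (snd x)) = (\<Sum>z\<in>connected_pairs A \<times> pairs (E - A). F (fst (?h z)) (snd (?h z)))"
      by (rule sum.reindex_bij_betw[symmetric])
    also have "\<dots> = (\<Sum>x\<in>connected_pairs A. \<Sum>y\<in>pairs (E - A). F (fst x \<union> fst y) (snd x \<union> snd y))"
      by (simp add: sum.cartesian_product case_prod_unfold)
    finally show "(\<Sum>x\<in>{x \<in> pairs E. component E e x = A}. F (fst x) (snd x)) =
      (\<Sum>x\<in>connected_pairs A. \<Sum>y\<in>pairs (E - A). F (fst x \<union> fst y) (snd x \<union> snd y))" .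
  qed
  finally show ?thesis .
qed

section \<open>The exponential formula for pairs of partitions\<close>

text \<open>The weight of the graph with the edges \<open>E\<close>, the black vertices \<open>P\<close> and the white vertices
  \<open>Q\<close>: the indices on the edges are contracted.\<close>

definition pair_weight :: "('d::finite multiset \<Rightarrow> 'b::comm_semiring_1) \<Rightarrow> ('d multiset \<Rightarrow> 'b) \<Rightarrow> 'e set \<Rightarrow> 'e set set \<Rightarrow> 'e set set \<Rightarrow> 'b" where
  "pair_weight \<alpha> \<delta> E P Q = (\<Sum>a\<in>E \<rightarrow>\<^sub>E UNIV.
     (\<Prod>B\<in>P. \<alpha> (image_mset a (mset_set B))) * (\<Prod>C\<in>Q. \<delta> (image_mset a (mset_set C))))"

lemma prod_blocks_restrict:
  assumes "P \<in> parts A" "finite A"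
  shows "(\<Prod>B\<in>P. \<alpha> (image_mset (restrict a A) (mset_set B))) = (\<Prod>B\<in>P. \<alpha> (image_mset a (mset_set B)))"
proof (rule prod.cong[OF refl])
  fix B assume "B \<in> P"
  then have B: "B \<subseteq> A" by (rule partsD(3)[OF assms(1)])
  then have "image_mset (restrict a A) (mset_set B) = image_mset a (mset_set B)"
    using finite_subset[OF B assms(2)] by (intro image_mset_cong) auto
  then show "\<alpha> (image_mset (restrict a A) (mset_set B)) = \<alpha> (image_mset a (mset_set B))" by simp
qed

lemma pair_weight_Un:
  assumes fin: "finite E" and A: "A \<subseteq> E"
    and p: "P1 \<in> parts A" "Q1 \<in> parts A" "P2 \<in> parts (E - A)" "Q2 \<in> parts (E - A)"
  shows "pair_weight \<alpha> \<delta> E (P1 \<union> P2) (Q1 \<union> Q2) = pair_weight \<alpha> \<delta> A P1 Q1 * pair_weight \<alpha> \<delta> (E - A) P2 Q2"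
proof -
  have fA: "finite A" "finite (E - A)" using fin A finite_subset by auto
  have fp: "finite P1" "finite Q1" "finite P2" "finite Q2" using p fA partsD(5) by blast+
  have disj: "P1 \<inter> P2 = {}" "Q1 \<inter> Q2 = {}"
    using partsD(2,3)[OF p(1)] partsD(3)[OF p(3)] partsD(2,3)[OF p(2)] partsD(3)[OF p(4)] by blast+
  let ?f = "\<lambda>P Q a. (\<Prod>B\<in>P. \<alpha> (image_mset a (mset_set B))) * (\<Prod>C\<in>Q. \<delta> (image_mset a (mset_set C)))"
  have "pair_weight \<alpha> \<delta> A P1 Q1 * pair_weight \<alpha> \<delta> (E - A) P2 Q2 =
    (\<Sum>a\<in>(A \<union> (E - A)) \<rightarrow>\<^sub>E UNIV. ?f P1 Q1 (restrict a A) * ?f P2 Q2 (restrict a (E - A)))"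
    unfolding pair_weight_def by (rule sum_PiE_Un[symmetric]) (use fA in auto)
  also have "A \<union> (E - A) = E" using A by auto
  also have "(\<Sum>a\<in>E \<rightarrow>\<^sub>E UNIV. ?f P1 Q1 (restrict a A) * ?f P2 Q2 (restrict a (E - A))) = pair_weight \<alpha> \<delta> E (P1 \<union> P2) (Q1 \<union> Q2)"
    unfolding pair_weight_def prod_blocks_restrict[OF p(1) fA(1)] prod_blocks_restrict[OF p(2) fA(1)]
      prod_blocks_restrict[OF p(3) fA(2)] prod_blocks_restrict[OF p(4) fA(2)]
    by (intro sum.cong refl) (simp add: prod.union_disjoint fp disj mult_ac)
  finally show ?thesis by simp
qed

definition all_sum :: "('d::finite multiset \<Rightarrow> 'b::comm_semiring_1) \<Rightarrow> ('d multiset \<Rightarrow> 'b) \<Rightarrow> 'e set \<Rightarrow> 'b" where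
  "all_sum \<alpha> \<delta> E = (\<Sum>x\<in>pairs E. pair_weight \<alpha> \<delta> E (fst x) (snd x))"

definition connected_sum :: "('d::finite multiset \<Rightarrow> 'b::comm_semiring_1) \<Rightarrow> ('d multiset \<Rightarrow> 'b) \<Rightarrow> 'e set \<Rightarrow> 'b" where
  "connected_sum \<alpha> \<delta> E = (\<Sum>x\<in>connected_pairs E. pair_weight \<alpha> \<delta> E (fst x) (snd x))"

lemma all_sum_rec:
  assumes "finite E" "e \<in> E"
  shows "all_sum \<alpha> \<delta> E = (\<Sum>A | e \<in> A \<and> A \<subseteq> E. connected_sum \<alpha> \<delta> A * all_sum \<alpha> \<delta> (E - A))"
  unfolding all_sum_def sum_pairs_component[OF assms]
proof (rule sum.cong[OF refl])
  fix A assume "A \<in> {A. e \<in> A \<and> A \<subseteq> E}"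
  then have A: "A \<subseteq> E" by auto
  have "pair_weight \<alpha> \<delta> E (fst x \<union> fst y) (snd x \<union> snd y) = pair_weight \<alpha> \<delta> A (fst x) (snd x) * pair_weight \<alpha> \<delta> (E - A) (fst y) (snd y)"
    if "x \<in> connected_pairs A" "y \<in> pairs (E - A)" for x y
    using that by (intro pair_weight_Un[OF assms(1) A]) (auto simp: connected_pairs_def pairs_def)
  then show "(\<Sum>x\<in>connected_pairs A. \<Sum>y\<in>pairs (E - A). pair_weight \<alpha> \<delta> E (fst x \<union> fst y) (snd x \<union> snd y)) =
    connected_sum \<alpha> \<delta> A * (\<Sum>y\<in>pairs (E - A). pair_weight \<alpha> \<delta> (E - A) (fst y) (snd y))"
    unfolding connected_sum_def sum_product by (intro sum.cong refl) auto
qed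

lemma all_sum_eq_Phi:
  "all_sum \<alpha> \<delta> E = (\<Sum>a\<in>E \<rightarrow>\<^sub>E UNIV. partition_sum \<alpha> E a * partition_sum \<delta> E a)"
proof -
  have "all_sum \<alpha> \<delta> E = (\<Sum>a\<in>E \<rightarrow>\<^sub>E UNIV. \<Sum>x\<in>parts E \<times> parts E. (\<Prod>B\<in>fst x. \<alpha> (image_mset a (mset_set B))) * (\<Prod>C\<in>snd x. \<delta> (image_mset a (mset_set C))))"
    unfolding all_sum_def pair_weight_def pairs_def by (rule sum.swap)
  also have "\<dots> = (\<Sum>a\<in>E \<rightarrow>\<^sub>E UNIV. partition_sum \<alpha> E a * partition_sum \<delta> E a)"
    unfolding partition_sum_def sum_product sum.cartesian_product by (simp add: case_prod_unfold)
  finally show ?thesis .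
qed

lemma sum_PiE_bij:
  fixes p :: "'a \<Rightarrow> 'b" and F :: "('a \<Rightarrow> 'd::finite) \<Rightarrow> 'c::comm_monoid_add"
  assumes p: "inj_on p E"
  shows "(\<Sum>a\<in>(p ` E) \<rightarrow>\<^sub>E (UNIV :: 'd::finite set). F (restrict (a \<circ> p) E)) = (\<Sum>b\<in>E \<rightarrow>\<^sub>E (UNIV :: 'd set). F b)"
proof (rule sum.reindex_bij_betw)
  show "bij_betw (\<lambda>a. restrict (a \<circ> p) E) ((p ` E) \<rightarrow>\<^sub>E (UNIV :: 'd set)) (E \<rightarrow>\<^sub>E UNIV)"
  proof (rule bij_betw_byWitness[where f'="\<lambda>b. restrict (b \<circ> inv_into E p) (p ` E)"])
    show "\<forall>a\<in>(p ` E) \<rightarrow>\<^sub>E (UNIV :: 'd set). restrict (restrict (a \<circ> p) E \<circ> inv_into E p) (p ` E) = a"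
    proof (intro ballI ext)
      fix a :: "'b \<Rightarrow> 'd" and x assume a: "a \<in> (p ` E) \<rightarrow>\<^sub>E (UNIV :: 'd set)"
      show "restrict (restrict (a \<circ> p) E \<circ> inv_into E p) (p ` E) x = a x"
        using PiE_arb[OF a, of x] by (cases "x \<in> p ` E") (simp_all add: inv_into_into f_inv_into_f)
    qed
    show "\<forall>b\<in>E \<rightarrow>\<^sub>E (UNIV :: 'd set). restrict (restrict (b \<circ> inv_into E p) (p ` E) \<circ> p) E = b"
    proof (intro ballI ext)
      fix b :: "'a \<Rightarrow> 'd" and x assume b: "b \<in> E \<rightarrow>\<^sub>E (UNIV :: 'd set)"
      show "restrict (restrict (b \<circ> inv_into E p) (p ` E) \<circ> p) E x = b x"
        using PiE_arb[OF b, of x] p by (cases "x \<in> E") simp_all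
    qed
  qed auto
qed

text \<open>Partition sums are transported along bijections.\<close>

lemma all_sum_card:
  fixes \<alpha> \<delta> :: "'d::finite multiset \<Rightarrow> 'c::comm_semiring_1" and E :: "'e set" and E' :: "'f set"
  assumes E: "finite E" "finite E'" "card E = card E'"
  shows "all_sum \<alpha> \<delta> E = all_sum \<alpha> \<delta> E'"
proof -
  obtain p where "bij_betw p E E'" using finite_same_card_bij[OF E] by blast
  then have p: "p ` E = E'" "inj_on p E" by (auto simp: bij_betw_def)
  have "all_sum \<alpha> \<delta> E' = (\<Sum>a\<in>(p ` E) \<rightarrow>\<^sub>E UNIV. partition_sum \<alpha> E (restrict (a \<circ> p) E) * partition_sum \<delta> E (restrict (a \<circ> p) E))"
    unfolding all_sum_eq_Phi p(1)[symmetric] partition_sum_bij[OF p(2)]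
  proof (rule sum.cong[OF refl])
    fix a :: "'f \<Rightarrow> 'd"
    have "partition_sum \<beta> E (a \<circ> p) = partition_sum \<beta> E (restrict (a \<circ> p) E)" for \<beta> :: "'d multiset \<Rightarrow> 'c"
      by (rule partition_sum_cong[OF E(1)]) simp
    then show "partition_sum \<alpha> E (a \<circ> p) * partition_sum \<delta> E (a \<circ> p) = partition_sum \<alpha> E (restrict (a \<circ> p) E) * partition_sum \<delta> E (restrict (a \<circ> p) E)" by simp
  qed
  also have "\<dots> = all_sum \<alpha> \<delta> E"
    unfolding all_sum_eq_Phi by (rule sum_PiE_bij[OF p(2)])
  finally show ?thesis by simp
qed

lemma all_sum_empty: "all_sum \<alpha> \<delta> {} = 1"
  by (simp add: all_sum_eq_Phi)

text \<open>The recursion \<open>all_sum_rec\<close> determines connected sums by total sums, which depend only on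
  the cardinality: the term with \<open>A = E\<close> is the connected sum over \<open>E\<close>, and the other terms
  involve smaller sets.\<close>

lemma connected_sum_card:
  fixes \<alpha> \<delta> :: "'d::finite multiset \<Rightarrow> 'c::comm_ring_1" and E :: "nat set"
  assumes "finite E" "E \<noteq> {}"
  shows "connected_sum \<alpha> \<delta> E = connected_sum \<alpha> \<delta> {..<card E}"
  using assms
proof (induction "card E" arbitrary: E rule: less_induct)
  case less
  define n where "n = card E - 1"
  have n: "card E = Suc n" using less.prems by (simp add: n_def card_gt_0_iff)
  \<comment> \<open>the value 0 at \<open>k = n\<close> removes the set \<open>A = F\<close> from the sum\<close>
  define h where "h k = (if k = n then 0 else connected_sum \<alpha> \<delta> {..<Suc k} * all_sum \<alpha> \<delta> {..<n - k})" for k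
  have split: "all_sum \<alpha> \<delta> F = connected_sum \<alpha> \<delta> F + (\<Sum>k\<le>n. of_nat (n choose k) * h k)"
    if F: "finite F" "card F = Suc n" for F :: "nat set"
  proof -
    obtain e where e: "e \<in> F" using F by fastforce
    define F' where "F' = F - {e}"
    have F': "F = insert e F'" "e \<notin> F'" "finite F'" "card F' = n" using e F by (auto simp: F'_def)
    have "all_sum \<alpha> \<delta> F = (\<Sum>A\<in>Pow F'. connected_sum \<alpha> \<delta> (insert e A) * all_sum \<alpha> \<delta> (F - insert e A))"
      unfolding all_sum_rec[OF F(1) e] sum_subsets_containing[OF F(1) e] F'_def ..
    also have "\<dots> = connected_sum \<alpha> \<delta> F * all_sum \<alpha> \<delta> (F - F) + (\<Sum>A\<in>Pow F' - {F'}. connected_sum \<alpha> \<delta> (insert e A) * all_sum \<alpha> \<delta> (F - insert e A))"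
      using F' by (subst sum.remove[of _ F']) auto
    also have "(\<Sum>A\<in>Pow F' - {F'}. connected_sum \<alpha> \<delta> (insert e A) * all_sum \<alpha> \<delta> (F - insert e A)) = (\<Sum>A\<in>Pow F' - {F'}. h (card A))"
    proof (rule sum.cong[OF refl])
      fix A assume A: "A \<in> Pow F' - {F'}"
      then have A': "finite A" "e \<notin> A" "A \<subset> F'" using F' finite_subset by auto
      have lt: "card A < n" using psubset_card_mono[OF F'(3) A'(3)] F'(4) by simp
      then have 1: "connected_sum \<alpha> \<delta> (insert e A) = connected_sum \<alpha> \<delta> {..<Suc (card A)}"
        using less.hyps[of "insert e A"] lt n A' by simp
      have "card (F - insert e A) = n - card A"
        using A' F F' by (subst card_Diff_subset) auto
      then have 2: "all_sum \<alpha> \<delta> (F - insert e A) = all_sum \<alpha> \<delta> {..<n - card A}"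
        using F by (intro all_sum_card) auto
      show "connected_sum \<alpha> \<delta> (insert e A) * all_sum \<alpha> \<delta> (F - insert e A) = h (card A)"
        using lt by (simp add: h_def 1 2)
    qed
    also have "\<dots> = (\<Sum>A\<in>Pow F'. h (card A))"
      using F' by (subst (2) sum.remove[of _ F']) (auto simp: h_def)
    also have "\<dots> = (\<Sum>k\<le>n. of_nat (n choose k) * h k)"
      using sum_Pow_card[OF F'(3), of h] F'(4) by simp
    finally show ?thesis by (simp add: all_sum_empty)
  qed
  have "connected_sum \<alpha> \<delta> E = all_sum \<alpha> \<delta> E - (\<Sum>k\<le>n. of_nat (n choose k) * h k)"
    using split[OF less.prems(1) n] by simp
  also have "all_sum \<alpha> \<delta> E = all_sum \<alpha> \<delta> {..<Suc n}"
    by (rule all_sum_card) (use less.prems n in auto)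
  also have "\<dots> - (\<Sum>k\<le>n. of_nat (n choose k) * h k) = connected_sum \<alpha> \<delta> {..<Suc n}"
    using split[of "{..<Suc n}"] by simp
  finally show ?case unfolding n .
qed

theorem all_sum_eq_exp_connected_sum:
  fixes \<alpha> \<delta> :: "'d::finite multiset \<Rightarrow> 'c::field_char_0"
  shows "Abs_fps (\<lambda>n. all_sum \<alpha> \<delta> {..<n} / fact n) =
    fps_exp 1 oo Abs_fps (\<lambda>n. if n = 0 then 0 else connected_sum \<alpha> \<delta> {..<n} / fact n)"
proof (rule exponential_formula)
  show "connected_sum \<alpha> \<delta> E = connected_sum \<alpha> \<delta> E'"
    if "finite E" "finite E'" "E \<noteq> {}" "card E = card E'" for E E' :: "nat set"
  proof -
    have "E' \<noteq> {}" using that by auto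
    then show ?thesis using connected_sum_card[of E \<alpha> \<delta>] connected_sum_card[of E' \<alpha> \<delta>] that by simp
  qed
qed (rule all_sum_empty all_sum_rec all_sum_card; assumption)+

section \<open>The formal integral as a sum over pairs of partitions\<close>

text \<open>The powers of \<open>- \<i> * h\<close> that accompany the derivatives are distributed over the blocks.\<close>

definition black_factor :: "real \<Rightarrow> ('d list \<Rightarrow> complex) \<Rightarrow> 'd multiset \<Rightarrow> complex" where
  "black_factor h S M = black_weight (\<i> / of_real h) S M * (- \<i> * of_real h) ^ size M"

definition white_factor :: "real \<Rightarrow> (real^'d::finite \<Rightarrow> real) \<Rightarrow> real^'d \<Rightarrow> 'd multiset \<Rightarrow> complex" where
  "white_factor h G x M = \<i> / of_real h * of_real (pd M G x)"

text \<open>Both the polynomial and the derivatives of the exponential of \<open>G\<close> are partition sums over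
  the same positions with the same indices; their product is a sum over pairs of partitions.\<close>

theorem formal_integral_eq_sum_pairs:
  fixes S :: "'d::finite list \<Rightarrow> complex" and G :: "real^'d \<Rightarrow> real"
  assumes h: "h > 0" and S: "symmetric_coeffs S" and G: "smooth G"
  shows "formal_integral h S G =
    fps_const (exp (\<i> / of_real h * (S [] + of_real (G (lin_part S))))) *
    Abs_fps (\<lambda>n. all_sum (black_factor h S) (white_factor h G (lin_part S)) {..<n} / fact n)"
proof (rule fps_ext)
  fix n
  define c where "c = \<i> / complex_of_real h"
  define u where "u = (\<lambda>y. exp (c * of_real (G y)))"
  define x where "x = lin_part S"
  define cw where "cw w = partition_sum (black_weight c S) {..<n} (\<lambda>j. w ! j) / fact n" for w :: "'d list"
  let ?W = "{w :: 'd list. length w = n}"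
  have W: "finite ?W" using finite_lists_length_eq[of "UNIV :: 'd set" n] by simp
  have u_smooth: "smooth u" unfolding u_def by (rule smooth_exp[OF G])
  have u_norm: "norm (u y) \<le> 1" for y by (simp add: u_def c_def)
  have words: "(\<Sum>w\<in>?W. F w) = (\<Sum>b\<in>{..<n} \<rightarrow>\<^sub>E UNIV. F (map b [0..<n]))" for F :: "'d list \<Rightarrow> complex"
    using sum_words_eq_sum_PiE[of "[0..<n]" "{..<n}" F] by (simp add: atLeast_upt[symmetric] lessThan_atLeast0)
  have cw_map: "cw (map b [0..<n]) = partition_sum (black_weight c S) {..<n} b / fact n" for b :: "nat \<Rightarrow> 'd"
    unfolding cw_def by (subst partition_sum_cong[where a'=b]) auto
  have mset_map: "mset (map b [0..<n]) = image_mset b (mset_set {..<n})" for b :: "nat \<Rightarrow> 'd"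
    by (simp add: atLeast_upt lessThan_atLeast0)
  have "exp_S_plus h S n = word_poly cw ?W"
  proof
    fix q
    have "word_poly cw ?W q = (\<Sum>b\<in>{..<n} \<rightarrow>\<^sub>E UNIV. partition_sum (black_weight c S) {..<n} b / fact n * (\<Prod>j<n. of_real (q $ b j)))"
      unfolding word_poly_def words cw_map
    proof (rule sum.cong[OF refl])
      fix b :: "nat \<Rightarrow> 'd"
      have "(\<Prod>a\<leftarrow>map b [0..<n]. complex_of_real (q $ a)) = (\<Prod>j<n. of_real (q $ b j))"
        using prod.distinct_set_conv_list[of "[0..<n]" "\<lambda>j. complex_of_real (q $ b j)"] by (simp add: o_def lessThan_atLeast0)
      then show "partition_sum (black_weight c S) {..<n} b / fact n * (\<Prod>a\<leftarrow>map b [0..<n]. of_real (q $ a)) = partition_sum (black_weight c S) {..<n} b / fact n * (\<Prod>j<n. of_real (q $ b j))"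
        by simp
    qed
    then show "exp_S_plus h S n q = word_poly cw ?W q"
      unfolding exp_S_plus_eq_sum_parts[OF S] c_def[symmetric] by (simp add: sum_divide_distrib)
  qed
  then have "formal_integral h S G $ n = exp (c * S []) * distr_eval (multiplier_distr h (word_poly cw ?W) u) x"
    by (simp add: formal_integral_def multiplier_distr_def c_def u_def x_def)
  also have "distr_eval (multiplier_distr h (word_poly cw ?W) u) x = (\<Sum>w\<in>?W. cw w * (- \<i> * of_real h) ^ length w * partials (rev w) u x)"
    by (rule distr_eval_multiplier_distr[OF h W u_smooth u_norm])
  also have "\<dots> = (\<Sum>b\<in>{..<n} \<rightarrow>\<^sub>E UNIV. u x * (partition_sum (black_factor h S) {..<n} b * partition_sum (white_factor h G x) {..<n} b) / fact n)"
    unfolding words cw_map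
  proof (rule sum.cong[OF refl])
    fix b :: "nat \<Rightarrow> 'd"
    have "mset (rev (map b [0..<n])) = image_mset b (mset_set {..<n})"
      using mset_map[of b] by (simp only: mset_rev)
    then have "partials (rev (map b [0..<n])) u x = pd (image_mset b (mset_set {..<n})) u x"
      using partials_eq_pd[OF u_smooth, of "rev (map b [0..<n])"] by (simp only:)
    also have "\<dots> = u x * partition_sum (white_factor h G x) {..<n} b"
      unfolding u_def white_factor_def[abs_def] c_def[symmetric] by (rule faa_di_bruno_exp[OF G]) simp
    finally have 1: "partials (rev (map b [0..<n])) u x = u x * partition_sum (white_factor h G x) {..<n} b" .
    have 2: "partition_sum (black_factor h S) {..<n} b = (- \<i> * of_real h) ^ n * partition_sum (black_weight c S) {..<n} b"
      unfolding black_factor_def[abs_def] c_def[symmetric] using partition_sum_mult[of "{..<n}" "black_weight c S" "- \<i> * of_real h" b] by simp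
    show "partition_sum (black_weight c S) {..<n} b / fact n * (- \<i> * of_real h) ^ length (map b [0..<n]) * partials (rev (map b [0..<n])) u x
       = u x * (partition_sum (black_factor h S) {..<n} b * partition_sum (white_factor h G x) {..<n} b) / fact n"
      unfolding 1 2 by simp
  qed
  also have "\<dots> = u x * (all_sum (black_factor h S) (white_factor h G x) {..<n} / fact n)"
    by (simp add: all_sum_eq_Phi sum_distrib_left sum_divide_distrib)
  finally have "formal_integral h S G $ n = exp (c * S []) * (u x * (all_sum (black_factor h S) (white_factor h G x) {..<n} / fact n))" .
  also have "\<dots> = exp (c * (S [] + of_real (G x))) * (all_sum (black_factor h S) (white_factor h G x) {..<n} / fact n)"
    by (simp add: u_def distrib_left exp_add)
  finally show "formal_integral h S G $ n = (fps_const (exp (\<i> / of_real h * (S [] + of_real (G (lin_part S))))) *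
    Abs_fps (\<lambda>n. all_sum (black_factor h S) (white_factor h G (lin_part S)) {..<n} / fact n)) $ n"
    by (simp add: c_def x_def)
qed

section \<open>Enumerating the edges of a graph\<close>

definition fibre :: "nat \<Rightarrow> (nat \<Rightarrow> 'v) \<Rightarrow> 'v \<Rightarrow> nat set" where
  "fibre n f v = {j. j < n \<and> f j = v}"

text \<open>If \<open>f j\<close> is the end of a given colour of the edge \<open>j\<close>, then these are the blocks of edges
  that share this end.\<close>

definition fibres :: "nat \<Rightarrow> (nat \<Rightarrow> 'v) \<Rightarrow> nat set set" where
  "fibres n f = fibre n f ` f ` {..<n}"

lemma mem_fibre [simp]: "j \<in> fibre n f v \<longleftrightarrow> j < n \<and> f j = v"
  by (simp add: fibre_def)

lemma fibre_subset: "fibre n f v \<subseteq> {..<n}"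
  by (simp add: subset_iff)

lemma finite_fibre [simp]: "finite (fibre n f v)"
  by (rule finite_subset[OF fibre_subset]) simp

lemma fibre_nonempty: "v \<in> f ` {..<n} \<longleftrightarrow> fibre n f v \<noteq> {}"
  unfolding fibre_def by blast

lemma inj_on_fibre: "inj_on (fibre n f) (f ` {..<n})"
proof (rule inj_onI)
  fix v w assume v: "v \<in> f ` {..<n}" and eq: "fibre n f v = fibre n f w"
  from v obtain j where "j < n" "f j = v" by blast
  then have "j \<in> fibre n f w" unfolding eq[symmetric] by simp
  then show "v = w" using \<open>f j = v\<close> by simp
qed

lemma fibres_parts: "fibres n f \<in> parts {..<n}"
  unfolding parts_def mem_Collect_eq
proof (rule partition_onI)
  show "\<Union>(fibres n f) = {..<n}"
    unfolding fibres_def fibre_def by blast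
  show "disjnt p q" if pq: "p \<in> fibres n f" "q \<in> fibres n f" "p \<noteq> q" for p q
  proof -
    obtain v w where vw: "p = fibre n f v" "q = fibre n f w" using pq unfolding fibres_def by blast
    then have "v \<noteq> w" using pq(3) by auto
    then show ?thesis unfolding vw fibre_def disjnt_def by blast
  qed
  show "{} \<notin> fibres n f"
    unfolding fibres_def fibre_def by blast
qed

lemma fibres_cong:
  assumes "\<And>j. j < n \<Longrightarrow> f j = g j"
  shows "fibres n f = fibres n g"
proof -
  have "f ` {..<n} = g ` {..<n}" using assms by (intro image_cong) auto
  moreover have "fibre n f = fibre n g" using assms unfolding fibre_def by (intro ext Collect_cong) auto
  ultimately show ?thesis by (simp add: fibres_def)
qed

abbreviation black_block :: "(int \<times> int) list \<Rightarrow> int \<Rightarrow> nat set" where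
  "black_block xs \<equiv> fibre (length xs) (\<lambda>j. fst (xs ! j))"

abbreviation white_block :: "(int \<times> int) list \<Rightarrow> int \<Rightarrow> nat set" where
  "white_block xs \<equiv> fibre (length xs) (\<lambda>j. snd (xs ! j))"

abbreviation black_partition :: "(int \<times> int) list \<Rightarrow> nat set set" where
  "black_partition xs \<equiv> fibres (length xs) (\<lambda>j. fst (xs ! j))"

abbreviation white_partition :: "(int \<times> int) list \<Rightarrow> nat set set" where
  "white_partition xs \<equiv> fibres (length xs) (\<lambda>j. snd (xs ! j))"

lemma image_set_nth: "g ` set xs = (\<lambda>j. g (xs ! j)) ` {..<length xs}"
proof -
  have "set xs = (!) xs ` {..<length xs}" by (simp add: nth_image lessThan_atLeast0)
  then show ?thesis by (simp only: image_image)
qed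

lemma count_mset_eq_card: "count (mset xs) e = card {j. j < length xs \<and> xs ! j = e}"
proof -
  have "count (mset xs) e = length (filter (\<lambda>x. x = e) xs)"
    by (induction xs) simp_all
  then show ?thesis by (simp add: length_filter_conv_card)
qed

lemma finite_black_white [simp]: "finite (black \<gamma>)" "finite (white \<gamma>)"
  by (simp_all add: black_def white_def)

lemma card_black_white: "card (black \<gamma>) = nblack \<gamma>" "card (white \<gamma>) = nwhite \<gamma>"
  by (simp_all add: black_def white_def)

text \<open>The positions in the list \<open>xs\<close> serve as edge labels; an edge of multiplicity \<open>k\<close> occupies
  \<open>k\<close> positions.\<close>

locale enumerated_graph =
  fixes \<gamma> :: bigraph and xs :: "(int \<times> int) list"
  assumes bipartite: "bipartite_graph \<gamma>" and edges_eq: "mset xs = edges \<gamma>"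
begin

lemma set_xs: "set xs = set_mset (edges \<gamma>)"
  using edges_eq by (metis set_mset_mset)

lemma set_xs_subset: "set xs \<subseteq> black \<gamma> \<times> white \<gamma>"
  using bipartite by (simp add: bipartite_graph_def set_xs)

lemma black_not_white: "v \<in> black \<gamma> \<Longrightarrow> v \<notin> white \<gamma>"
  by (auto simp: black_def white_def)

lemma fst_xs: "j < length xs \<Longrightarrow> fst (xs ! j) \<in> black \<gamma>"
  and snd_xs: "j < length xs \<Longrightarrow> snd (xs ! j) \<in> white \<gamma>"
  using subsetD[OF set_xs_subset nth_mem] by (simp_all only: mem_Times_iff)

text \<open>Positions in \<open>xs\<close> with the same entry are matched with the numbered copies of that edge.\<close>

lemma ex_enumeration:
  "\<exists>p. bij_betw p {..<length xs} (edge_copies \<gamma>) \<and> (\<forall>j. j < length xs \<longrightarrow> fst (p j) = xs ! j)"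
proof -
  have "\<exists>q. bij_betw q {j. j < length xs \<and> xs ! j = e} {..<count (edges \<gamma>) e}" for e
    by (rule finite_same_card_bij) (simp_all add: edges_eq[symmetric] count_mset_eq_card)
  then obtain q where q: "\<And>e. bij_betw (q e) {j. j < length xs \<and> xs ! j = e} {..<count (edges \<gamma>) e}" by metis
  define p where "p j = (xs ! j, q (xs ! j) j)" for j
  have "bij_betw p {..<length xs} (edge_copies \<gamma>)"
    unfolding bij_betw_def
  proof
    show "inj_on p {..<length xs}"
    proof (rule inj_onI)
      fix i j assume ij: "i \<in> {..<length xs}" "j \<in> {..<length xs}" "p i = p j"
      then have "xs ! i = xs ! j" "q (xs ! i) i = q (xs ! i) j" by (auto simp: p_def)
      then show "i = j" using q[of "xs ! i"] ij unfolding bij_betw_def inj_on_def by auto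
    qed
    show "p ` {..<length xs} = edge_copies \<gamma>"
    proof
      show "p ` {..<length xs} \<subseteq> edge_copies \<gamma>"
      proof
        fix x assume "x \<in> p ` {..<length xs}"
        then obtain j where j: "j < length xs" "x = p j" by auto
        then have "q (xs ! j) j \<in> {..<count (edges \<gamma>) (xs ! j)}" using q[of "xs ! j"] unfolding bij_betw_def by blast
        then show "x \<in> edge_copies \<gamma>" by (simp add: j p_def edge_copies_def)
      qed
      show "edge_copies \<gamma> \<subseteq> p ` {..<length xs}"
      proof
        fix x assume x: "x \<in> edge_copies \<gamma>"
        obtain e k where ek: "x = (e, k)" by (cases x)
        have "k \<in> {..<count (edges \<gamma>) e}" using x by (simp add: ek edge_copies_def)
        then have "k \<in> q e ` {j. j < length xs \<and> xs ! j = e}" unfolding bij_betw_imp_surj_on[OF q] .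
        then obtain j where j: "k = q e j" "j \<in> {j. j < length xs \<and> xs ! j = e}" by (rule imageE)
        have "x = p j" using j by (simp add: ek p_def)
        then show "x \<in> p ` {..<length xs}" using j(2) by (intro image_eqI[of _ _ j]) simp_all
      qed
    qed
  qed
  moreover have "\<forall>j. j < length xs \<longrightarrow> fst (p j) = xs ! j" by (simp add: p_def)
  ultimately show ?thesis by blast
qed

lemma attached_black:
  assumes p: "bij_betw p {..<length xs} (edge_copies \<gamma>)" "\<forall>j. j < length xs \<longrightarrow> fst (p j) = xs ! j" and v: "v \<in> black \<gamma>"
  shows "attached \<gamma> v = p ` black_block xs v"
proof -
  have ec: "edge_copies \<gamma> = p ` {..<length xs}" using p(1) by (simp add: bij_betw_def)
  have "attached \<gamma> v = {c \<in> edge_copies \<gamma>. fst (fst c) = v \<or> snd (fst c) = v}"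
    unfolding attached_def by (auto split: prod.splits)
  also have "\<dots> = p ` {j \<in> {..<length xs}. fst (fst (p j)) = v \<or> snd (fst (p j)) = v}"
    unfolding ec by blast
  also have "{j \<in> {..<length xs}. fst (fst (p j)) = v \<or> snd (fst (p j)) = v} = black_block xs v"
    using p(2) snd_xs black_not_white[OF v] by (auto simp: fibre_def)
  finally show ?thesis .
qed

lemma attached_white:
  assumes p: "bij_betw p {..<length xs} (edge_copies \<gamma>)" "\<forall>j. j < length xs \<longrightarrow> fst (p j) = xs ! j" and v: "v \<in> white \<gamma>"
  shows "attached \<gamma> v = p ` white_block xs v"
proof -
  have ec: "edge_copies \<gamma> = p ` {..<length xs}" using p(1) by (simp add: bij_betw_def)
  have "attached \<gamma> v = {c \<in> edge_copies \<gamma>. fst (fst c) = v \<or> snd (fst c) = v}"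
    unfolding attached_def by (auto split: prod.splits)
  also have "\<dots> = p ` {j \<in> {..<length xs}. fst (fst (p j)) = v \<or> snd (fst (p j)) = v}"
    unfolding ec by blast
  also have "{j \<in> {..<length xs}. fst (fst (p j)) = v \<or> snd (fst (p j)) = v} = white_block xs v"
    using p(2) fst_xs black_not_white v by (auto simp: fibre_def)
  finally show ?thesis .
qed

lemma inj_on_blocks:
  assumes "bij_betw p {..<length xs} (edge_copies \<gamma>)"
  shows "inj_on p (black_block xs v)" "inj_on p (white_block xs v)"
  by (rule inj_on_subset[OF bij_betw_imp_inj_on[OF assms] fibre_subset])+

lemma vdeg_black: "v \<in> black \<gamma> \<Longrightarrow> vdeg \<gamma> v = card (black_block xs v)"
proof -
  assume v: "v \<in> black \<gamma>"
  obtain p where p: "bij_betw p {..<length xs} (edge_copies \<gamma>)" "\<forall>j. j < length xs \<longrightarrow> fst (p j) = xs ! j"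
    using ex_enumeration by blast
  show ?thesis unfolding vdeg_def attached_black[OF p v] by (rule card_image[OF inj_on_blocks(1)[OF p(1)]])
qed

lemma edge_list_image:
  assumes p: "bij_betw p {..<length xs} (edge_copies \<gamma>)" and B: "B \<subseteq> {..<length xs}" "attached \<gamma> v = p ` B"
  shows "mset (map a (edge_list \<gamma> v)) = image_mset (a \<circ> p) (mset_set B)"
proof -
  have fin: "finite B" using B finite_subset by blast
  have "\<exists>es. distinct es \<and> set es = attached \<gamma> v"
    using finite_distinct_list[of "attached \<gamma> v"] B fin by auto
  then have es: "distinct (edge_list \<gamma> v)" "set (edge_list \<gamma> v) = attached \<gamma> v"
    unfolding edge_list_def by (metis (mono_tags, lifting) someI_ex)+
  then have "mset (edge_list \<gamma> v) = mset_set (p ` B)" using mset_set_set[OF es(1)] B by simp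
  also have "\<dots> = image_mset p (mset_set B)"
    by (rule image_mset_mset_set[OF inj_on_subset[OF bij_betw_imp_inj_on[OF p] B(1)], symmetric])
  finally show ?thesis by (simp add: multiset.map_comp)
qed

text \<open>Index assignments on edge copies are transported to positions of \<open>xs\<close>. The order of the
  edges in \<open>edge_list\<close> does not matter because coefficients and partial derivatives are
  symmetric.\<close>

lemma pairing_eq:
  fixes S :: "'d::finite list \<Rightarrow> complex" and G :: "real^'d \<Rightarrow> real"
  assumes S: "symmetric_coeffs S" and G: "smooth G"
  shows "pairing S G \<gamma> = (\<Prod>v\<in>black \<gamma>. fact (vdeg \<gamma> v) / (\<Prod>i=1..vdeg \<gamma> v. fact i ^ shared \<gamma> v i)) *
    (\<Sum>a\<in>{..<length xs} \<rightarrow>\<^sub>E UNIV. (\<Prod>v\<in>black \<gamma>. symcoeff S (image_mset a (mset_set (black_block xs v)))) *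
       (\<Prod>w\<in>white \<gamma>. of_real (pd (image_mset a (mset_set (white_block xs w))) G (lin_part S))))"
proof -
  obtain p where p: "bij_betw p {..<length xs} (edge_copies \<gamma>)" "\<forall>j. j < length xs \<longrightarrow> fst (p j) = xs ! j"
    using ex_enumeration by blast
  have ec: "edge_copies \<gamma> = p ` {..<length xs}" and inj: "inj_on p {..<length xs}" using p(1) by (simp_all add: bij_betw_def)
  define K where "K = (\<Prod>v\<in>black \<gamma>. fact (vdeg \<gamma> v) / (\<Prod>i=1..vdeg \<gamma> v. fact i ^ shared \<gamma> v i) :: complex)"
  define F where "F a = (\<Prod>v\<in>black \<gamma>. symcoeff S (image_mset a (mset_set (black_block xs v)))) *
       (\<Prod>w\<in>white \<gamma>. complex_of_real (pd (image_mset a (mset_set (white_block xs w))) G (lin_part S)))" for a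
  have sub: "black_block xs v \<subseteq> {..<length xs}" "white_block xs v \<subseteq> {..<length xs}" for v
    by (rule fibre_subset)+
  have res: "image_mset (restrict (a \<circ> p) {..<length xs}) (mset_set B) = image_mset (a \<circ> p) (mset_set B)" if "B \<subseteq> {..<length xs}" for a :: "(int \<times> int) \<times> nat \<Rightarrow> 'd" and B
    using that finite_subset[OF that] by (intro image_mset_cong) auto
  have "pairing S G \<gamma> = (\<Sum>a\<in>edge_copies \<gamma> \<rightarrow>\<^sub>E UNIV. K * F (restrict (a \<circ> p) {..<length xs}))"
    unfolding pairing_def
  proof (rule sum.cong[OF refl])
    fix a :: "(int \<times> int) \<times> nat \<Rightarrow> 'd"
    have 1: "S (map a (edge_list \<gamma> v)) = symcoeff S (image_mset (restrict (a \<circ> p) {..<length xs}) (mset_set (black_block xs v)))" if "v \<in> black \<gamma>" for v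
      by (simp only: symcoeff_mset[OF S, of "map a (edge_list \<gamma> v)"] edge_list_image[OF p(1) sub(1) attached_black[OF p that]] res[OF sub(1)])
    have 2: "partials (map a (edge_list \<gamma> w)) G = pd (image_mset (restrict (a \<circ> p) {..<length xs}) (mset_set (white_block xs w))) G" if "w \<in> white \<gamma>" for w
      by (simp only: partials_eq_pd[OF G, of "map a (edge_list \<gamma> w)"] edge_list_image[OF p(1) sub(2) attached_white[OF p that]] res[OF sub(2)])
    show "(\<Prod>v\<in>black \<gamma>. fact (vdeg \<gamma> v) / (\<Prod>i=1..vdeg \<gamma> v. fact i ^ shared \<gamma> v i) * S (map a (edge_list \<gamma> v))) *
      (\<Prod>w\<in>white \<gamma>. complex_of_real (partials (map a (edge_list \<gamma> w)) G (lin_part S))) = K * F (restrict (a \<circ> p) {..<length xs})"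
      unfolding K_def F_def prod.distrib by (simp add: 1 2 mult.assoc cong: prod.cong)
  qed
  also have "\<dots> = (\<Sum>b\<in>{..<length xs} \<rightarrow>\<^sub>E UNIV. K * F b)"
    unfolding ec by (rule sum_PiE_bij[OF inj])
  also have "\<dots> = K * (\<Sum>b\<in>{..<length xs} \<rightarrow>\<^sub>E UNIV. F b)" by (simp add: sum_distrib_left)
  finally show ?thesis unfolding K_def F_def .
qed

lemma count_le_vdeg:
  assumes "v \<in> black \<gamma>"
  shows "count (edges \<gamma>) (v, w) \<le> vdeg \<gamma> v"
  unfolding vdeg_black[OF assms] edges_eq[symmetric] count_mset_eq_card
  by (rule card_mono) (auto simp: fibre_def)

text \<open>Grouping the white vertices by the number of edges they share with \<open>v\<close>; those sharing no
  edge contribute \<open>fact 0 = 1\<close>.\<close>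

lemma prod_shared:
  assumes v: "v \<in> black \<gamma>"
  shows "(\<Prod>i=1..vdeg \<gamma> v. fact i ^ shared \<gamma> v i) = (\<Prod>w\<in>white \<gamma>. fact (count (edges \<gamma>) (v, w)) :: complex)"
proof -
  have "(\<Prod>w\<in>white \<gamma>. fact (count (edges \<gamma>) (v, w)) :: complex) =
    (\<Prod>i\<in>{0..vdeg \<gamma> v}. \<Prod>w\<in>{w \<in> white \<gamma>. count (edges \<gamma>) (v, w) = i}. fact (count (edges \<gamma>) (v, w)))"
    using count_le_vdeg[OF v] by (intro prod.group[symmetric]) auto
  also have "\<dots> = (\<Prod>i\<in>{0..vdeg \<gamma> v}. fact i ^ shared \<gamma> v i)"
    by (intro prod.cong refl) (simp add: shared_def)
  also have "\<dots> = (\<Prod>i=1..vdeg \<gamma> v. fact i ^ shared \<gamma> v i)"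
    by (rule prod.mono_neutral_right) (auto simp: Suc_le_eq)
  finally show ?thesis by simp
qed

text \<open>The number of edge enumerations involves the factorials of all multiplicities, and these
  cancel the denominators of the prefactors.\<close>

lemma prod_prefactor:
  "(\<Prod>v\<in>black \<gamma>. fact (vdeg \<gamma> v) / (\<Prod>i=1..vdeg \<gamma> v. fact i ^ shared \<gamma> v i)) * (\<Prod>e\<in>set_mset (edges \<gamma>). fact (count (edges \<gamma>) e)) =
   (\<Prod>v\<in>black \<gamma>. fact (card (black_block xs v)) :: complex)"
proof -
  have "(\<Prod>e\<in>set_mset (edges \<gamma>). fact (count (edges \<gamma>) e) :: complex) = (\<Prod>e\<in>black \<gamma> \<times> white \<gamma>. fact (count (edges \<gamma>) e))"
  proof (rule prod.mono_neutral_left)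
    show "\<forall>e\<in>black \<gamma> \<times> white \<gamma> - set_mset (edges \<gamma>). fact (count (edges \<gamma>) e) = (1 :: complex)"
      by (simp add: not_in_iff)
  qed (use set_xs set_xs_subset in simp_all)
  also have "\<dots> = (\<Prod>v\<in>black \<gamma>. \<Prod>w\<in>white \<gamma>. fact (count (edges \<gamma>) (v, w)))"
    by (simp add: prod.cartesian_product)
  finally have 1: "(\<Prod>e\<in>set_mset (edges \<gamma>). fact (count (edges \<gamma>) e) :: complex) = (\<Prod>v\<in>black \<gamma>. \<Prod>w\<in>white \<gamma>. fact (count (edges \<gamma>) (v, w)))" .
  have cancel: "x / P * P = x" if "P \<noteq> 0" for x P :: complex using that by simp
  have nz: "(\<Prod>w\<in>white \<gamma>. fact (count (edges \<gamma>) (v, w)) :: complex) \<noteq> 0" for v by simp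
  show ?thesis
    unfolding 1 prod.distrib[symmetric]
  proof (rule prod.cong[OF refl])
    fix v assume v: "v \<in> black \<gamma>"
    show "fact (vdeg \<gamma> v) / (\<Prod>i=1..vdeg \<gamma> v. fact i ^ shared \<gamma> v i) * (\<Prod>w\<in>white \<gamma>. fact (count (edges \<gamma>) (v, w))) = (fact (card (black_block xs v)) :: complex)"
      unfolding prod_shared[OF v] unfolding vdeg_black[OF v] by (rule cancel[OF nz])
  qed
qed

end

lemma saturated_fibresD:
  assumes "saturated A (fibres n f)" "j \<in> A" "j < n" "k < n" "f k = f j"
  shows "k \<in> A"
proof -
  have "fibre n f (f j) \<in> fibres n f" using assms(3) by (simp add: fibres_def)
  then have "fibre n f (f j) \<subseteq> A \<or> fibre n f (f j) \<inter> A = {}" using assms(1) unfolding saturated_def by blast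
  moreover have "j \<in> fibre n f (f j)" "k \<in> fibre n f (f j)" using assms by simp_all
  ultimately show ?thesis using assms(2) by blast
qed

lemma saturated_fibresI:
  assumes "\<And>j k. j < n \<Longrightarrow> k < n \<Longrightarrow> f k = f j \<Longrightarrow> j \<in> A \<Longrightarrow> k \<in> A"
  shows "saturated A (fibres n f)"
  unfolding saturated_def
proof
  fix B assume "B \<in> fibres n f"
  then obtain v where B: "B = fibre n f v" unfolding fibres_def by blast
  show "B \<subseteq> A \<or> B \<inter> A = {}"
  proof (cases "B \<inter> A = {}")
    case False
    then obtain j where "j \<in> B" and jA: "j \<in> A" by blast
    then have j: "j < n" "f j = v" unfolding B by simp_all
    have "k \<in> A" if "k \<in> B" for k
    proof -
      from that have k: "k < n" "f k = f j" unfolding B using j(2) by simp_all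
      show ?thesis by (rule assms[OF j(1) k jA])
    qed
    then have "B \<subseteq> A" by blast
    then show ?thesis ..
  next
    case True
    then show ?thesis ..
  qed
qed

section \<open>Connectedness, degree and weight of an enumerated graph\<close>

context enumerated_graph
begin

definition adj :: "(int \<times> int) set" where
  "adj = set_mset (edges \<gamma>) \<union> (set_mset (edges \<gamma>))\<inverse>"

lemma adj_edge: "j < length xs \<Longrightarrow> (fst (xs ! j), snd (xs ! j)) \<in> adj" "j < length xs \<Longrightarrow> (snd (xs ! j), fst (xs ! j)) \<in> adj"
  using nth_mem[of j xs] by (simp_all add: adj_def set_xs[symmetric])

lemma adjE:
  assumes "(x, y) \<in> adj"
  obtains j where "j < length xs" "x = fst (xs ! j)" "y = snd (xs ! j)" | j where "j < length xs" "x = snd (xs ! j)" "y = fst (xs ! j)"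
proof -
  from assms have "(x, y) \<in> set xs \<or> (y, x) \<in> set xs" by (simp add: adj_def set_xs)
  then show thesis
  proof
    assume "(x, y) \<in> set xs"
    then obtain j where j: "j < length xs" "xs ! j = (x, y)" unfolding in_set_conv_nth by blast
    show thesis by (rule that(1)[OF j(1)]) (simp_all add: j(2))
  next
    assume "(y, x) \<in> set xs"
    then obtain j where j: "j < length xs" "xs ! j = (y, x)" unfolding in_set_conv_nth by blast
    show thesis by (rule that(2)[OF j(1)]) (simp_all add: j(2))
  qed
qed

lemma fst_neq_snd: "j < length xs \<Longrightarrow> k < length xs \<Longrightarrow> fst (xs ! j) \<noteq> snd (xs ! k)"
  using fst_xs snd_xs black_not_white by metis

lemma connected_graph_adj:
  "connected_graph \<gamma> \<longleftrightarrow> vertices \<gamma> \<noteq> {} \<and> (\<forall>u\<in>vertices \<gamma>. \<forall>v\<in>vertices \<gamma>. (u, v) \<in> adj\<^sup>*)"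
  by (simp add: connected_graph_def adj_def)

text \<open>A graph with an edge has two vertices, so connectedness excludes isolated vertices.\<close>

lemma connected_imp_incident:
  assumes "connected_graph \<gamma>" "xs \<noteq> []"
  shows "fst ` set xs = black \<gamma>" "snd ` set xs = white \<gamma>"
proof -
  have ne: "0 < length xs" using assms(2) by simp
  have b0: "fst (xs ! 0) \<in> black \<gamma>" and w0: "snd (xs ! 0) \<in> white \<gamma>" using fst_xs snd_xs ne by blast+
  have inc: "\<exists>y. (u, y) \<in> adj" if "u \<in> vertices \<gamma>" "v \<in> vertices \<gamma>" "u \<noteq> v" for u v
  proof -
    have "(u, v) \<in> adj\<^sup>*" using assms(1) that unfolding connected_graph_adj by blast
    then show ?thesis using that(3) by (meson converse_rtranclE)
  qed
  show "fst ` set xs = black \<gamma>"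
  proof
    show "fst ` set xs \<subseteq> black \<gamma>" unfolding image_set_nth using fst_xs by blast
    show "black \<gamma> \<subseteq> fst ` set xs"
    proof
      fix v assume v: "v \<in> black \<gamma>"
      have "v \<noteq> snd (xs ! 0)" using v w0 black_not_white by blast
      then obtain y where "(v, y) \<in> adj" using inc[of v "snd (xs ! 0)"] v w0 by (auto simp: vertices_def)
      then show "v \<in> fst ` set xs"
      proof (rule adjE)
        fix j assume "j < length xs" "v = fst (xs ! j)"
        then show ?thesis by simp
      next
        fix j assume "j < length xs" "v = snd (xs ! j)"
        then show ?thesis using snd_xs[of j] v black_not_white by blast
      qed
    qed
  qed
  show "snd ` set xs = white \<gamma>"
  proof
    show "snd ` set xs \<subseteq> white \<gamma>" unfolding image_set_nth using snd_xs by blast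
    show "white \<gamma> \<subseteq> snd ` set xs"
    proof
      fix v assume v: "v \<in> white \<gamma>"
      have "v \<noteq> fst (xs ! 0)" using v b0 black_not_white by blast
      then obtain y where "(v, y) \<in> adj" using inc[of v "fst (xs ! 0)"] v b0 by (auto simp: vertices_def)
      then show "v \<in> snd ` set xs"
      proof (rule adjE)
        fix j assume "j < length xs" "v = fst (xs ! j)"
        then show ?thesis using fst_xs[of j] v black_not_white by blast
      next
        fix j assume "j < length xs" "v = snd (xs ! j)"
        then show ?thesis by simp
      qed
    qed
  qed
qed

text \<open>A walk cannot leave the set \<open>U\<close> of ends of a saturated set \<open>A\<close> of edges.\<close>

lemma connected_imp_connected_pair:
  assumes "connected_graph \<gamma>"
  shows "connected_pair {..<length xs} (black_partition xs) (white_partition xs)"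
  unfolding connected_pair_def
proof (intro allI impI)
  fix A assume A: "A \<subseteq> {..<length xs}" "A \<noteq> {}" "saturated A (black_partition xs)" "saturated A (white_partition xs)"
  \<comment> \<open>the vertices incident with an edge in \<open>A\<close>\<close>
  define U where "U = (\<lambda>j. fst (xs ! j)) ` A \<union> (\<lambda>j. snd (xs ! j)) ` A"
  have lt: "j < length xs" if "j \<in> A" for j using subsetD[OF A(1) that] by simp
  have inA_b: "k \<in> A" if "k < length xs" "fst (xs ! k) \<in> U" for k
  proof -
    from that(2) obtain j where "j \<in> A" "fst (xs ! k) = fst (xs ! j) \<or> fst (xs ! k) = snd (xs ! j)"
      unfolding U_def by (elim UnE imageE) simp_all
    then have j: "j \<in> A" "fst (xs ! k) = fst (xs ! j)" using fst_neq_snd[OF that(1) lt] by simp_all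
    show ?thesis by (rule saturated_fibresD[OF A(3) j(1) lt[OF j(1)] that(1) j(2)])
  qed
  have inA_w: "k \<in> A" if "k < length xs" "snd (xs ! k) \<in> U" for k
  proof -
    from that(2) obtain j where j': "j \<in> A" "snd (xs ! k) = fst (xs ! j) \<or> snd (xs ! k) = snd (xs ! j)"
      unfolding U_def by (elim UnE imageE) simp_all
    then have j: "j \<in> A" "snd (xs ! k) = snd (xs ! j)" using fst_neq_snd[OF lt[OF j'(1)] that(1)] by simp_all
    show ?thesis by (rule saturated_fibresD[OF A(4) j(1) lt[OF j(1)] that(1) j(2)])
  qed
  have step: "y \<in> U" if "(x, y) \<in> adj" "x \<in> U" for x y
    using that(1)
  proof (rule adjE)
    fix j assume j: "j < length xs" "x = fst (xs ! j)" "y = snd (xs ! j)"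
    then have "j \<in> A" using inA_b that(2) by simp
    then show ?thesis using j(3) unfolding U_def by blast
  next
    fix j assume j: "j < length xs" "x = snd (xs ! j)" "y = fst (xs ! j)"
    then have "j \<in> A" using inA_w that(2) by simp
    then show ?thesis using j(3) unfolding U_def by blast
  qed
  have reach: "y \<in> U" if "(x, y) \<in> adj\<^sup>*" "x \<in> U" for x y
    using that by (induction rule: rtrancl_induct) (use step in blast)+
  obtain j where j: "j \<in> A" using A(2) by blast
  have "k \<in> A" if k: "k < length xs" for k
  proof -
    have "fst (xs ! j) \<in> vertices \<gamma>" "fst (xs ! k) \<in> vertices \<gamma>" using fst_xs lt[OF j] k by (simp_all add: vertices_def)
    then have "(fst (xs ! j), fst (xs ! k)) \<in> adj\<^sup>*" using assms unfolding connected_graph_adj by blast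
    moreover have "fst (xs ! j) \<in> U" using j unfolding U_def by blast
    ultimately show ?thesis using reach inA_b k by blast
  qed
  then show "A = {..<length xs}" using A(1) by blast
qed

text \<open>The edges whose black end is reachable from \<open>u\<close> form a saturated set.\<close>

lemma connected_pair_imp_connected:
  assumes "xs \<noteq> []" and inc: "fst ` set xs = black \<gamma>" "snd ` set xs = white \<gamma>"
    and conn: "connected_pair {..<length xs} (black_partition xs) (white_partition xs)"
  shows "connected_graph \<gamma>"
  unfolding connected_graph_adj
proof (intro conjI ballI)
  have "0 < length xs" using assms(1) by simp
  then show "vertices \<gamma> \<noteq> {}" using fst_xs unfolding vertices_def by blast
  fix u v assume uv: "u \<in> vertices \<gamma>" "v \<in> vertices \<gamma>"
  have inc': "(\<exists>j<length xs. x = fst (xs ! j)) \<or> (\<exists>j<length xs. x = snd (xs ! j))" if "x \<in> vertices \<gamma>" for x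
    using that unfolding vertices_def inc[symmetric] image_set_nth by blast
  \<comment> \<open>the edges in the connected component of \<open>u\<close>\<close>
  define A where "A = {k. k < length xs \<and> (u, fst (xs ! k)) \<in> adj\<^sup>*}"
  have "A = {..<length xs}"
  proof -
    have "A \<noteq> {}"
    proof -
      from inc'[OF uv(1)] show ?thesis
      proof
        assume "\<exists>j<length xs. u = fst (xs ! j)"
        then show ?thesis unfolding A_def by blast
      next
        assume "\<exists>j<length xs. u = snd (xs ! j)"
        then obtain j where "j < length xs" "u = snd (xs ! j)" by blast
        then have "j \<in> A" unfolding A_def using adj_edge(2)[of j] by simp
        then show ?thesis by blast
      qed
    qed
    moreover have "saturated A (black_partition xs)"
      by (rule saturated_fibresI) (simp add: A_def)
    moreover have "saturated A (white_partition xs)"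
    proof (rule saturated_fibresI)
      fix j k assume jk: "j < length xs" "k < length xs" "snd (xs ! k) = snd (xs ! j)" "j \<in> A"
      have "(u, fst (xs ! j)) \<in> adj\<^sup>*" using jk by (simp add: A_def)
      then have "(u, snd (xs ! k)) \<in> adj\<^sup>*" using adj_edge(1)[OF jk(1)] jk(3) by (simp add: rtrancl.rtrancl_into_rtrancl)
      then have "(u, fst (xs ! k)) \<in> adj\<^sup>*" using adj_edge(2)[OF jk(2)] by (rule rtrancl.rtrancl_into_rtrancl)
      then show "k \<in> A" using jk by (simp add: A_def)
    qed
    moreover have "A \<subseteq> {..<length xs}" unfolding A_def by blast
    ultimately show ?thesis using conn unfolding connected_pair_def by blast
  qed
  then have reach: "(u, fst (xs ! k)) \<in> adj\<^sup>*" if "k < length xs" for k using that unfolding A_def by blast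
  from inc'[OF uv(2)] show "(u, v) \<in> adj\<^sup>*"
  proof
    assume "\<exists>j<length xs. v = fst (xs ! j)"
    then show ?thesis using reach by blast
  next
    assume "\<exists>j<length xs. v = snd (xs ! j)"
    then obtain j where j: "j < length xs" "v = snd (xs ! j)" by blast
    show ?thesis unfolding j(2) using reach[OF j(1)] adj_edge(1)[OF j(1)] by (rule rtrancl.rtrancl_into_rtrancl)
  qed
qed

lemma black_partition_eq: "fst ` set xs = black \<gamma> \<Longrightarrow> black_partition xs = black_block xs ` black \<gamma>"
  unfolding fibres_def image_set_nth by (simp only:)

lemma white_partition_eq: "snd ` set xs = white \<gamma> \<Longrightarrow> white_partition xs = white_block xs ` white \<gamma>"
  unfolding fibres_def image_set_nth by (simp only:)

lemma inj_on_black_block: "fst ` set xs = black \<gamma> \<Longrightarrow> inj_on (black_block xs) (black \<gamma>)"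
  using inj_on_fibre[of "length xs" "\<lambda>j. fst (xs ! j)"] unfolding image_set_nth by (simp only:)

lemma inj_on_white_block: "snd ` set xs = white \<gamma> \<Longrightarrow> inj_on (white_block xs) (white \<gamma>)"
  using inj_on_fibre[of "length xs" "\<lambda>j. snd (xs ! j)"] unfolding image_set_nth by (simp only:)

lemma card_black_partition: "fst ` set xs = black \<gamma> \<Longrightarrow> card (black_partition xs) = nblack \<gamma>"
  using black_partition_eq card_image[OF inj_on_black_block] card_black_white(1) by simp

lemma card_white_partition: "snd ` set xs = white \<gamma> \<Longrightarrow> card (white_partition xs) = nwhite \<gamma>"
  using white_partition_eq card_image[OF inj_on_white_block] card_black_white(2) by simp

text \<open>The characterisation by partitions of the edges: no isolated vertices, connectedness, and no
  black vertex of degree 1.\<close>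

theorem Gamma_circ_iff:
  assumes "xs \<noteq> []"
  shows "\<gamma> \<in> Gamma_circ \<longleftrightarrow> fst ` set xs = black \<gamma> \<and> snd ` set xs = white \<gamma> \<and>
    connected_pair {..<length xs} (black_partition xs) (white_partition xs) \<and> (\<forall>B\<in>black_partition xs. 2 \<le> card B)"
proof
  assume g: "\<gamma> \<in> Gamma_circ"
  then have conn: "connected_graph \<gamma>" by (simp add: Gamma_circ_def)
  note inc = connected_imp_incident[OF conn assms]
  have "2 \<le> card (black_block xs v)" if v: "v \<in> black \<gamma>" for v
  proof -
    have "vdeg \<gamma> v \<noteq> 1" using g v black_not_white by (auto simp: Gamma_circ_def vertices_def)
    moreover have "black_block xs v \<noteq> {}" using v unfolding inc(1)[symmetric] image_set_nth fibre_nonempty .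
    then have "card (black_block xs v) \<noteq> 0" by simp
    ultimately show ?thesis using vdeg_black[OF v] by linarith
  qed
  then show "fst ` set xs = black \<gamma> \<and> snd ` set xs = white \<gamma> \<and>
    connected_pair {..<length xs} (black_partition xs) (white_partition xs) \<and> (\<forall>B\<in>black_partition xs. 2 \<le> card B)"
    using inc connected_imp_connected_pair[OF conn] black_partition_eq[OF inc(1)] by simp
next
  assume *: "fst ` set xs = black \<gamma> \<and> snd ` set xs = white \<gamma> \<and>
    connected_pair {..<length xs} (black_partition xs) (white_partition xs) \<and> (\<forall>B\<in>black_partition xs. 2 \<le> card B)"
  then have "connected_graph \<gamma>" using connected_pair_imp_connected[OF assms] by blast
  moreover have "v \<in> white \<gamma>" if "v \<in> vertices \<gamma>" "vdeg \<gamma> v = 1" for v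
  proof (rule ccontr)
    assume "v \<notin> white \<gamma>"
    then have v: "v \<in> black \<gamma>" using that by (simp add: vertices_def)
    have "2 \<le> card (black_block xs v)" using * black_partition_eq v by simp
    then show False using vdeg_black[OF v] that(2) by linarith
  qed
  ultimately show "\<gamma> \<in> Gamma_circ" using bipartite by (simp add: Gamma_circ_def)
qed

lemma sum_card_black_block: "(\<Sum>v\<in>black \<gamma>. card (black_block xs v)) = length xs"
proof -
  have "(\<Sum>v\<in>black \<gamma>. \<Sum>j\<in>{j \<in> {..<length xs}. fst (xs ! j) = v}. 1) = (\<Sum>j\<in>{..<length xs}. (1::nat))"
    by (rule sum.group) (use fst_xs in auto)
  moreover have "{j \<in> {..<length xs}. fst (xs ! j) = v} = black_block xs v" for v by (simp add: fibre_def)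
  ultimately show ?thesis by simp
qed

text \<open>Every edge has a black end, and black vertices do not have degree 1.\<close>

lemma graph_degree_eq:
  assumes "\<gamma> \<in> Gamma_circ" shows "graph_degree \<gamma> = length xs"
proof -
  have "(if vdeg \<gamma> v \<ge> 2 then vdeg \<gamma> v else 0) = card (black_block xs v)" if v: "v \<in> black \<gamma>" for v
  proof -
    have "vdeg \<gamma> v \<noteq> 1" using assms v black_not_white by (auto simp: Gamma_circ_def vertices_def)
    then show ?thesis unfolding vdeg_black[OF v, symmetric] by auto
  qed
  then have "graph_degree \<gamma> = (\<Sum>v\<in>black \<gamma>. card (black_block xs v))"
    unfolding graph_degree_def by (rule sum.cong[OF refl])
  then show ?thesis by (simp only: sum_card_black_block)
qed

text \<open>Every vertex contributes a factor \<open>c = \<i> / h\<close> and every edge a factor \<open>z = 1 / c\<close>. By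
  definition of the Betti number, the product of these factors is \<open>c * z powi betti \<gamma>\<close>.\<close>

lemma pair_weight_eq:
  fixes S :: "'d::finite list \<Rightarrow> complex" and G :: "real^'d \<Rightarrow> real"
  assumes h: "h > 0" and S: "symmetric_coeffs S" and G: "smooth G" and ne: "xs \<noteq> []" and g: "\<gamma> \<in> Gamma_circ"
  shows "pair_weight (black_factor h S) (white_factor h G (lin_part S)) {..<length xs} (black_partition xs) (white_partition xs) =
    \<i> / of_real h * ((of_real h / \<i>) powi betti \<gamma> * pairing S G \<gamma>) * (\<Prod>e\<in>set_mset (edges \<gamma>). fact (count (edges \<gamma>) e))"
proof -
  have inc: "fst ` set xs = black \<gamma>" "snd ` set xs = white \<gamma>" and two: "\<And>B. B \<in> black_partition xs \<Longrightarrow> 2 \<le> card B"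
    using g unfolding Gamma_circ_iff[OF ne] by blast+
  define c where "c = \<i> / complex_of_real h"
  define z where "z = - \<i> * complex_of_real h"
  have c0: "c \<noteq> 0" and cz: "c * z = 1" and z: "of_real h / \<i> = z" using h by (simp_all add: c_def z_def)
  define n where "n = length xs"
  define M where "M a v = image_mset a (mset_set (black_block xs v))" for a :: "nat \<Rightarrow> 'd" and v
  define N where "N a w = image_mset a (mset_set (white_block xs w))" for a :: "nat \<Rightarrow> 'd" and w
  define D where "D = (\<Prod>v\<in>black \<gamma>. fact (card (black_block xs v)) :: complex)"
  have black: "(\<Prod>B\<in>black_partition xs. black_factor h S (image_mset a (mset_set B))) = c ^ nblack \<gamma> * z ^ n * D * (\<Prod>v\<in>black \<gamma>. symcoeff S (M a v))" for a
  proof -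
    have "(\<Prod>B\<in>black_partition xs. black_factor h S (image_mset a (mset_set B))) = (\<Prod>v\<in>black \<gamma>. black_factor h S (M a v))"
      unfolding black_partition_eq[OF inc(1)] M_def prod.reindex[OF inj_on_black_block[OF inc(1)]] by simp
    also have "\<dots> = (\<Prod>v\<in>black \<gamma>. c * (fact (card (black_block xs v)) * (symcoeff S (M a v) * z ^ card (black_block xs v))))"
    proof (rule prod.cong[OF refl])
      fix v assume "v \<in> black \<gamma>"
      then have "2 \<le> card (black_block xs v)" using two black_partition_eq[OF inc(1)] by blast
      then show "black_factor h S (M a v) = c * (fact (card (black_block xs v)) * (symcoeff S (M a v) * z ^ card (black_block xs v)))"
        by (simp add: black_factor_def black_weight_def M_def c_def z_def)
    qed
    also have "\<dots> = c ^ nblack \<gamma> * z ^ n * D * (\<Prod>v\<in>black \<gamma>. symcoeff S (M a v))"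
    proof -
      have "(\<Prod>v\<in>black \<gamma>. z ^ card (black_block xs v)) = z ^ n"
        by (simp only: power_sum[symmetric] sum_card_black_block n_def)
      then show ?thesis unfolding prod.distrib D_def prod_constant card_black_white(1) by (simp only: mult_ac)
    qed
    finally show ?thesis .
  qed
  have white: "(\<Prod>C\<in>white_partition xs. white_factor h G (lin_part S) (image_mset a (mset_set C))) = c ^ nwhite \<gamma> * (\<Prod>w\<in>white \<gamma>. of_real (pd (N a w) G (lin_part S)))" for a
  proof -
    have "(\<Prod>C\<in>white_partition xs. white_factor h G (lin_part S) (image_mset a (mset_set C))) = (\<Prod>w\<in>white \<gamma>. c * of_real (pd (N a w) G (lin_part S)))"
      unfolding white_partition_eq[OF inc(2)] N_def prod.reindex[OF inj_on_white_block[OF inc(2)]] white_factor_def c_def by simp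
    then show ?thesis by (simp add: prod.distrib card_black_white(2))
  qed
  define T where "T = (\<Sum>a\<in>{..<length xs} \<rightarrow>\<^sub>E UNIV. (\<Prod>v\<in>black \<gamma>. symcoeff S (M a v)) * (\<Prod>w\<in>white \<gamma>. complex_of_real (pd (N a w) G (lin_part S))))"
  have "pair_weight (black_factor h S) (white_factor h G (lin_part S)) {..<length xs} (black_partition xs) (white_partition xs) =
     (\<Sum>a\<in>{..<length xs} \<rightarrow>\<^sub>E UNIV. (c ^ nblack \<gamma> * z ^ n * c ^ nwhite \<gamma> * D) * ((\<Prod>v\<in>black \<gamma>. symcoeff S (M a v)) * (\<Prod>w\<in>white \<gamma>. complex_of_real (pd (N a w) G (lin_part S)))))"
    unfolding pair_weight_def black white by (intro sum.cong refl) (simp only: mult_ac)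
  also have "\<dots> = c ^ nblack \<gamma> * z ^ n * c ^ nwhite \<gamma> * D * T" unfolding T_def by (simp add: sum_distrib_left)
  finally have 1: "pair_weight (black_factor h S) (white_factor h G (lin_part S)) {..<length xs} (black_partition xs) (white_partition xs) = c ^ nblack \<gamma> * z ^ n * c ^ nwhite \<gamma> * D * T" .
  have p: "pairing S G \<gamma> = (\<Prod>v\<in>black \<gamma>. fact (vdeg \<gamma> v) / (\<Prod>i=1..vdeg \<gamma> v. fact i ^ shared \<gamma> v i)) * T"
    unfolding T_def M_def N_def by (rule pairing_eq[OF S G])
  have DT: "pairing S G \<gamma> * (\<Prod>e\<in>set_mset (edges \<gamma>). fact (count (edges \<gamma>) e)) = D * T"
    unfolding p D_def prod_prefactor[symmetric] by (simp only: mult_ac)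
  have "c * z powi betti \<gamma> = c ^ nblack \<gamma> * z ^ n * c ^ nwhite \<gamma>"
  proof -
    have z0: "z \<noteq> 0" using cz by auto
    have cinv: "c = inverse z" using cz z0 by (simp add: field_simps)
    have "card (vertices \<gamma>) = nblack \<gamma> + nwhite \<gamma>"
      unfolding vertices_def card_black_white(1)[symmetric] card_black_white(2)[symmetric]
      by (rule card_Un_disjoint) (use black_not_white in auto)
    moreover have "size (edges \<gamma>) = n" unfolding n_def edges_eq[symmetric] by simp
    ultimately have "betti \<gamma> = (int n - int (nblack \<gamma>) - int (nwhite \<gamma>)) + 1" by (simp add: betti_def)
    then have "z powi betti \<gamma> = z ^ n / z ^ nblack \<gamma> / z ^ nwhite \<gamma> * z"
      using z0 by (simp add: power_int_add power_int_diff)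
    then show ?thesis using z0 unfolding cinv by (simp add: divide_inverse power_inverse)
  qed
  then have "c ^ nblack \<gamma> * z ^ n * c ^ nwhite \<gamma> * D * T = c * z powi betti \<gamma> * (D * T)" by (simp only: mult_ac)
  then show ?thesis
    unfolding 1 z c_def[symmetric] by (simp only: DT[symmetric] mult_ac)
qed

end

section \<open>Relabelling vertices\<close>

lemma fibres_eqD:
  assumes eq: "fibres n f = fibres n g" and ij: "i < n" "j < n"
  shows "f i = f j \<longleftrightarrow> g i = g j"
proof -
  have "fibre n f (f i) \<in> fibres n f" unfolding fibres_def using ij by simp
  then have "fibre n f (f i) \<in> fibres n g" unfolding eq .
  then obtain v where v: "fibre n f (f i) = fibre n g v" unfolding fibres_def by blast
  have "i \<in> fibre n f (f i)" using ij by simp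
  then have "g i = v" unfolding v by simp
  have "f i = f j \<longleftrightarrow> j \<in> fibre n f (f i)" using ij by auto
  also have "\<dots> \<longleftrightarrow> g j = v" unfolding v using ij by simp
  also have "\<dots> \<longleftrightarrow> g i = g j" using \<open>g i = v\<close> by auto
  finally show ?thesis .
qed

lemma fibres_comp:
  assumes "inj_on p (f ` {..<n})"
  shows "fibres n (\<lambda>j. p (f j)) = fibres n f"
proof -
  have "fibre n (\<lambda>j. p (f j)) (p v) = fibre n f v" if "v \<in> f ` {..<n}" for v
    using assms that unfolding fibre_def inj_on_def by blast
  then have "(\<lambda>v. fibre n (\<lambda>j. p (f j)) (p v)) ` f ` {..<n} = fibre n f ` f ` {..<n}" by (rule image_cong[OF refl])
  then show ?thesis unfolding fibres_def image_image by simp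
qed

text \<open>A vertex numbering of the blocks is unique up to a permutation of the vertices.\<close>

lemma ex_relabelling:
  assumes eq: "fibres n f = fibres n g" and V: "f ` {..<n} = V" "g ` {..<n} = V"
  shows "\<exists>p. p permutes V \<and> (\<forall>j<n. g j = p (f j))"
proof -
  define p where "p v = (if v \<in> V then g (SOME j. j < n \<and> f j = v) else v)" for v
  have pf: "p (f j) = g j" if j: "j < n" for j
  proof -
    have "f j \<in> V" using V(1) j by blast
    define k where "k = (SOME k. k < n \<and> f k = f j)"
    have k: "k < n \<and> f k = f j" unfolding k_def by (rule someI[of _ j]) (simp add: j)
    then have "g k = g j" using fibres_eqD[OF eq, of k j] j by simp
    then show ?thesis using \<open>f j \<in> V\<close> by (simp add: p_def k_def)
  qed
  have "bij_betw p V V"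
    unfolding bij_betw_def
  proof
    show "inj_on p V"
    proof (rule inj_onI)
      fix v w assume v: "v \<in> V" "w \<in> V" "p v = p w"
      obtain i j where ij: "i < n" "f i = v" "j < n" "f j = w" using v V(1) by blast
      then have "g i = g j" using v(3) pf by metis
      then show "v = w" using fibres_eqD[OF eq ij(1,3)] ij by simp
    qed
    have "p ` V = (\<lambda>j. p (f j)) ` {..<n}" unfolding V(1)[symmetric] image_image ..
    also have "\<dots> = g ` {..<n}" by (rule image_cong[OF refl]) (simp add: pf)
    finally show "p ` V = V" using V(2) by simp
  qed
  then have "p permutes V" by (rule bij_imp_permutes) (simp add: p_def)
  then show ?thesis using pf by (intro exI[of _ p]) simp
qed

text \<open>Every partition with the right number of blocks arises from a vertex numbering.\<close>

lemma ex_labelling: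
  assumes P: "P \<in> parts {..<n}" and V: "finite V" "card V = card P"
  shows "\<exists>f. f ` {..<n} = V \<and> fibres n f = P"
proof -
  have finP: "finite P" by (rule partsD(5)[OF P]) simp
  obtain b where b: "bij_betw b P V" using finite_same_card_bij[OF finP V(1)] V(2) by auto
  have b_inj: "inj_on b P" and b_im: "b ` P = V" using b by (simp_all add: bij_betw_def)
  define f where "f j = b (THE B. B \<in> P \<and> j \<in> B)" for j
  have f: "f j = b B" if "B \<in> P" "j \<in> B" for B j
  proof -
    have "(THE B. B \<in> P \<and> j \<in> B) = B"
    proof (rule the_equality)
      show "B \<in> P \<and> j \<in> B" using that by simp
      show "C = B" if "C \<in> P \<and> j \<in> C" for C using partsD(4)[OF P] that \<open>B \<in> P\<close> \<open>j \<in> B\<close> by blast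
    qed
    then show ?thesis by (simp add: f_def)
  qed
  have im: "f ` {..<n} = V"
  proof
    show "f ` {..<n} \<subseteq> V"
    proof
      fix v assume "v \<in> f ` {..<n}"
      then obtain j where j: "v = f j" "j \<in> {..<n}" by (rule imageE)
      then obtain B where "B \<in> P" "j \<in> B" using partsD(1)[OF P] by blast
      then show "v \<in> V" using f b_im j(1) by blast
    qed
    show "V \<subseteq> f ` {..<n}"
    proof
      fix v assume "v \<in> V"
      then obtain B where B: "B \<in> P" "v = b B" using b_im by blast
      then obtain j where j: "j \<in> B" using partsD(2)[OF P] by blast
      then have "v = f j" using f B by simp
      moreover have "j \<in> {..<n}" using partsD(3)[OF P B(1)] j by blast
      ultimately show "v \<in> f ` {..<n}" by (rule image_eqI)
    qed
  qed
  have fib: "fibre n f (b B) = B" if B: "B \<in> P" for B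
  proof
    show "B \<subseteq> fibre n f (b B)" using f[OF B] partsD(3)[OF P B] by (auto simp: fibre_def)
    show "fibre n f (b B) \<subseteq> B"
    proof
      fix j assume "j \<in> fibre n f (b B)"
      then have j: "j < n" "f j = b B" by simp_all
      then have "j \<in> \<Union>P" unfolding partsD(1)[OF P] by simp
      then obtain C where C: "C \<in> P" "j \<in> C" by blast
      then have "b C = b B" using f j by simp
      then show "j \<in> B" using inj_onD[OF b_inj _ C(1) B] C(2) by blast
    qed
  qed
  have "fibres n f = fibre n f ` b ` P" unfolding fibres_def im b_im ..
  also have "\<dots> = P" using fib by (simp add: image_image)
  finally show ?thesis using im by blast
qed

lemma permutes_eqI:
  assumes "p permutes V" "q permutes V" "\<And>v. v \<in> V \<Longrightarrow> p v = q v"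
  shows "p = q"
proof
  fix v show "p v = q v"
    using assms permutes_not_in[OF assms(1)] permutes_not_in[OF assms(2)] by (cases "v \<in> V") simp_all
qed

definition enumerations :: "nat \<Rightarrow> (bigraph \<times> (int \<times> int) list) set" where
  "enumerations n = {(\<gamma>, xs). \<gamma> \<in> Gamma_circ \<and> mset xs = edges \<gamma> \<and> length xs = n}"

definition relabel :: "(int \<Rightarrow> int) \<Rightarrow> (int \<Rightarrow> int) \<Rightarrow> bigraph \<Rightarrow> bigraph" where
  "relabel p q \<gamma> = \<gamma>\<lparr>edges := image_mset (map_prod p q) (edges \<gamma>)\<rparr>"

lemma relabel_simps [simp]:
  "nblack (relabel p q \<gamma>) = nblack \<gamma>" "nwhite (relabel p q \<gamma>) = nwhite \<gamma>"
  "edges (relabel p q \<gamma>) = image_mset (map_prod p q) (edges \<gamma>)"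
  "black (relabel p q \<gamma>) = black \<gamma>" "white (relabel p q \<gamma>) = white \<gamma>"
  by (simp_all add: relabel_def black_def white_def)

lemma enumerationsD:
  assumes "(\<gamma>, xs) \<in> enumerations n"
  shows "\<gamma> \<in> Gamma_circ" "mset xs = edges \<gamma>" "length xs = n" "enumerated_graph \<gamma> xs"
  using assms by (simp_all add: enumerations_def enumerated_graph_def Gamma_circ_def)

lemma enumerations_Gamma_circ_iff:
  assumes "(\<gamma>, xs) \<in> enumerations n" "n > 0"
  shows "fst ` set xs = black \<gamma>" "snd ` set xs = white \<gamma>"
    "connected_pair {..<n} (black_partition xs) (white_partition xs)" "\<And>B. B \<in> black_partition xs \<Longrightarrow> 2 \<le> card B"
proof -
  note e = enumerationsD[OF assms(1)]
  have ne: "xs \<noteq> []" using e(3) assms(2) by auto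
  show "fst ` set xs = black \<gamma>" "snd ` set xs = white \<gamma>"
    "connected_pair {..<n} (black_partition xs) (white_partition xs)" "\<And>B. B \<in> black_partition xs \<Longrightarrow> 2 \<le> card B"
    using e(1) unfolding enumerated_graph.Gamma_circ_iff[OF e(4) ne] e(3) by blast+
qed

lemma subset_fst_times_snd: "A \<subseteq> fst ` A \<times> snd ` A"
  by (rule subsetI) (simp add: mem_Times_iff)

lemma enumerationsI:
  assumes "set xs \<subseteq> black \<gamma> \<times> white \<gamma>" "mset xs = edges \<gamma>" "length xs = n" "n > 0"
    and "fst ` set xs = black \<gamma>" "snd ` set xs = white \<gamma>"
    "connected_pair {..<n} (black_partition xs) (white_partition xs)" "\<And>B. B \<in> black_partition xs \<Longrightarrow> 2 \<le> card B"
  shows "(\<gamma>, xs) \<in> enumerations n"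
proof -
  have "set_mset (edges \<gamma>) = set xs" unfolding assms(2)[symmetric] by simp
  then have e: "enumerated_graph \<gamma> xs" using assms(1,2) by (simp add: enumerated_graph_def bipartite_graph_def)
  have ne: "xs \<noteq> []" using assms(3,4) by auto
  have "\<gamma> \<in> Gamma_circ" unfolding enumerated_graph.Gamma_circ_iff[OF e ne]
    using assms(5-8) unfolding assms(3)[symmetric] by blast
  then show ?thesis using assms(2,3) by (simp add: enumerations_def)
qed

lemma relabel_partitions:
  assumes "inj_on p (fst ` set xs)" "inj_on q (snd ` set xs)"
  shows "black_partition (map (map_prod p q) xs) = black_partition xs"
    "white_partition (map (map_prod p q) xs) = white_partition xs"
proof -
  have "black_partition (map (map_prod p q) xs) = fibres (length xs) (\<lambda>j. p (fst (xs ! j)))"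
    unfolding length_map by (rule fibres_cong) simp
  also have "\<dots> = black_partition xs" by (rule fibres_comp) (use assms(1) in \<open>simp only: image_set_nth\<close>)
  finally show "black_partition (map (map_prod p q) xs) = black_partition xs" .
  have "white_partition (map (map_prod p q) xs) = fibres (length xs) (\<lambda>j. q (snd (xs ! j)))"
    unfolding length_map by (rule fibres_cong) simp
  also have "\<dots> = white_partition xs" by (rule fibres_comp) (use assms(2) in \<open>simp only: image_set_nth\<close>)
  finally show "white_partition (map (map_prod p q) xs) = white_partition xs" .
qed

lemma relabel_enumerations:
  assumes z: "(\<gamma>, xs) \<in> enumerations n" and n: "n > 0" and p: "p permutes black \<gamma>" and q: "q permutes white \<gamma>"
  shows "(relabel p q \<gamma>, map (map_prod p q) xs) \<in> enumerations n"
    "black_partition (map (map_prod p q) xs) = black_partition xs"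
    "white_partition (map (map_prod p q) xs) = white_partition xs"
proof -
  note e = enumerationsD[OF z] and i = enumerations_Gamma_circ_iff[OF z n]
  have inj: "inj_on p (fst ` set xs)" "inj_on q (snd ` set xs)"
    using permutes_inj_on[OF p] permutes_inj_on[OF q] by blast+
  show parts: "black_partition (map (map_prod p q) xs) = black_partition xs"
    "white_partition (map (map_prod p q) xs) = white_partition xs"
    by (rule relabel_partitions[OF inj])+
  have f: "fst ` set (map (map_prod p q) xs) = p ` fst ` set xs" "snd ` set (map (map_prod p q) xs) = q ` snd ` set xs"
    unfolding set_map image_image by simp_all
  have fs: "fst ` set (map (map_prod p q) xs) = black \<gamma>" "snd ` set (map (map_prod p q) xs) = white \<gamma>"
    unfolding f i(1,2) by (rule permutes_image[OF p], rule permutes_image[OF q])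
  show "(relabel p q \<gamma>, map (map_prod p q) xs) \<in> enumerations n"
  proof (rule enumerationsI)
    show "set (map (map_prod p q) xs) \<subseteq> black (relabel p q \<gamma>) \<times> white (relabel p q \<gamma>)"
      using subset_fst_times_snd[of "set (map (map_prod p q) xs)"] unfolding fs relabel_simps .
    show "mset (map (map_prod p q) xs) = edges (relabel p q \<gamma>)" using e(2) by simp
    show "connected_pair {..<n} (black_partition (map (map_prod p q) xs)) (white_partition (map (map_prod p q) xs))"
      unfolding parts by (rule i(3))
    show "2 \<le> card B" if "B \<in> black_partition (map (map_prod p q) xs)" for B
      using that unfolding parts by (rule i(4))
  qed (use e fs n in simp_all)
qed

section \<open>Counting enumerations\<close>

lemma enumerations_nblack:
  assumes "(\<gamma>, xs) \<in> enumerations n" "n > 0"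
  shows "nblack \<gamma> = card (black_partition xs)" "nwhite \<gamma> = card (white_partition xs)"
proof -
  note e = enumerationsD[OF assms(1)] and i = enumerations_Gamma_circ_iff[OF assms]
  show "nblack \<gamma> = card (black_partition xs)" "nwhite \<gamma> = card (white_partition xs)"
    using enumerated_graph.card_black_partition[OF e(4) i(1)] enumerated_graph.card_white_partition[OF e(4) i(2)] by simp_all
qed

lemma finite_enumerations:
  assumes "n > 0" shows "finite (enumerations n)"
proof -
  let ?g = "\<lambda>xs. (\<lparr>nblack = card (black_partition xs), nwhite = card (white_partition xs), edges = mset xs\<rparr>, xs)"
  let ?L = "{xs. set xs \<subseteq> {1..int n} \<times> {- int n..-1} \<and> length xs = n}"
  have "enumerations n \<subseteq> ?g ` ?L"
  proof
    fix z assume z: "z \<in> enumerations n"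
    obtain \<gamma> xs where zz: "z = (\<gamma>, xs)" by (cases z)
    have e: "(\<gamma>, xs) \<in> enumerations n" using z zz by simp
    note ed = enumerationsD[OF e] and nb = enumerations_nblack[OF e assms] and i = enumerations_Gamma_circ_iff[OF e assms]
    have "\<gamma> = \<lparr>nblack = card (black_partition xs), nwhite = card (white_partition xs), edges = mset xs\<rparr>"
      by (rule bigraph.equality) (simp_all only: nb ed bigraph.simps unit_eq)
    then have "z = ?g xs" using zz by simp
    moreover have "xs \<in> ?L"
    proof -
      have "card (fst ` set xs) \<le> n" "card (snd ` set xs) \<le> n"
        using card_image_le[of "set xs" fst] card_image_le[of "set xs" snd] card_length[of xs] ed(3) by simp_all
      then have "nblack \<gamma> \<le> n" "nwhite \<gamma> \<le> n" unfolding i(1,2) by (simp_all add: black_def white_def)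
      then have "black \<gamma> \<times> white \<gamma> \<subseteq> {1..int n} \<times> {- int n..-1}" by (auto simp: black_def white_def)
      then show ?thesis using enumerated_graph.set_xs_subset[OF ed(4)] ed(3) by blast
    qed
    ultimately show "z \<in> ?g ` ?L" by (rule image_eqI)
  qed
  moreover have "finite ?L" by (rule finite_lists_length_eq) simp
  ultimately show ?thesis by (meson finite_imageI finite_subset)
qed

text \<open>Permutations of the vertices act on the enumerated graphs with given partitions. The action
  is free because no vertex is isolated, and it is transitive because vertex numberings are
  unique up to a permutation.\<close>

lemma card_enumerations_fibre:
  assumes z: "(\<gamma>, xs) \<in> enumerations n" and n: "n > 0"
  shows "card {z \<in> enumerations n. black_partition (snd z) = black_partition xs \<and> white_partition (snd z) = white_partition xs} =
    fact (nblack \<gamma>) * fact (nwhite \<gamma>)"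
proof -
  note e = enumerationsD[OF z] and i = enumerations_Gamma_circ_iff[OF z n] and nb = enumerations_nblack[OF z n]
  let ?P = "{p. p permutes black \<gamma>} \<times> {q. q permutes white \<gamma>}"
  let ?h = "\<lambda>pq. (relabel (fst pq) (snd pq) \<gamma>, map (map_prod (fst pq) (snd pq)) xs)"
  let ?Z = "{z \<in> enumerations n. black_partition (snd z) = black_partition xs \<and> white_partition (snd z) = white_partition xs}"
  have "bij_betw ?h ?P ?Z"
    unfolding bij_betw_def
  proof
    show "inj_on ?h ?P"
    proof (rule inj_onI)
      fix x y assume x: "x \<in> ?P" and y: "y \<in> ?P" and eq: "?h x = ?h y"
      obtain p q p' q' where xy: "x = (p, q)" "y = (p', q')" by (metis prod.collapse)
      have pq: "p permutes black \<gamma>" "q permutes white \<gamma>" "p' permutes black \<gamma>" "q' permutes white \<gamma>"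
        using x y unfolding xy by simp_all
      have m: "p (fst e) = p' (fst e)" "q (snd e) = q' (snd e)" if "e \<in> set xs" for e
      proof -
        have "map_prod p q e = map_prod p' q' e" using eq that unfolding xy by simp
        from arg_cong[OF this, of fst] arg_cong[OF this, of snd]
        show "p (fst e) = p' (fst e)" "q (snd e) = q' (snd e)" by simp_all
      qed
      have "p = p'"
      proof (rule permutes_eqI[OF pq(1,3)])
        fix v assume "v \<in> black \<gamma>"
        then obtain e where "e \<in> set xs" "v = fst e" unfolding i(1)[symmetric] by blast
        then show "p v = p' v" using m(1)[of e] by simp
      qed
      moreover have "q = q'"
      proof (rule permutes_eqI[OF pq(2,4)])
        fix v assume "v \<in> white \<gamma>"
        then obtain e where "e \<in> set xs" "v = snd e" unfolding i(2)[symmetric] by blast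
        then show "q v = q' v" using m(2)[of e] by simp
      qed
      ultimately show "x = y" by (simp add: xy)
    qed
    show "?h ` ?P = ?Z"
    proof
      show "?h ` ?P \<subseteq> ?Z"
      proof
        fix z' assume "z' \<in> ?h ` ?P"
        then obtain x where x: "z' = ?h x" "x \<in> ?P" by (rule imageE)
        have "fst x permutes black \<gamma>" "snd x permutes white \<gamma>" using x(2) by (simp_all add: mem_Times_iff)
        from relabel_enumerations[OF z n this] show "z' \<in> ?Z" unfolding x(1) by simp
      qed
      show "?Z \<subseteq> ?h ` ?P"
      proof
        fix z' assume z': "z' \<in> ?Z"
        obtain \<gamma>' xs' where zz: "z' = (\<gamma>', xs')" by (cases z')
        have e': "(\<gamma>', xs') \<in> enumerations n" and b: "black_partition xs' = black_partition xs" and w: "white_partition xs' = white_partition xs"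
          using z' unfolding zz by simp_all
        note ed' = enumerationsD[OF e'] and i' = enumerations_Gamma_circ_iff[OF e' n] and nb' = enumerations_nblack[OF e' n]
        have nn: "nblack \<gamma>' = nblack \<gamma>" "nwhite \<gamma>' = nwhite \<gamma>" unfolding nb nb' b w by simp_all
        then have bw: "black \<gamma>' = black \<gamma>" "white \<gamma>' = white \<gamma>" by (simp_all add: black_def white_def)
        have b': "fibres n (\<lambda>j. fst (xs ! j)) = fibres n (\<lambda>j. fst (xs' ! j))" and w': "fibres n (\<lambda>j. snd (xs ! j)) = fibres n (\<lambda>j. snd (xs' ! j))"
          using b w unfolding e(3) ed'(3) by simp_all
        have "\<exists>p. p permutes black \<gamma> \<and> (\<forall>j<n. fst (xs' ! j) = p (fst (xs ! j)))"
          by (rule ex_relabelling[OF b']) (use i(1) i'(1) bw e(3) ed'(3) in \<open>simp_all only: image_set_nth\<close>)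
        then obtain p where p: "p permutes black \<gamma>" "\<And>j. j < n \<Longrightarrow> fst (xs' ! j) = p (fst (xs ! j))" by blast
        have "\<exists>q. q permutes white \<gamma> \<and> (\<forall>j<n. snd (xs' ! j) = q (snd (xs ! j)))"
          by (rule ex_relabelling[OF w']) (use i(2) i'(2) bw e(3) ed'(3) in \<open>simp_all only: image_set_nth\<close>)
        then obtain q where q: "q permutes white \<gamma>" "\<And>j. j < n \<Longrightarrow> snd (xs' ! j) = q (snd (xs ! j))" by blast
        have xs': "xs' = map (map_prod p q) xs"
        proof (rule nth_equalityI)
          show "length xs' = length (map (map_prod p q) xs)" using e(3) ed'(3) by simp
          fix j assume "j < length xs'"
          then have j: "j < n" using ed'(3) by simp
          then have "xs' ! j = (p (fst (xs ! j)), q (snd (xs ! j)))" using p(2) q(2) by (simp add: prod_eq_iff)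
          then show "xs' ! j = map (map_prod p q) xs ! j" using j e(3) by (simp add: map_prod_def case_prod_unfold)
        qed
        have "\<gamma>' = relabel p q \<gamma>"
        proof (rule bigraph.equality)
          show "edges \<gamma>' = edges (relabel p q \<gamma>)" using ed'(2) e(2) xs' by simp
        qed (simp_all add: nn)
        then have "z' = ?h (p, q)" using zz xs' by simp
        moreover have "(p, q) \<in> ?P" using p q by simp
        ultimately show "z' \<in> ?h ` ?P" by (rule image_eqI)
      qed
    qed
  qed
  then have "card ?Z = card ?P" by (simp only: bij_betw_same_card[symmetric])
  also have "\<dots> = fact (nblack \<gamma>) * fact (nwhite \<gamma>)"
    unfolding card_cartesian_product
    using card_permutations[OF card_black_white(1)] card_permutations[OF card_black_white(2)]
    by simp
  finally show ?thesis .
qed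

lemma ex_enumeration_of_pair:
  assumes PQ: "(P, Q) \<in> connected_pairs {..<n}" and two: "\<And>B. B \<in> P \<Longrightarrow> 2 \<le> card B" and n: "n > 0"
  shows "\<exists>\<gamma> xs. (\<gamma>, xs) \<in> enumerations n \<and> black_partition xs = P \<and> white_partition xs = Q"
proof -
  have P: "P \<in> parts {..<n}" and Q: "Q \<in> parts {..<n}" and conn: "connected_pair {..<n} P Q"
    using PQ by (simp_all add: connected_pairs_def pairs_def)
  define b w where "b = card P" and "w = card Q"
  obtain f where f: "f ` {..<n} = {1..int b}" "fibres n f = P"
    using ex_labelling[OF P, of "{1..int b}"] by (auto simp: b_def)
  obtain g where g: "g ` {..<n} = {- int w..-1}" "fibres n g = Q"
    using ex_labelling[OF Q, of "{- int w..-1}"] by (auto simp: w_def)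
  define xs where "xs = map (\<lambda>j. (f j, g j)) [0..<n]"
  define \<gamma> where "\<gamma> = \<lparr>nblack = b, nwhite = w, edges = mset xs\<rparr>"
  have len: "length xs = n" by (simp add: xs_def)
  have "fibres n (\<lambda>j. fst (xs ! j)) = fibres n f" "fibres n (\<lambda>j. snd (xs ! j)) = fibres n g" by (rule fibres_cong, simp add: xs_def)+
  then have bp: "black_partition xs = P" "white_partition xs = Q" using f g len by simp_all
  have s: "fst ` set xs = f ` {..<n}" "snd ` set xs = g ` {..<n}"
    unfolding xs_def set_map image_image by (simp_all add: lessThan_atLeast0)
  have bw: "black \<gamma> = {1..int b}" "white \<gamma> = {- int w..-1}" by (simp_all add: \<gamma>_def black_def white_def)
  have "(\<gamma>, xs) \<in> enumerations n"
  proof (rule enumerationsI)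
    show "fst ` set xs = black \<gamma>" "snd ` set xs = white \<gamma>" unfolding s f(1) g(1) bw by (rule refl)+
    then show "set xs \<subseteq> black \<gamma> \<times> white \<gamma>" using subset_fst_times_snd[of "set xs"] by simp
    show "connected_pair {..<n} (black_partition xs) (white_partition xs)" unfolding bp by (rule conn)
    show "2 \<le> card B" if "B \<in> black_partition xs" for B using that unfolding bp by (rule two)
  qed (simp_all add: \<gamma>_def len n)
  then show ?thesis using bp by blast
qed

text \<open>The sum over enumerated graphs is grouped by the pairs of partitions, and every connected
  pair without black blocks of size 1 is hit equally often as the denominator says. The other
  pairs contribute 0.\<close>

theorem sum_enumerations:
  fixes F :: "nat set set \<Rightarrow> nat set set \<Rightarrow> complex"
  assumes n: "n > 0" and F: "\<And>P Q B. B \<in> P \<Longrightarrow> finite P \<Longrightarrow> card B < 2 \<Longrightarrow> F P Q = 0"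
  shows "(\<Sum>z\<in>enumerations n. F (black_partition (snd z)) (white_partition (snd z)) / (fact (nblack (fst z)) * fact (nwhite (fst z)))) =
    (\<Sum>x\<in>connected_pairs {..<n}. F (fst x) (snd x))"
proof -
  let ?C = "{x \<in> connected_pairs {..<n}. \<forall>B\<in>fst x. 2 \<le> card B}"
  let ?k = "\<lambda>z. (black_partition (snd z), white_partition (snd z))"
  let ?G = "\<lambda>z. F (black_partition (snd z)) (white_partition (snd z)) / (fact (nblack (fst z)) * fact (nwhite (fst z)))"
  have finc: "finite (connected_pairs {..<n})"
    by (rule finite_subset[of _ "pairs {..<n}"]) (auto simp: connected_pairs_def)
  have sub: "?k ` enumerations n \<subseteq> ?C"
  proof
    fix x assume "x \<in> ?k ` enumerations n"
    then obtain z where z: "x = ?k z" "z \<in> enumerations n" by (rule imageE)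
    obtain \<gamma> xs where zz: "z = (\<gamma>, xs)" by (cases z)
    have e: "(\<gamma>, xs) \<in> enumerations n" using z zz by simp
    note ed = enumerationsD[OF e] and i = enumerations_Gamma_circ_iff[OF e n]
    have "black_partition xs \<in> parts {..<n}" "white_partition xs \<in> parts {..<n}"
      using fibres_parts[of "length xs"] unfolding ed(3) by blast+
    then show "x \<in> ?C" unfolding z(1) zz using i(3,4) by (simp add: connected_pairs_def pairs_def)
  qed
  have "(\<Sum>z\<in>enumerations n. ?G z) = (\<Sum>x\<in>?C. \<Sum>z\<in>{z \<in> enumerations n. ?k z = x}. ?G z)"
    by (rule sum.group[symmetric, OF finite_enumerations[OF n] _ sub]) (use finc in simp)
  also have "\<dots> = (\<Sum>x\<in>?C. F (fst x) (snd x))"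
  proof (rule sum.cong[OF refl])
    fix x assume x: "x \<in> ?C"
    obtain P Q where xx: "x = (P, Q)" by (cases x)
    obtain \<gamma> xs where e: "(\<gamma>, xs) \<in> enumerations n" and bp: "black_partition xs = P" "white_partition xs = Q"
      using ex_enumeration_of_pair[OF _ _ n, of P Q] x unfolding xx by auto
    have "?G z = F P Q / (fact (nblack \<gamma>) * fact (nwhite \<gamma>))" if z: "z \<in> {z \<in> enumerations n. ?k z = x}" for z
    proof -
      obtain \<gamma>' xs' where zz: "z = (\<gamma>', xs')" by (cases z)
      have e': "(\<gamma>', xs') \<in> enumerations n" and b: "black_partition xs' = P" "white_partition xs' = Q"
        using z unfolding zz xx by simp_all
      have "nblack \<gamma>' = nblack \<gamma>" "nwhite \<gamma>' = nwhite \<gamma>"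
        unfolding enumerations_nblack[OF e' n] enumerations_nblack[OF e n] b bp by simp_all
      then show ?thesis using b by (simp add: zz)
    qed
    then have 1: "(\<Sum>z\<in>{z \<in> enumerations n. ?k z = x}. ?G z) = of_nat (card {z \<in> enumerations n. ?k z = x}) * (F P Q / (fact (nblack \<gamma>) * fact (nwhite \<gamma>)))"
      by simp
    have "{z \<in> enumerations n. ?k z = x} = {z \<in> enumerations n. black_partition (snd z) = black_partition xs \<and> white_partition (snd z) = white_partition xs}"
      unfolding xx bp by simp
    then have "card {z \<in> enumerations n. ?k z = x} = fact (nblack \<gamma>) * fact (nwhite \<gamma>)"
      by (simp only: card_enumerations_fibre[OF e n])
    then show "(\<Sum>z\<in>{z \<in> enumerations n. ?k z = x}. ?G z) = F (fst x) (snd x)"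
      by (subst 1) (simp add: xx)
  qed
  also have "\<dots> = (\<Sum>x\<in>connected_pairs {..<n}. F (fst x) (snd x))"
  proof (rule sum.mono_neutral_left[OF finc])
    show "\<forall>x\<in>connected_pairs {..<n} - ?C. F (fst x) (snd x) = 0"
    proof
      fix x assume x: "x \<in> connected_pairs {..<n} - ?C"
      then obtain B where B: "B \<in> fst x" "\<not> 2 \<le> card B" by blast
      have "fst x \<in> parts {..<n}" using x by (auto simp: connected_pairs_def pairs_def)
      then have "finite (fst x)" by (rule partsD(5)) simp
      then show "F (fst x) (snd x) = 0" using F[OF B(1)] B(2) by simp
    qed
  qed auto
  finally show ?thesis .
qed

section \<open>Isomorphism classes\<close>

lemma count_image_mset_injective:
  assumes "inj f" shows "count (image_mset f M) (f x) = count M x"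
  by (induction M) (simp_all add: inj_eq[OF assms])

lemma bigraph_eqI:
  "nblack \<gamma> = nblack \<gamma>' \<Longrightarrow> nwhite \<gamma> = nwhite \<gamma>' \<Longrightarrow> edges \<gamma> = edges \<gamma>' \<Longrightarrow> \<gamma> = (\<gamma>' :: bigraph)"
  by (rule bigraph.equality) simp_all

lemma isomorphisms_iff:
  assumes "bipartite_graph \<gamma>" "bipartite_graph \<gamma>'"
  shows "(p, q) \<in> isomorphisms \<gamma> \<gamma>' \<longleftrightarrow> p permutes black \<gamma> \<and> q permutes white \<gamma> \<and> \<gamma>' = relabel p q \<gamma>"
proof
  assume iso: "(p, q) \<in> isomorphisms \<gamma> \<gamma>'"
  then have p: "p permutes black \<gamma>" and q: "q permutes white \<gamma>" and n: "nblack \<gamma> = nblack \<gamma>'" "nwhite \<gamma> = nwhite \<gamma>'"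
    and c: "\<And>b w. b \<in> black \<gamma> \<Longrightarrow> w \<in> white \<gamma> \<Longrightarrow> count (edges \<gamma>') (p b, q w) = count (edges \<gamma>) (b, w)"
    by (simp_all add: isomorphisms_def)
  have bw: "black \<gamma>' = black \<gamma>" "white \<gamma>' = white \<gamma>" using n by (simp_all add: black_def white_def)
  have inj: "inj (map_prod p q)" using permutes_inj[OF p] permutes_inj[OF q] by (rule prod.inj_map)
  have "edges \<gamma>' = image_mset (map_prod p q) (edges \<gamma>)"
  proof (rule multiset_eqI)
    fix e
    obtain b w where e: "e = (p b, q w)"
      using permutes_surj[OF p] permutes_surj[OF q] by (metis prod.collapse surjD)
    have r: "count (image_mset (map_prod p q) (edges \<gamma>)) e = count (edges \<gamma>) (b, w)"
      using count_image_mset_injective[OF inj, of "edges \<gamma>" "(b, w)"] by (simp add: e)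
    show "count (edges \<gamma>') e = count (image_mset (map_prod p q) (edges \<gamma>)) e"
    proof (cases "b \<in> black \<gamma> \<and> w \<in> white \<gamma>")
      case True
      then show ?thesis unfolding e r[unfolded e] by (simp add: c)
    next
      case False
      then have "(b, w) \<notin> set_mset (edges \<gamma>)" using assms(1) unfolding bipartite_graph_def by blast
      moreover have "(p b, q w) \<notin> set_mset (edges \<gamma>')"
        using False assms(2) permutes_in_image[OF p] permutes_in_image[OF q] unfolding bipartite_graph_def bw by blast
      ultimately show ?thesis unfolding e r[unfolded e] by (simp add: not_in_iff)
    qed
  qed
  then have "\<gamma>' = relabel p q \<gamma>" using n by (intro bigraph_eqI) simp_all
  then show "p permutes black \<gamma> \<and> q permutes white \<gamma> \<and> \<gamma>' = relabel p q \<gamma>" using p q by blast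
next
  assume *: "p permutes black \<gamma> \<and> q permutes white \<gamma> \<and> \<gamma>' = relabel p q \<gamma>"
  then have inj: "inj (map_prod p q)" using permutes_inj prod.inj_map by blast
  have "count (image_mset (map_prod p q) (edges \<gamma>)) (p b, q w) = count (edges \<gamma>) (b, w)" for b w
    using count_image_mset_injective[OF inj, of "edges \<gamma>" "(b, w)"] by simp
  then show "(p, q) \<in> isomorphisms \<gamma> \<gamma>'" using * by (simp add: isomorphisms_def)
qed

lemma relabel_relabel: "relabel p' q' (relabel p q \<gamma>) = relabel (p' \<circ> p) (q' \<circ> q) \<gamma>"
  by (rule bigraph_eqI) (simp_all add: multiset.map_comp map_prod.comp)

lemma relabel_id: "relabel id id \<gamma> = \<gamma>"
  by (rule bigraph_eqI) (simp_all add: map_prod.id)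

lemma relabel_Gamma_circ:
  assumes g: "\<gamma> \<in> Gamma_circ" and p: "p permutes black \<gamma>" and q: "q permutes white \<gamma>"
  shows "relabel p q \<gamma> \<in> Gamma_circ"
proof (cases "edges \<gamma> = {#}")
  case True
  then have "relabel p q \<gamma> = \<gamma>" by (intro bigraph_eqI) simp_all
  then show ?thesis using g by simp
next
  case False
  obtain xs where xs: "mset xs = edges \<gamma>" using ex_mset by blast
  have "(\<gamma>, xs) \<in> enumerations (length xs)" using g xs by (simp add: enumerations_def)
  moreover have "length xs > 0" using False xs by auto
  ultimately have "(relabel p q \<gamma>, map (map_prod p q) xs) \<in> enumerations (length xs)"
    using relabel_enumerations(1) p q by blast
  then show ?thesis by (rule enumerationsD(1))
qed

lemma Gamma_circ_bipartite: "\<gamma> \<in> Gamma_circ \<Longrightarrow> bipartite_graph \<gamma>"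
  by (simp add: Gamma_circ_def)

definition iso_rel :: "(bigraph \<times> bigraph) set" where
  "iso_rel = {(\<gamma>, \<gamma>'). \<gamma> \<in> Gamma_circ \<and> \<gamma>' \<in> Gamma_circ \<and> isomorphisms \<gamma> \<gamma>' \<noteq> {}}"

definition relabellings :: "bigraph \<Rightarrow> ((int \<Rightarrow> int) \<times> (int \<Rightarrow> int)) set" where
  "relabellings \<gamma> = {p. p permutes black \<gamma>} \<times> {q. q permutes white \<gamma>}"

lemma iso_rel_class:
  assumes "\<gamma> \<in> Gamma_circ"
  shows "iso_rel `` {\<gamma>} = (\<lambda>pq. relabel (fst pq) (snd pq) \<gamma>) ` relabellings \<gamma>"
proof (rule set_eqI)
  fix \<gamma>'
  have "\<gamma>' \<in> iso_rel `` {\<gamma>} \<longleftrightarrow> \<gamma>' \<in> Gamma_circ \<and> (\<exists>p q. (p, q) \<in> isomorphisms \<gamma> \<gamma>')"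
    using assms unfolding iso_rel_def by auto
  also have "\<dots> \<longleftrightarrow> (\<exists>p q. p permutes black \<gamma> \<and> q permutes white \<gamma> \<and> \<gamma>' = relabel p q \<gamma>)"
    using isomorphisms_iff[OF Gamma_circ_bipartite[OF assms] Gamma_circ_bipartite] relabel_Gamma_circ[OF assms] by metis
  also have "\<dots> \<longleftrightarrow> \<gamma>' \<in> (\<lambda>pq. relabel (fst pq) (snd pq) \<gamma>) ` relabellings \<gamma>"
    unfolding relabellings_def by (auto simp: image_iff)
  finally show "\<gamma>' \<in> iso_rel `` {\<gamma>} \<longleftrightarrow> \<gamma>' \<in> (\<lambda>pq. relabel (fst pq) (snd pq) \<gamma>) ` relabellings \<gamma>" .
qed

lemma iso_rel_iff: "(\<gamma>, \<gamma>') \<in> iso_rel \<longleftrightarrow> \<gamma> \<in> Gamma_circ \<and> (\<exists>p q. p permutes black \<gamma> \<and> q permutes white \<gamma> \<and> \<gamma>' = relabel p q \<gamma>)"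
proof (cases "\<gamma> \<in> Gamma_circ")
  case True
  have "(\<gamma>, \<gamma>') \<in> iso_rel \<longleftrightarrow> \<gamma>' \<in> iso_rel `` {\<gamma>}" by simp
  also have "\<dots> \<longleftrightarrow> (\<exists>p q. p permutes black \<gamma> \<and> q permutes white \<gamma> \<and> \<gamma>' = relabel p q \<gamma>)"
    unfolding iso_rel_class[OF True] relabellings_def by (auto simp: image_iff)
  finally show ?thesis using True by simp
qed (simp add: iso_rel_def)

lemma equiv_iso_rel: "equiv Gamma_circ iso_rel"
proof (rule equivI)
  show "iso_rel \<subseteq> Gamma_circ \<times> Gamma_circ" by (auto simp: iso_rel_def)
  show "refl_on Gamma_circ iso_rel"
  proof (rule refl_onI)
    fix \<gamma> assume "\<gamma> \<in> Gamma_circ"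
    then show "(\<gamma>, \<gamma>) \<in> iso_rel"
      unfolding iso_rel_iff using permutes_id relabel_id[of \<gamma>] by (metis (no_types))
  qed
  show "sym iso_rel"
  proof (rule symI)
    fix \<gamma> \<gamma>' assume r: "(\<gamma>, \<gamma>') \<in> iso_rel"
    then obtain p q where pq: "p permutes black \<gamma>" "q permutes white \<gamma>" "\<gamma>' = relabel p q \<gamma>" unfolding iso_rel_iff by blast
    have "relabel (inv p) (inv q) \<gamma>' = \<gamma>"
      unfolding pq(3) relabel_relabel permutes_inv_o(2)[OF pq(1)] permutes_inv_o(2)[OF pq(2)] by (rule relabel_id)
    moreover have "inv p permutes black \<gamma>'" "inv q permutes white \<gamma>'" unfolding pq(3) relabel_simps
      using permutes_inv[OF pq(1)] permutes_inv[OF pq(2)] by simp_all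
    moreover have "\<gamma>' \<in> Gamma_circ" using r by (simp add: iso_rel_def)
    ultimately show "(\<gamma>', \<gamma>) \<in> iso_rel" unfolding iso_rel_iff by metis
  qed
  show "trans iso_rel"
  proof (rule transI)
    fix \<gamma> \<gamma>' \<gamma>'' assume r: "(\<gamma>, \<gamma>') \<in> iso_rel" "(\<gamma>', \<gamma>'') \<in> iso_rel"
    obtain p q where pq: "\<gamma> \<in> Gamma_circ" "p permutes black \<gamma>" "q permutes white \<gamma>" "\<gamma>' = relabel p q \<gamma>"
      using r(1) unfolding iso_rel_iff by blast
    obtain p' q' where pq': "p' permutes black \<gamma>'" "q' permutes white \<gamma>'" "\<gamma>'' = relabel p' q' \<gamma>'"
      using r(2) unfolding iso_rel_iff by blast
    have bw: "p' permutes black \<gamma>" "q' permutes white \<gamma>" using pq'(1,2) unfolding pq(4) relabel_simps by simp_all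
    have "\<gamma>'' = relabel (p' \<circ> p) (q' \<circ> q) \<gamma>" unfolding pq'(3) pq(4) by (rule relabel_relabel)
    moreover have "p' \<circ> p permutes black \<gamma>" "q' \<circ> q permutes white \<gamma>"
      using permutes_compose[OF pq(2) bw(1)] permutes_compose[OF pq(3) bw(2)] by simp_all
    ultimately show "(\<gamma>, \<gamma>'') \<in> iso_rel" unfolding iso_rel_iff using pq(1) by blast
  qed
qed

lemma card_relabellings: "card (relabellings \<gamma>) = fact (nblack \<gamma>) * fact (nwhite \<gamma>)" "finite (relabellings \<gamma>)"
proof -
  show "card (relabellings \<gamma>) = fact (nblack \<gamma>) * fact (nwhite \<gamma>)"
    unfolding relabellings_def card_cartesian_product by (simp add: card_permutations card_black_white)
  show "finite (relabellings \<gamma>)" unfolding relabellings_def by (simp add: finite_permutations)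
qed

text \<open>Orbit counting for the action of the vertex permutations.\<close>

lemma card_iso_class:
  assumes g: "\<gamma> \<in> Gamma_circ"
  shows "card (iso_rel `` {\<gamma>}) * card (automorphisms \<gamma>) = fact (nblack \<gamma>) * fact (nwhite \<gamma>)"
    and "finite (iso_rel `` {\<gamma>})" and "card (automorphisms \<gamma>) > 0"
proof -
  let ?R = "relabellings \<gamma>" and ?f = "\<lambda>pq. relabel (fst pq) (snd pq) \<gamma>"
  note bip = Gamma_circ_bipartite[OF g]
  have aut: "automorphisms \<gamma> = {pq \<in> ?R. ?f pq = \<gamma>}"
  proof (rule set_eqI)
    fix pq :: "(int \<Rightarrow> int) \<times> (int \<Rightarrow> int)"
    obtain p q where pq: "pq = (p, q)" by (cases pq)
    have "pq \<in> automorphisms \<gamma> \<longleftrightarrow> p permutes black \<gamma> \<and> q permutes white \<gamma> \<and> \<gamma> = relabel p q \<gamma>"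
      unfolding pq automorphisms_def by (rule isomorphisms_iff[OF bip bip])
    also have "\<dots> \<longleftrightarrow> (p permutes black \<gamma> \<and> q permutes white \<gamma>) \<and> relabel p q \<gamma> = \<gamma>"
      by (intro iffI conjI; elim conjE; (assumption | (rule sym, assumption)))
    also have "\<dots> \<longleftrightarrow> pq \<in> {pq \<in> ?R. ?f pq = \<gamma>}"
      unfolding pq relabellings_def by (simp only: mem_Collect_eq mem_Times_iff fst_conv snd_conv)
    finally show "pq \<in> automorphisms \<gamma> \<longleftrightarrow> pq \<in> {pq \<in> ?R. ?f pq = \<gamma>}" .
  qed
  have orbit: "card {pq \<in> ?R. ?f pq = \<gamma>'} = card (automorphisms \<gamma>)" if "\<gamma>' \<in> ?f ` ?R" for \<gamma>'
  proof -
    obtain x where x: "\<gamma>' = ?f x" "x \<in> ?R" using \<open>\<gamma>' \<in> ?f ` ?R\<close> by (rule imageE)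
    obtain p0 q0 where x0: "x = (p0, q0)" by (cases x)
    have p0: "p0 permutes black \<gamma>" "q0 permutes white \<gamma>" using x(2) unfolding x0 relabellings_def by simp_all
    let ?h = "\<lambda>pq. (p0 \<circ> fst pq, q0 \<circ> snd pq)" and ?i = "\<lambda>pq. (inv p0 \<circ> fst pq, inv q0 \<circ> snd pq)"
    have c: "inv p0 \<circ> (p0 \<circ> p) = p" "p0 \<circ> (inv p0 \<circ> p) = p" "inv q0 \<circ> (q0 \<circ> p) = p" "q0 \<circ> (inv q0 \<circ> p) = p" for p :: "int \<Rightarrow> int"
      using permutes_inv_o[OF p0(1)] permutes_inv_o[OF p0(2)] by (simp_all add: o_assoc)
    have mem: "?h pq \<in> ?R" "?i pq \<in> ?R" if "pq \<in> ?R" for pq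
      using that p0 permutes_inv[OF p0(1)] permutes_inv[OF p0(2)] unfolding relabellings_def
      by (auto intro!: permutes_compose)
    have fh: "?f (?h pq) = relabel p0 q0 (?f pq)" for pq by (simp add: relabel_relabel)
    have fi: "?f (?i pq) = relabel (inv p0) (inv q0) (?f pq)" for pq by (simp add: relabel_relabel)
    have undo: "relabel (inv p0) (inv q0) \<gamma>' = \<gamma>"
      unfolding x(1) x0 fst_conv snd_conv relabel_relabel permutes_inv_o(2)[OF p0(1)] permutes_inv_o(2)[OF p0(2)] by (rule relabel_id)
    have "bij_betw ?h {pq \<in> ?R. ?f pq = \<gamma>} {pq \<in> ?R. ?f pq = \<gamma>'}"
    proof (rule bij_betw_byWitness[where f'="?i"])
      show "\<forall>pq\<in>{pq \<in> ?R. ?f pq = \<gamma>}. ?i (?h pq) = pq" by (simp add: c)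
      show "\<forall>pq\<in>{pq \<in> ?R. ?f pq = \<gamma>'}. ?h (?i pq) = pq" by (simp add: c)
      show "?h ` {pq \<in> ?R. ?f pq = \<gamma>} \<subseteq> {pq \<in> ?R. ?f pq = \<gamma>'}"
      proof
        fix y assume "y \<in> ?h ` {pq \<in> ?R. ?f pq = \<gamma>}"
        then obtain pq where y: "y = ?h pq" and pq: "pq \<in> {pq \<in> ?R. ?f pq = \<gamma>}" by (rule imageE)
        have "?f y = \<gamma>'" unfolding y fh using pq by (simp add: x(1) x0)
        moreover have "y \<in> ?R" unfolding y using mem(1) pq by blast
        ultimately show "y \<in> {pq \<in> ?R. ?f pq = \<gamma>'}" by blast
      qed
      show "?i ` {pq \<in> ?R. ?f pq = \<gamma>'} \<subseteq> {pq \<in> ?R. ?f pq = \<gamma>}"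
      proof
        fix y assume "y \<in> ?i ` {pq \<in> ?R. ?f pq = \<gamma>'}"
        then obtain pq where y: "y = ?i pq" and pq: "pq \<in> {pq \<in> ?R. ?f pq = \<gamma>'}" by (rule imageE)
        have "?f pq = \<gamma>'" using pq by blast
        then have "?f y = \<gamma>" unfolding y fi by (simp only: undo)
        moreover have "y \<in> ?R" unfolding y using mem(2) pq by blast
        ultimately show "y \<in> {pq \<in> ?R. ?f pq = \<gamma>}" by blast
      qed
    qed
    then show ?thesis unfolding aut by (rule bij_betw_same_card[symmetric])
  qed
  have "card ?R = (\<Sum>\<gamma>'\<in>?f ` ?R. \<Sum>pq\<in>{pq \<in> ?R. ?f pq = \<gamma>'}. 1)"
    unfolding card_eq_sum by (rule sum.image_gen[OF card_relabellings(2)])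
  also have "\<dots> = (\<Sum>\<gamma>'\<in>?f ` ?R. card (automorphisms \<gamma>))" by (intro sum.cong refl) (simp add: orbit)
  finally show "card (iso_rel `` {\<gamma>}) * card (automorphisms \<gamma>) = fact (nblack \<gamma>) * fact (nwhite \<gamma>)"
    unfolding card_relabellings(1) iso_rel_class[OF g] by simp
  show "finite (iso_rel `` {\<gamma>})" unfolding iso_rel_class[OF g] using card_relabellings(2) by (rule finite_imageI)
  have "finite (automorphisms \<gamma>)" unfolding aut using card_relabellings(2) by (rule rev_finite_subset) blast
  moreover have "(id, id) \<in> automorphisms \<gamma>" unfolding automorphisms_def isomorphisms_iff[OF bip bip] using permutes_id relabel_id by metis
  ultimately show "card (automorphisms \<gamma>) > 0" unfolding card_gt_0_iff by blast
qed

lemma graph_degree_size: "\<gamma> \<in> Gamma_circ \<Longrightarrow> graph_degree \<gamma> = size (edges \<gamma>)"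
proof -
  assume g: "\<gamma> \<in> Gamma_circ"
  obtain xs where xs: "mset xs = edges \<gamma>" using ex_mset by blast
  have "enumerated_graph \<gamma> xs" using g xs by (simp add: enumerated_graph_def Gamma_circ_def)
  then have "graph_degree \<gamma> = length xs" using g by (rule enumerated_graph.graph_degree_eq)
  then show ?thesis unfolding xs[symmetric] by simp
qed

lemma Gamma_circ_classes_eq: "Gamma_circ_classes = Gamma_circ // iso_rel"
  by (simp add: Gamma_circ_classes_def iso_rel_def)

lemma class_representative:
  assumes "c \<in> Gamma_circ_classes"
  shows "(SOME \<gamma>. \<gamma> \<in> c) \<in> Gamma_circ" "iso_rel `` {SOME \<gamma>. \<gamma> \<in> c} = c"
proof -
  obtain \<gamma> where g: "\<gamma> \<in> Gamma_circ" "c = iso_rel `` {\<gamma>}" using assms unfolding Gamma_circ_classes_eq by (rule quotientE)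
  have "\<gamma> \<in> c" unfolding g(2) using equiv_class_self[OF equiv_iso_rel g(1)] .
  then have s: "(SOME \<gamma>. \<gamma> \<in> c) \<in> c" by (rule someI)
  then have r: "(\<gamma>, SOME \<gamma>. \<gamma> \<in> c) \<in> iso_rel" by (simp add: g(2))
  then show "(SOME \<gamma>. \<gamma> \<in> c) \<in> Gamma_circ" by (simp add: iso_rel_def)
  show "iso_rel `` {SOME \<gamma>. \<gamma> \<in> c} = c"
    by (rule trans[OF sym[OF equiv_class_eq[OF equiv_iso_rel r]] sym[OF g(2)]])
qed

definition graphs_of_degree :: "nat \<Rightarrow> bigraph set" where
  "graphs_of_degree n = {\<gamma> \<in> Gamma_circ. size (edges \<gamma>) = n}"

lemma finite_graphs_of_degree:
  assumes "n > 0" shows "finite (graphs_of_degree n)"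
proof -
  have "graphs_of_degree n \<subseteq> fst ` enumerations n"
  proof
    fix \<gamma> assume g: "\<gamma> \<in> graphs_of_degree n"
    obtain xs where xs: "mset xs = edges \<gamma>" using ex_mset by blast
    then have "length xs = n" using g unfolding graphs_of_degree_def by (metis (mono_tags, lifting) mem_Collect_eq size_mset)
    then have "(\<gamma>, xs) \<in> enumerations n" using g xs by (simp add: enumerations_def graphs_of_degree_def)
    then show "\<gamma> \<in> fst ` enumerations n" by (rule image_eqI[rotated]) simp
  qed
  then show ?thesis using finite_enumerations[OF assms] finite_subset by blast
qed

lemma iso_rel_graphs_of_degree:
  assumes "(\<gamma>, \<gamma>') \<in> iso_rel"
  shows "size (edges \<gamma>') = size (edges \<gamma>)" "nblack \<gamma>' = nblack \<gamma>" "nwhite \<gamma>' = nwhite \<gamma>"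
  using assms unfolding iso_rel_iff by auto

text \<open>By orbit counting, a class has \<open>nblack! nwhite! / |sym|\<close> members, and \<open>F\<close> is constant on it.\<close>

theorem sum_graphs_eq_labelled:
  assumes n: "n > 0" and F: "\<And>\<gamma> \<gamma>'. (\<gamma>, \<gamma>') \<in> iso_rel \<Longrightarrow> size (edges \<gamma>) = n \<Longrightarrow> F \<gamma>' = F \<gamma>"
  shows "sum_graphs (\<lambda>\<gamma>. 1 / of_nat (card (automorphisms \<gamma>)) * F \<gamma>) $ n =
    (\<Sum>\<gamma>\<in>graphs_of_degree n. F \<gamma> / (fact (nblack \<gamma>) * fact (nwhite \<gamma>)))"
proof -
  define rep where "rep c = (SOME \<gamma>. \<gamma> \<in> c)" for c :: "bigraph set"
  define C where "C = {c \<in> Gamma_circ_classes. graph_degree (rep c) = n}"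
  let ?g = "\<lambda>\<gamma>. F \<gamma> / (fact (nblack \<gamma>) * fact (nwhite \<gamma>))"
  have rep: "rep c \<in> graphs_of_degree n" "iso_rel `` {rep c} = c" if "c \<in> C" for c
  proof -
    have c: "c \<in> Gamma_circ_classes" "graph_degree (rep c) = n" using that by (simp_all only: C_def mem_Collect_eq)
    note r = class_representative[OF c(1), folded rep_def]
    show "rep c \<in> graphs_of_degree n" using r(1) graph_degree_size[OF r(1)] c(2) by (simp add: graphs_of_degree_def)
    show "iso_rel `` {rep c} = c" by (rule r(2))
  qed
  have im: "(\<lambda>\<gamma>. iso_rel `` {\<gamma>}) ` graphs_of_degree n = C"
  proof
    show "C \<subseteq> (\<lambda>\<gamma>. iso_rel `` {\<gamma>}) ` graphs_of_degree n"
    proof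
      fix c assume "c \<in> C"
      from rep[OF this] show "c \<in> (\<lambda>\<gamma>. iso_rel `` {\<gamma>}) ` graphs_of_degree n" by (intro image_eqI[of _ _ "rep c"]) simp_all
    qed
    show "(\<lambda>\<gamma>. iso_rel `` {\<gamma>}) ` graphs_of_degree n \<subseteq> C"
    proof
      fix c assume "c \<in> (\<lambda>\<gamma>. iso_rel `` {\<gamma>}) ` graphs_of_degree n"
      then obtain \<gamma> where c: "c = iso_rel `` {\<gamma>}" and g: "\<gamma> \<in> graphs_of_degree n" by (rule imageE)
      have g': "\<gamma> \<in> Gamma_circ" "size (edges \<gamma>) = n" using g by (simp_all add: graphs_of_degree_def)
      have cc: "c \<in> Gamma_circ_classes" unfolding Gamma_circ_classes_eq c by (rule quotientI[OF g'(1)])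
      note r = class_representative[OF cc, folded rep_def]
      have "rep c \<in> iso_rel `` {rep c}" by (rule equiv_class_self[OF equiv_iso_rel r(1)])
      then have "(\<gamma>, rep c) \<in> iso_rel" unfolding r(2) by (simp add: c)
      then have "size (edges (rep c)) = n" using iso_rel_graphs_of_degree(1) g'(2) by simp
      then show "c \<in> C" using cc graph_degree_size[OF r(1)] by (simp add: C_def)
    qed
  qed
  have "sum_graphs (\<lambda>\<gamma>. 1 / of_nat (card (automorphisms \<gamma>)) * F \<gamma>) $ n = (\<Sum>c\<in>C. 1 / of_nat (card (automorphisms (rep c))) * F (rep c))"
    by (simp add: sum_graphs_def C_def rep_def)
  also have "\<dots> = (\<Sum>c\<in>C. \<Sum>\<gamma>\<in>{\<gamma> \<in> graphs_of_degree n. iso_rel `` {\<gamma>} = c}. ?g \<gamma>)"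
  proof (rule sum.cong[OF refl])
    fix c assume c: "c \<in> C"
    note r = rep[OF c]
    have rg: "rep c \<in> Gamma_circ" "size (edges (rep c)) = n" using r(1) by (simp_all add: graphs_of_degree_def)
    have eq: "{\<gamma> \<in> graphs_of_degree n. iso_rel `` {\<gamma>} = c} = c"
    proof
      show "{\<gamma> \<in> graphs_of_degree n. iso_rel `` {\<gamma>} = c} \<subseteq> c"
        using equiv_class_self[OF equiv_iso_rel] unfolding graphs_of_degree_def by blast
      show "c \<subseteq> {\<gamma> \<in> graphs_of_degree n. iso_rel `` {\<gamma>} = c}"
      proof
        fix \<gamma> assume "\<gamma> \<in> c"
        then have i: "(rep c, \<gamma>) \<in> iso_rel" using r(2) by blast
        have "iso_rel `` {\<gamma>} = c" using equiv_class_eq[OF equiv_iso_rel i] r(2) by simp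
        moreover have "\<gamma> \<in> Gamma_circ" using i by (simp add: iso_rel_def)
        ultimately show "\<gamma> \<in> {\<gamma> \<in> graphs_of_degree n. iso_rel `` {\<gamma>} = c}"
          using iso_rel_graphs_of_degree(1)[OF i] rg(2) by (simp add: graphs_of_degree_def)
      qed
    qed
    have "?g \<gamma> = ?g (rep c)" if "\<gamma> \<in> c" for \<gamma>
    proof -
      have i: "(rep c, \<gamma>) \<in> iso_rel" using r(2) that by blast
      show ?thesis using iso_rel_graphs_of_degree[OF i] F[OF i rg(2)] by simp
    qed
    then have "(\<Sum>\<gamma>\<in>c. ?g \<gamma>) = of_nat (card c) * ?g (rep c)" by simp
    also have "\<dots> = 1 / of_nat (card (automorphisms (rep c))) * F (rep c)"
    proof -
      note k = card_iso_class[OF rg(1), unfolded r(2)]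
      have "(fact (nblack (rep c)) * fact (nwhite (rep c)) :: complex) = of_nat (card c) * of_nat (card (automorphisms (rep c)))"
        using arg_cong[OF k(1), of "of_nat :: nat \<Rightarrow> complex"] by simp
      moreover have "(of_nat (card c) :: complex) \<noteq> 0"
      proof
        assume "(of_nat (card c) :: complex) = 0"
        then have "card c = 0" by simp
        then show False using k(1) by simp
      qed
      ultimately show ?thesis by simp
    qed
    finally show "1 / of_nat (card (automorphisms (rep c))) * F (rep c) = (\<Sum>\<gamma>\<in>{\<gamma> \<in> graphs_of_degree n. iso_rel `` {\<gamma>} = c}. ?g \<gamma>)"
      unfolding eq by simp
  qed
  also have "\<dots> = (\<Sum>\<gamma>\<in>graphs_of_degree n. ?g \<gamma>)"
    unfolding im[symmetric] by (rule sum.image_gen[OF finite_graphs_of_degree[OF n], symmetric])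
  finally show ?thesis .
qed

section \<open>Graphs without edges\<close>

definition black_vertex :: bigraph where
  "black_vertex = \<lparr>nblack = 1, nwhite = 0, edges = {#}\<rparr>"

definition white_vertex :: bigraph where
  "white_vertex = \<lparr>nblack = 0, nwhite = 1, edges = {#}\<rparr>"

lemma graphs_of_degree_0: "graphs_of_degree 0 = {black_vertex, white_vertex}"
proof
  show "graphs_of_degree 0 \<subseteq> {black_vertex, white_vertex}"
  proof
    fix \<gamma> assume "\<gamma> \<in> graphs_of_degree 0"
    then have g: "\<gamma> \<in> Gamma_circ" and e: "edges \<gamma> = {#}" by (simp_all add: graphs_of_degree_def)
    have conn: "connected_graph \<gamma>" using g by (simp add: Gamma_circ_def)
    then have ne: "vertices \<gamma> \<noteq> {}" and eq: "\<And>u v. u \<in> vertices \<gamma> \<Longrightarrow> v \<in> vertices \<gamma> \<Longrightarrow> u = v"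
      by (simp_all add: connected_graph_def e)
    obtain v where "v \<in> vertices \<gamma>" using ne by blast
    then have "vertices \<gamma> = {v}" using eq by blast
    then have "card (vertices \<gamma>) = 1" by simp
    moreover have "card (vertices \<gamma>) = nblack \<gamma> + nwhite \<gamma>"
    proof -
      have "black \<gamma> \<inter> white \<gamma> = {}" by (auto simp: black_def white_def)
      then show ?thesis unfolding vertices_def by (subst card_Un_disjoint) (simp_all add: black_def white_def)
    qed
    ultimately have "(nblack \<gamma> = 1 \<and> nwhite \<gamma> = 0) \<or> (nblack \<gamma> = 0 \<and> nwhite \<gamma> = 1)" by linarith
    then have "\<gamma> = black_vertex \<or> \<gamma> = white_vertex"
      using e by (auto intro!: bigraph_eqI simp: black_vertex_def white_vertex_def)
    then show "\<gamma> \<in> {black_vertex, white_vertex}" by simp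
  qed
  have v: "vertices black_vertex = {1}" "vertices white_vertex = {-1}"
    by (auto simp: black_vertex_def white_vertex_def vertices_def black_def white_def)
  have mem: "\<gamma> \<in> graphs_of_degree 0" if e: "edges \<gamma> = {#}" and v: "vertices \<gamma> = {v}" for \<gamma> v
  proof -
    have "attached \<gamma> x = {}" for x by (simp add: attached_def edge_copies_def e)
    then have "vdeg \<gamma> x = 0" for x by (simp add: vdeg_def)
    then show ?thesis
      by (simp add: graphs_of_degree_def Gamma_circ_def connected_graph_def bipartite_graph_def e v)
  qed
  have "edges black_vertex = {#}" "edges white_vertex = {#}" by (simp_all add: black_vertex_def white_vertex_def)
  then show "{black_vertex, white_vertex} \<subseteq> graphs_of_degree 0" using mem v by simp
qed

lemma relabel_edgeless: "edges \<gamma> = {#} \<Longrightarrow> relabel p q \<gamma> = \<gamma>"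
  by (rule bigraph_eqI) simp_all

lemma iso_class_edgeless:
  assumes "\<gamma> \<in> graphs_of_degree 0" shows "iso_rel `` {\<gamma>} = {\<gamma>}"
proof -
  have g: "\<gamma> \<in> Gamma_circ" and e: "edges \<gamma> = {#}" using assms by (simp_all add: graphs_of_degree_def)
  have "relabellings \<gamma> \<noteq> {}" unfolding relabellings_def using permutes_id by blast
  then show ?thesis unfolding iso_rel_class[OF g] relabel_edgeless[OF e] by (simp add: image_constant_conv)
qed

lemma card_automorphisms_edgeless:
  assumes "\<gamma> \<in> graphs_of_degree 0" shows "card (automorphisms \<gamma>) = 1"
proof -
  have g: "\<gamma> \<in> Gamma_circ" using assms by (simp add: graphs_of_degree_def)
  have "nblack \<gamma> \<le> 1" "nwhite \<gamma> \<le> 1" using assms unfolding graphs_of_degree_0 by (auto simp: black_vertex_def white_vertex_def)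
  then have "fact (nblack \<gamma>) = (1::nat)" "fact (nwhite \<gamma>) = (1::nat)" by (auto simp: le_Suc_eq)
  then show ?thesis using card_iso_class(1)[OF g] unfolding iso_class_edgeless[OF assms] by simp
qed

lemma sum_graphs_nth_0: "sum_graphs F $ 0 = F black_vertex + F white_vertex"
proof -
  have "{c \<in> Gamma_circ_classes. graph_degree (SOME \<gamma>. \<gamma> \<in> c) = 0} = {{black_vertex}, {white_vertex}}"
  proof
    show "{c \<in> Gamma_circ_classes. graph_degree (SOME \<gamma>. \<gamma> \<in> c) = 0} \<subseteq> {{black_vertex}, {white_vertex}}"
    proof
      fix c assume c: "c \<in> {c \<in> Gamma_circ_classes. graph_degree (SOME \<gamma>. \<gamma> \<in> c) = 0}"
      then have cc: "c \<in> Gamma_circ_classes" by blast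
      note r = class_representative[OF cc]
      have "(SOME \<gamma>. \<gamma> \<in> c) \<in> graphs_of_degree 0"
        using r(1) c graph_degree_size[OF r(1)] by (simp add: graphs_of_degree_def)
      then show "c \<in> {{black_vertex}, {white_vertex}}"
        using iso_class_edgeless r(2) unfolding graphs_of_degree_0 by auto
    qed
    show "{{black_vertex}, {white_vertex}} \<subseteq> {c \<in> Gamma_circ_classes. graph_degree (SOME \<gamma>. \<gamma> \<in> c) = 0}"
    proof
      fix c assume "c \<in> {{black_vertex}, {white_vertex}}"
      then obtain \<gamma> where c: "c = {\<gamma>}" and "\<gamma> \<in> graphs_of_degree 0" unfolding graphs_of_degree_0 by blast
      then have g: "\<gamma> \<in> graphs_of_degree 0" "\<gamma> \<in> Gamma_circ" by (simp_all add: graphs_of_degree_def)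
      have "c \<in> Gamma_circ_classes"
        unfolding Gamma_circ_classes_eq c using quotientI[OF g(2), of iso_rel] unfolding iso_class_edgeless[OF g(1)] .
      moreover have "graph_degree (SOME \<gamma>. \<gamma> \<in> c) = 0" using graph_degree_size[OF g(2)] g(1) by (simp add: c graphs_of_degree_def)
      ultimately show "c \<in> {c \<in> Gamma_circ_classes. graph_degree (SOME \<gamma>. \<gamma> \<in> c) = 0}" by blast
    qed
  qed
  moreover have "black_vertex \<noteq> white_vertex" by (simp add: black_vertex_def white_vertex_def)
  ultimately show ?thesis by (simp add: sum_graphs_def)
qed

lemma pairing_edgeless:
  fixes S :: "'d::finite list \<Rightarrow> complex" and G :: "real^'d \<Rightarrow> real"
  assumes S: "symmetric_coeffs S" and G: "smooth G" and g: "\<gamma> \<in> graphs_of_degree 0"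
  shows "pairing S G \<gamma> = S [] ^ nblack \<gamma> * of_real (G (lin_part S)) ^ nwhite \<gamma>"
proof -
  have e: "enumerated_graph \<gamma> []" using g by (simp add: enumerated_graph_def graphs_of_degree_def Gamma_circ_def)
  have f: "fibre 0 f v = {}" for f :: "nat \<Rightarrow> int" and v by (simp add: fibre_def)
  have v: "vdeg \<gamma> v = 0" if "v \<in> black \<gamma>" for v
    using enumerated_graph.vdeg_black[OF e that] by (simp add: f)
  have "symcoeff S {#} = S []" using symcoeff_mset[OF S, of "[]"] by simp
  then show ?thesis
    unfolding enumerated_graph.pairing_eq[OF e S G] by (simp add: v f card_black_white cong: prod.cong)
qed

section \<open>The sum over connected graphs\<close>

text \<open>The enumerations of a graph are the arrangements of its multiset of edges.\<close>

lemma sum_enumerations_eq_sum_graphs: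
  fixes K :: "bigraph \<Rightarrow> complex"
  assumes n: "n > 0"
  shows "(\<Sum>z\<in>enumerations n. K (fst z)) = (\<Sum>\<gamma>\<in>graphs_of_degree n. of_nat (card (permutations_of_multiset (edges \<gamma>))) * K \<gamma>)"
proof -
  have "enumerations n = Sigma (graphs_of_degree n) (\<lambda>\<gamma>. permutations_of_multiset (edges \<gamma>))"
  proof (rule set_eqI)
    fix z :: "bigraph \<times> (int \<times> int) list"
    obtain \<gamma> xs where z: "z = (\<gamma>, xs)" by (cases z)
    have "size (edges \<gamma>) = length xs" if "mset xs = edges \<gamma>" using that by (metis size_mset)
    then show "z \<in> enumerations n \<longleftrightarrow> z \<in> Sigma (graphs_of_degree n) (\<lambda>\<gamma>. permutations_of_multiset (edges \<gamma>))"
      unfolding z enumerations_def graphs_of_degree_def permutations_of_multiset_def by auto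
  qed
  then have "(\<Sum>z\<in>enumerations n. K (fst z)) = (\<Sum>\<gamma>\<in>graphs_of_degree n. \<Sum>xs\<in>permutations_of_multiset (edges \<gamma>). K \<gamma>)"
    using sum.Sigma[OF finite_graphs_of_degree[OF n], of "\<lambda>\<gamma>. permutations_of_multiset (edges \<gamma>)" "\<lambda>\<gamma> xs. K \<gamma>"]
    by (simp add: case_prod_unfold)
  then show ?thesis by simp
qed

lemma fact_eq_card_permutations_mult:
  "(fact (size A) :: complex) = of_nat (card (permutations_of_multiset A)) * (\<Prod>x\<in>set_mset A. fact (count A x))"
proof -
  have "fact (size A) = card (permutations_of_multiset A) * (\<Prod>x\<in>set_mset A. fact (count A x) :: nat)"
    using card_permutations_of_multiset[of A] by simp
  from arg_cong[OF this, of "of_nat :: nat \<Rightarrow> complex"] show ?thesis by simp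
qed

definition graph_term :: "real \<Rightarrow> ('d::finite list \<Rightarrow> complex) \<Rightarrow> (real^'d \<Rightarrow> real) \<Rightarrow> bigraph \<Rightarrow> complex" where
  "graph_term h S G \<gamma> = (of_real h / \<i>) powi betti \<gamma> * pairing S G \<gamma>"

definition enumeration_weight :: "real \<Rightarrow> ('d::finite list \<Rightarrow> complex) \<Rightarrow> (real^'d \<Rightarrow> real) \<Rightarrow> (int \<times> int) list \<Rightarrow> complex" where
  "enumeration_weight h S G xs = pair_weight (black_factor h S) (white_factor h G (lin_part S)) {..<length xs} (black_partition xs) (white_partition xs)"

lemma graph_term_eq:
  fixes S :: "'d::finite list \<Rightarrow> complex" and G :: "real^'d \<Rightarrow> real"
  assumes h: "h > 0" and S: "symmetric_coeffs S" and G: "smooth G"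
    and en: "(\<gamma>, xs) \<in> enumerations n" "n > 0"
  shows "of_nat (card (permutations_of_multiset (edges \<gamma>))) * enumeration_weight h S G xs = fact n * (\<i> / of_real h * graph_term h S G \<gamma>)"
proof -
  note e = enumerationsD[OF en(1)]
  have ne: "xs \<noteq> []" using e(3) en(2) by auto
  have "size (edges \<gamma>) = n" using e(2,3) by (metis size_mset)
  then have "fact n = of_nat (card (permutations_of_multiset (edges \<gamma>))) * (\<Prod>x\<in>set_mset (edges \<gamma>). fact (count (edges \<gamma>) x) :: complex)"
    using fact_eq_card_permutations_mult[of "edges \<gamma>"] by simp
  then show ?thesis
    unfolding enumeration_weight_def enumerated_graph.pair_weight_eq[OF e(4) h S G ne e(1)] graph_term_def by (simp only: mult_ac)
qed

text \<open>A relabelled enumeration has the same partitions and hence the same weight, and isomorphic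
  graphs have equally many enumerations.\<close>

lemma graph_term_iso:
  fixes S :: "'d::finite list \<Rightarrow> complex" and G :: "real^'d \<Rightarrow> real"
  assumes h: "h > 0" and S: "symmetric_coeffs S" and G: "smooth G"
    and iso: "(\<gamma>, \<gamma>') \<in> iso_rel" and n: "size (edges \<gamma>) = n" "n > 0"
  shows "graph_term h S G \<gamma>' = graph_term h S G \<gamma>"
proof -
  obtain p q where pq: "\<gamma> \<in> Gamma_circ" "p permutes black \<gamma>" "q permutes white \<gamma>" "\<gamma>' = relabel p q \<gamma>"
    using iso unfolding iso_rel_iff by blast
  obtain xs where xs: "mset xs = edges \<gamma>" using ex_mset by blast
  then have "length xs = n" using n(1) by (metis size_mset)
  then have e: "(\<gamma>, xs) \<in> enumerations n" using pq(1) xs by (simp add: enumerations_def)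
  note e' = relabel_enumerations[OF e n(2) pq(2,3)]
  have w: "enumeration_weight h S G (map (map_prod p q) xs) = enumeration_weight h S G xs" unfolding enumeration_weight_def e'(2,3) by simp
  have inj: "inj (map_prod p q)" using permutes_inj[OF pq(2)] permutes_inj[OF pq(3)] by (rule prod.inj_map)
  have "card (permutations_of_multiset (edges \<gamma>')) = card (permutations_of_multiset (edges \<gamma>))"
    unfolding pq(4) relabel_simps permutations_of_multiset_image
    by (rule card_image) (rule inj_on_subset[OF inj_mapI[OF inj] subset_UNIV])
  moreover have "of_nat (card (permutations_of_multiset (edges \<gamma>'))) * enumeration_weight h S G xs = fact n * (\<i> / of_real h * graph_term h S G \<gamma>')"
    using graph_term_eq[OF h S G e'(1) n(2)] unfolding pq(4)[symmetric] w .
  ultimately have "fact n * (\<i> / of_real h * graph_term h S G \<gamma>') = fact n * (\<i> / of_real h * graph_term h S G \<gamma>)"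
    using graph_term_eq[OF h S G e n(2)] by (simp only:)
  then show ?thesis using h by simp
qed

text \<open>Connected pairs are replaced by enumerated graphs, enumerated graphs by numbered graphs and
  numbered graphs by isomorphism classes.\<close>

theorem connected_sum_eq_sum_graphs:
  fixes S :: "'d::finite list \<Rightarrow> complex" and G :: "real^'d \<Rightarrow> real"
  assumes h: "h > 0" and S: "symmetric_coeffs S" and G: "smooth G"
    and n: "n > 0"
  shows "connected_sum (black_factor h S) (white_factor h G (lin_part S)) {..<n} / fact n =
    \<i> / of_real h * sum_graphs (\<lambda>\<gamma>. 1 / of_nat (card (automorphisms \<gamma>)) * graph_term h S G \<gamma>) $ n"
proof -
  let ?W = "pair_weight (black_factor h S) (white_factor h G (lin_part S)) {..<n}"
  let ?L = "\<lambda>\<gamma>. complex_of_nat (card (permutations_of_multiset (edges \<gamma>)))"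
  have zero: "?W P Q = 0" if B: "B \<in> P" "finite P" "card B < 2" for P Q B
    unfolding pair_weight_def
  proof (rule sum.neutral, rule ballI)
    fix a :: "nat \<Rightarrow> 'd"
    have "black_factor h S (image_mset a (mset_set B)) = 0" using B(3) by (simp add: black_factor_def black_weight_def)
    then have "(\<Prod>B\<in>P. black_factor h S (image_mset a (mset_set B))) = 0" using B(1,2) by (intro prod_zero) blast+
    then show "(\<Prod>B\<in>P. black_factor h S (image_mset a (mset_set B))) * (\<Prod>C\<in>Q. white_factor h G (lin_part S) (image_mset a (mset_set C))) = 0" by simp
  qed
  have L0: "?L \<gamma> \<noteq> 0" for \<gamma> using fact_eq_card_permutations_mult[of "edges \<gamma>"] by (metis fact_nonzero mult_zero_left)
  have "connected_sum (black_factor h S) (white_factor h G (lin_part S)) {..<n} =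
    (\<Sum>z\<in>enumerations n. ?W (black_partition (snd z)) (white_partition (snd z)) / (fact (nblack (fst z)) * fact (nwhite (fst z))))"
    unfolding connected_sum_def by (rule sum_enumerations[OF n zero, symmetric])
  also have "\<dots> = (\<Sum>z\<in>enumerations n. (fact n * (\<i> / of_real h * graph_term h S G (fst z)) / ?L (fst z)) / (fact (nblack (fst z)) * fact (nwhite (fst z))))"
  proof (rule sum.cong[OF refl])
    fix z assume z: "z \<in> enumerations n"
    obtain \<gamma> xs where zz: "z = (\<gamma>, xs)" by (cases z)
    have e: "(\<gamma>, xs) \<in> enumerations n" using z zz by simp
    have "?W (black_partition xs) (white_partition xs) = enumeration_weight h S G xs" unfolding enumeration_weight_def enumerationsD(3)[OF e] ..
    also have "\<dots> = fact n * (\<i> / of_real h * graph_term h S G \<gamma>) / ?L \<gamma>"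
      unfolding graph_term_eq[OF h S G e n, symmetric] using L0[of \<gamma>] by simp
    finally have "?W (black_partition xs) (white_partition xs) = fact n * (\<i> / of_real h * graph_term h S G \<gamma>) / ?L \<gamma>" .
    then show "?W (black_partition (snd z)) (white_partition (snd z)) / (fact (nblack (fst z)) * fact (nwhite (fst z))) =
      (fact n * (\<i> / of_real h * graph_term h S G (fst z)) / ?L (fst z)) / (fact (nblack (fst z)) * fact (nwhite (fst z)))"
      unfolding zz fst_conv snd_conv by (rule arg_cong)
  qed
  also have "\<dots> = (\<Sum>\<gamma>\<in>graphs_of_degree n. ?L \<gamma> * ((fact n * (\<i> / of_real h * graph_term h S G \<gamma>) / ?L \<gamma>) / (fact (nblack \<gamma>) * fact (nwhite \<gamma>))))"
    by (rule sum_enumerations_eq_sum_graphs[OF n])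
  also have "\<dots> = (\<Sum>\<gamma>\<in>graphs_of_degree n. fact n * (\<i> / of_real h) * (graph_term h S G \<gamma> / (fact (nblack \<gamma>) * fact (nwhite \<gamma>))))"
    by (rule sum.cong[OF refl]) (simp add: L0)
  also have "\<dots> = fact n * (\<i> / of_real h) * (\<Sum>\<gamma>\<in>graphs_of_degree n. graph_term h S G \<gamma> / (fact (nblack \<gamma>) * fact (nwhite \<gamma>)))"
    by (rule sum_distrib_left[symmetric])
  also have "(\<Sum>\<gamma>\<in>graphs_of_degree n. graph_term h S G \<gamma> / (fact (nblack \<gamma>) * fact (nwhite \<gamma>))) =
    sum_graphs (\<lambda>\<gamma>. 1 / of_nat (card (automorphisms \<gamma>)) * graph_term h S G \<gamma>) $ n"
    by (rule sum_graphs_eq_labelled[OF n, symmetric]) (rule graph_term_iso[OF h S G _ _ n])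
  finally show ?thesis by simp
qed

lemma sum_graph_terms_nth_0:
  fixes S :: "'d::finite list \<Rightarrow> complex" and G :: "real^'d \<Rightarrow> real"
  assumes h: "h > 0" and S: "symmetric_coeffs S" and G: "smooth G"
  shows "sum_graphs (\<lambda>\<gamma>. 1 / of_nat (card (automorphisms \<gamma>)) * graph_term h S G \<gamma>) $ 0 = S [] + of_real (G (lin_part S))"
proof -
  have m: "black_vertex \<in> graphs_of_degree 0" "white_vertex \<in> graphs_of_degree 0" by (simp_all add: graphs_of_degree_0)
  have "card (vertices black_vertex) = 1" "card (vertices white_vertex) = 1"
    by (simp_all add: vertices_def black_def white_def black_vertex_def white_vertex_def)
  moreover have v: "nblack black_vertex = 1" "nwhite black_vertex = 0" "nblack white_vertex = 0" "nwhite white_vertex = 1"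
    "size (edges black_vertex) = 0" "size (edges white_vertex) = 0"
    by (simp_all add: black_vertex_def white_vertex_def)
  ultimately have b: "betti black_vertex = 0" "betti white_vertex = 0" by (simp_all add: betti_def)
  show ?thesis
    unfolding sum_graphs_nth_0 graph_term_def card_automorphisms_edgeless[OF m(1)] card_automorphisms_edgeless[OF m(2)]
      pairing_edgeless[OF S G m(1)] pairing_edgeless[OF S G m(2)] b v by simp
qed

theorem proposition2p6:
  fixes S :: "'d::finite list \<Rightarrow> complex"
    and G :: "real^'d \<Rightarrow> real"
    and h :: real
  assumes "h > 0"
    and "symmetric_coeffs S"
    and "\<And>i. S [i] \<in> \<real>"
    and "smooth G"
  shows "formal_integral h S G =
    formal_exp (fps_const (\<i> / of_real h) *
      sum_graphs (\<lambda>\<gamma>. 1 / of_nat (card (automorphisms \<gamma>)) * (of_real h / \<i>) powi betti \<gamma> * pairing S G \<gamma>))"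
proof -
  note a = assms(1,2,4)
  define W where "W = fps_const (\<i> / of_real h) * sum_graphs (\<lambda>\<gamma>. 1 / of_nat (card (automorphisms \<gamma>)) * (of_real h / \<i>) powi betti \<gamma> * pairing S G \<gamma>)"
  have W: "W = fps_const (\<i> / of_real h) * sum_graphs (\<lambda>\<gamma>. 1 / of_nat (card (automorphisms \<gamma>)) * graph_term h S G \<gamma>)"
    unfolding W_def graph_term_def by (simp only: mult.assoc)
  have W0: "W $ 0 = \<i> / of_real h * (S [] + of_real (G (lin_part S)))"
    unfolding W fps_mult_left_const_nth sum_graph_terms_nth_0[OF a] ..
  have "W - fps_const (W $ 0) = Abs_fps (\<lambda>n. if n = 0 then 0 else connected_sum (black_factor h S) (white_factor h G (lin_part S)) {..<n} / fact n)"
  proof (rule fps_ext)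
    fix n
    show "(W - fps_const (W $ 0)) $ n = Abs_fps (\<lambda>n. if n = 0 then 0 else connected_sum (black_factor h S) (white_factor h G (lin_part S)) {..<n} / fact n) $ n"
    proof (cases "n = 0")
      case False
      then have "connected_sum (black_factor h S) (white_factor h G (lin_part S)) {..<n} / fact n = W $ n"
        unfolding W using connected_sum_eq_sum_graphs[OF a, of n] by simp
      then show ?thesis using False by simp
    qed simp
  qed
  then have "formal_exp W = fps_const (exp (W $ 0)) * Abs_fps (\<lambda>n. all_sum (black_factor h S) (white_factor h G (lin_part S)) {..<n} / fact n)"
    unfolding formal_exp_def all_sum_eq_exp_connected_sum by (simp only:)
  also have "\<dots> = formal_integral h S G"
    unfolding W0 formal_integral_eq_sum_pairs[OF a] ..
  finally show ?thesis unfolding W_def by (rule sym)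
qed

end
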